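(* Let $n\in\{2,3\}$, let $\alpha>0$, and let $L_1,L_2,L_3\in\mathbb{R}$ satisfy $L_1>0$ and $L_1>|L_2+L_3|$. Let $Q_0\in H^1(\mathbb{T}^n;\mathcal{Q}_{phy})$ satisfy $\mathcal{E}(Q_0)+\|\delta\mathcal{E}(Q_0)\|_{L^2(\mathbb{T}^n)}<\infty$, and let $Q(t,x)$ be the unique global strong solution of $\partial_tQ=-\delta\mathcal{E}(Q)$ on $\mathbb{R}^+\times\mathbb{T}^n$ with $Q|_{t=0}=Q_0$. Let $T>0$. Then for a.e. $t\in(0,T)$ the contact set $\mathcal{C}(Q(t,\cdot))=\{x\in\mathbb{T}^n: f(Q(t,x))=\infty\}$ has the following properties: (i) $\mathcal{C}(Q(t,\cdot))=\emptyset$ if $n=2$; (ii) $\mathcal{C}(Q(t,\cdot))$ has Hausdorff dimension at most $1$ if $n=3$.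
   Context: $\mathbb{T}^n=\mathbb{R}^n/\mathbb{Z}^n$ is the unit torus (periodic boundary conditions). Let $\mathcal{Q}=\{M\in\mathbb{R}^{3\times3}: \operatorname{tr}M=0,\ M=M^T\}$, with inner product $A:B=\operatorname{tr}(AB)$ and Frobenius norm. For $M\in\mathcal{Q}$, $\lambda_1(M)\le\lambda_2(M)\le\lambda_3(M)$ are its eigenvalues, and $\mathcal{Q}_{phy}=\{M\in\mathcal{Q}: -\tfrac13<\lambda_1(M)\le\lambda_2(M)\le\lambda_3(M)<\tfrac23\}$. Statements that a function takes values in $\mathcal{Q}_{phy}$ are understood almost everywhere. Singular potential: for $Q\in\mathcal{Q}_{phy}$, $$f(Q)=\inf_{\rho\in\mathcal{A}_Q}\int_{\mathbb{S}^2}\rho(\mathbf{n})\ln\rho(\mathbf{n})\,d\mathbf{n},$$ where $\mathcal{A}_Q$ is the set of $\rho:\mathbb{S}^2\to\mathbb{R}_{\ge0}$ with $\|\rho\|_{L^1(\mathbb{S}^2)}=1$, $\rho(\mathbf{n})=\rho(-\mathbf{n})$ and $\int_{\mathbb{S}^2}(\mathbf{n}\mathbf{n}^T-\tfrac13\mathbb{I}_3)\rho(\mathbf{n})\,d\mathbf{n}=Q$ (with $0\ln0=0$, $d\mathbf{n}$ the surface measure, $\mathbb{I}_3$ the identity matrix); $f(Q)=+\infty$ for $Q\in\mathcal{Q}\setminus\mathcal{Q}_{phy}$. The function $f$ is smooth on $\mathcal{Q}_{phy}$; $D_Qf(Q)\in\mathcal{Q}$ denotes its gradient with respect to the inner product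 of $\mathcal{Q}$ (equivalently, the trace-free part $\frac{\partial f}{\partial Q}-\frac13\operatorname{tr}(\frac{\partial f}{\partial Q})\mathbb{I}_3$). Energy (summation over repeated indices; spatial derivatives $\partial_k$ with $k>n$ are zero): $$\mathcal{E}(Q)=\frac12\int_{\mathbb{T}^n}\big(L_1|\nabla Q|^2+L_2\,\partial_jQ_{ik}\partial_kQ_{ij}+L_3\,\partial_jQ_{ij}\partial_kQ_{ik}\big)dx+\int_{\mathbb{T}^n}f(Q)\,dx-\alpha\|Q\|_{L^2(\mathbb{T}^n)}^2.$$ Its variation $\delta\mathcal{E}(Q)$ (the $L^2$-gradient among $\mathcal{Q}$-valued maps) is given by $$-(\delta\mathcal{E}(Q))_{ij}=L_1\Delta Q_{ij}+\frac{L_2+L_3}{2}\big(\partial_j\partial_kQ_{ik}+\partial_i\partial_kQ_{jk}\big)-\frac{L_2+L_3}{3}\,\partial_k\partial_\ell Q_{\ell k}\,\delta_{ij}-(D_Qf(Q))_{ij}+2\alpha Q_{ij}.$$ For $Q_0\in H^1$ the expression $\delta\mathcal{E}(Q_0)$ is understood in the sense of distributions (with $D_Qf(Q_0)$ integrable), and the hypothesis says that it belongs to $L^2(\mathbb{T}^n)$. A global strong solution with initial data $Q_0$ is a $\mathcal{Q}_{phy}$-valued $Q$ such that, for every $T>0$, $Q\in L^2(0,T;H^2(\mathbb{T}^n))$, $\partial_tQ\in L^2(0,T;L^2(\mathbb{T}^n))$, $\partial_tQ=-\delta\mathcal{E}(Q)$ a.e. in $(0,T)\times\mathbb{T}^n$,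 and $Q(0,\cdot)=Q_0$ (with $Q\in C([0,T];L^2(\mathbb{T}^n))$). Under the stated hypotheses such a solution exists and is unique, and for every $T>0$ it satisfies $Q\in L^\infty(0,T;H^2(\mathbb{T}^n))$, $\partial_tQ\in L^\infty(0,T;L^2(\mathbb{T}^n))\cap L^2(0,T;H^1(\mathbb{T}^n))$ and $f(Q)\in L^2(0,T;H^1(\mathbb{T}^n))$ (this is the paper's existence theorem, which defines the solution referred to). In the definition of the contact set, $Q(t,\cdot)\in H^2(\mathbb{T}^n)$ is identified with its continuous representative. *)

theory Defs
  imports "HOL-Analysis.Analysis"
begin

section \<open>Q-tensors\<close>

definition Qsp :: "(real^3^3) set" where
  "Qsp = {M. trace M = 0 \<and> transpose M = M}"

text \<open>The inner product and norm of type \<open>real^3^3\<close> are the Frobenius ones; on symmetric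
  matrices the former is \<open>A : B = tr (A B)\<close>.\<close>

lemma Qsp_inner_eq_trace:
  assumes "A \<in> Qsp"
  shows "A \<bullet> B = trace (A ** B)"
proof -
  have sym: "A $ i $ j = A $ j $ i" for i j
    using assms by (auto simp: Qsp_def transpose_def vec_eq_iff)
  have "A \<bullet> B = (\<Sum>i\<in>UNIV. \<Sum>j\<in>UNIV. A $ i $ j * B $ i $ j)"
    by (simp add: inner_vec_def)
  also have "\<dots> = (\<Sum>i\<in>UNIV. \<Sum>j\<in>UNIV. A $ j $ i * B $ i $ j)"
    by (intro sum.cong refl) (metis sym)
  also have "\<dots> = (\<Sum>j\<in>UNIV. \<Sum>i\<in>UNIV. A $ j $ i * B $ i $ j)"
    by (rule sum.swap)
  also have "\<dots> = trace (A ** B)"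
    by (simp add: trace_def matrix_matrix_mult_def)
  finally show ?thesis .
qed

definition eigenvalues :: "real^3^3 \<Rightarrow> real set" where
  "eigenvalues M = {l. \<exists>v. v \<noteq> 0 \<and> M *v v = l *\<^sub>R v}"

definition Qphy :: "(real^3^3) set" where
  "Qphy = {M \<in> Qsp. \<forall>l\<in>eigenvalues M. - 1/3 < l \<and> l < 2/3}"


section \<open>The singular potential\<close>

text \<open>Surface measure on the unit sphere, by polar coordinates: the measure of \<open>A\<close> is three
  times the volume of the cone \<open>{r n | n \<in> A, 0 < r < 1}\<close>.\<close>

definition S2 :: "(real^3) measure" where
  "S2 = scale_measure 3
     (distr (restrict_space lborel (ball 0 1 - {0})) (restrict_space borel (sphere 0 1))
       (\<lambda>x. x /\<^sub>R norm x))"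

text \<open>Lebesgue integral with values in the extended reals, as the difference of the integrals of
  the positive and the negative part (\<open>e2ennreal\<close> truncates negative values to \<open>0\<close>). It is only
  used for integrands that are bounded below on spaces of finite measure.\<close>

definition ereal_integral :: "'a measure \<Rightarrow> ('a \<Rightarrow> ereal) \<Rightarrow> ereal" where
  "ereal_integral M g =
     enn2ereal (\<integral>\<^sup>+ x. e2ennreal (g x) \<partial>M) - enn2ereal (\<integral>\<^sup>+ x. e2ennreal (- g x) \<partial>M)"

definition admissible :: "real^3^3 \<Rightarrow> (real^3 \<Rightarrow> real) set" where
  "admissible Q = {\<rho>. \<rho> \<in> borel_measurable S2 \<and>
     (\<forall>v\<in>sphere 0 1. \<rho> v \<ge> 0 \<and> \<rho> (- v) = \<rho> v) \<and>
     integrable S2 \<rho> \<and> (\<integral> v. \<rho> v \<partial>S2) = 1 \<and>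
     (\<integral> v. \<rho> v *\<^sub>R ((\<chi> i j. v $ i * v $ j) - (1/3) *\<^sub>R mat 1) \<partial>S2) = Q}"

text \<open>Note that \<open>0 * ln 0 = 0\<close> in HOL.\<close>

definition entropy :: "(real^3 \<Rightarrow> real) \<Rightarrow> ereal" where
  "entropy \<rho> = ereal_integral S2 (\<lambda>v. ereal (\<rho> v * ln (\<rho> v)))"

definition singular_potential :: "real^3^3 \<Rightarrow> ereal" where
  "singular_potential Q = (if Q \<in> Qphy then (INF \<rho>\<in>admissible Q. entropy \<rho>) else \<infinity>)"

text \<open>The gradient within the space \<open>Qsp\<close>, at points of its relatively open subset \<open>Qphy\<close>,
  near which the potential is finite and agrees with its real-valued version.\<close>

definition DQf :: "real^3^3 \<Rightarrow> real^3^3" where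
  "DQf Q = (THE G. G \<in> Qsp \<and>
     ((\<lambda>P. real_of_ereal (singular_potential P)) has_derivative (\<lambda>H. G \<bullet> H)) (at Q within Qsp))"


section \<open>Functions on the torus\<close>

text \<open>The torus \<open>\<real>\<^sup>n / \<int>\<^sup>n\<close> is represented by the half-open unit cell (with the quotient metric
  \<open>torus_dist\<close> below), functions on it by their periodic lifts to \<open>\<real>\<^sup>n\<close>.\<close>

definition unit_cell :: "(real^'n) set" where
  "unit_cell = {x. \<forall>i. 0 \<le> x $ i \<and> x $ i < 1}"

definition periodic :: "(real^'n \<Rightarrow> 'b) \<Rightarrow> bool" where
  "periodic u \<longleftrightarrow> (\<forall>x i. u (x + axis i 1) = u x)"

definition dir_deriv :: "'a::euclidean_space \<Rightarrow> ('a \<Rightarrow> real) \<Rightarrow> 'a \<Rightarrow> real" where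
  "dir_deriv w \<phi> = (\<lambda>x. frechet_derivative \<phi> (at x) w)"

definition smooth :: "('a::euclidean_space \<Rightarrow> real) \<Rightarrow> bool" where
  "smooth \<phi> \<longleftrightarrow> (\<forall>ws x. foldr dir_deriv ws \<phi> differentiable (at x))"

definition torus_test :: "(real^'n::finite \<Rightarrow> real) set" where
  "torus_test = {\<phi>. smooth \<phi> \<and> periodic \<phi>}"

definition in_L2 :: "(real^'n::finite \<Rightarrow> 'b::euclidean_space) \<Rightarrow> bool" where
  "in_L2 u \<longleftrightarrow> periodic u \<and> u \<in> borel_measurable (lebesgue_on unit_cell) \<and>
     integrable (lebesgue_on unit_cell) (\<lambda>x. (norm (u x))\<^sup>2)"

definition L2_norm :: "(real^'n::finite \<Rightarrow> 'b::euclidean_space) \<Rightarrow> real" where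
  "L2_norm u = sqrt (\<integral> x. (norm (u x))\<^sup>2 \<partial>lebesgue_on unit_cell)"

text \<open>\<open>v\<close> is the distributional derivative of \<open>u\<close> in the direction \<open>w\<close>.\<close>

definition has_weak_deriv ::
    "real^'n::finite \<Rightarrow> (real^'n \<Rightarrow> 'b::euclidean_space) \<Rightarrow> (real^'n \<Rightarrow> 'b) \<Rightarrow> bool" where
  "has_weak_deriv w u v \<longleftrightarrow>
     periodic u \<and> integrable (lebesgue_on unit_cell) u \<and>
     periodic v \<and> integrable (lebesgue_on unit_cell) v \<and>
     (\<forall>\<phi>\<in>torus_test. (\<integral> x. dir_deriv w \<phi> x *\<^sub>R u x \<partial>lebesgue_on unit_cell) =
        - (\<integral> x. \<phi> x *\<^sub>R v x \<partial>lebesgue_on unit_cell))"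

text \<open>Determined up to null sets whenever a weak derivative exists.\<close>

definition weak_deriv ::
    "real^'n::finite \<Rightarrow> (real^'n \<Rightarrow> 'b::euclidean_space) \<Rightarrow> real^'n \<Rightarrow> 'b" where
  "weak_deriv w u = (SOME v. has_weak_deriv w u v)"

definition in_H1 :: "(real^'n::finite \<Rightarrow> 'b::euclidean_space) \<Rightarrow> bool" where
  "in_H1 u \<longleftrightarrow> in_L2 u \<and> (\<forall>i. \<exists>v. in_L2 v \<and> has_weak_deriv (axis i 1) u v)"

definition in_H2 :: "(real^'n::finite \<Rightarrow> 'b::euclidean_space) \<Rightarrow> bool" where
  "in_H2 u \<longleftrightarrow> in_H1 u \<and> (\<forall>i. in_H1 (weak_deriv (axis i 1) u))"

definition H2_norm :: "(real^'n::finite \<Rightarrow> 'b::euclidean_space) \<Rightarrow> real" where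
  "H2_norm u = sqrt ((L2_norm u)\<^sup>2 + (\<Sum>i\<in>UNIV. (L2_norm (weak_deriv (axis i 1) u))\<^sup>2) +
     (\<Sum>i\<in>UNIV. \<Sum>j\<in>UNIV. (L2_norm (weak_deriv (axis j 1) (weak_deriv (axis i 1) u)))\<^sup>2))"


section \<open>The energy and its variation\<close>

text \<open>The coordinates of \<open>\<real>\<^sup>n\<close> are indexed by a type \<open>'n\<close>, the rows and columns of a Q-tensor by
  the type \<open>3\<close>. A map \<open>lab\<close> gives every coordinate its number among \<open>1, \<dots>, n\<close>.
  The direction belonging to an index \<open>k > n\<close> is \<open>0\<close>, so that the derivative \<open>\<partial>\<^sub>k\<close> vanishes.\<close>

definition coord_dir :: "('n \<Rightarrow> 3) \<Rightarrow> 3 \<Rightarrow> real^'n" where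
  "coord_dir lab k = (\<chi> i. if lab i = k then 1 else 0)"

text \<open>\<open>\<partial>\<^sub>k Q\<^sub>i\<^sub>j\<close> and \<open>\<partial>\<^sub>k \<partial>\<^sub>l Q\<^sub>i\<^sub>j\<close>, for Q-tensor fields and for test functions.\<close>

definition d1 :: "('n::finite \<Rightarrow> 3) \<Rightarrow> (real^'n \<Rightarrow> real^3^3) \<Rightarrow> 3 \<Rightarrow> 3 \<Rightarrow> 3 \<Rightarrow> real^'n \<Rightarrow> real" where
  "d1 lab Q k i j = weak_deriv (coord_dir lab k) (\<lambda>x. Q x $ i $ j)"

definition d2 ::
    "('n::finite \<Rightarrow> 3) \<Rightarrow> (real^'n \<Rightarrow> real^3^3) \<Rightarrow> 3 \<Rightarrow> 3 \<Rightarrow> 3 \<Rightarrow> 3 \<Rightarrow> real^'n \<Rightarrow> real" where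
  "d2 lab Q k l i j = weak_deriv (coord_dir lab k) (weak_deriv (coord_dir lab l) (\<lambda>x. Q x $ i $ j))"

definition test_d2 :: "('n::finite \<Rightarrow> 3) \<Rightarrow> (real^'n \<Rightarrow> real) \<Rightarrow> 3 \<Rightarrow> 3 \<Rightarrow> real^'n \<Rightarrow> real" where
  "test_d2 lab \<phi> k l = dir_deriv (coord_dir lab k) (dir_deriv (coord_dir lab l) \<phi>)"

definition elastic_density ::
    "('n::finite \<Rightarrow> 3) \<Rightarrow> real \<Rightarrow> real \<Rightarrow> real \<Rightarrow> (real^'n \<Rightarrow> real^3^3) \<Rightarrow> real^'n \<Rightarrow> real" where
  "elastic_density lab L1 L2 L3 Q x =
     L1 * (\<Sum>i\<in>UNIV. \<Sum>j\<in>UNIV. \<Sum>k\<in>UNIV. (d1 lab Q k i j x)\<^sup>2) +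
     L2 * (\<Sum>i\<in>UNIV. \<Sum>j\<in>UNIV. \<Sum>k\<in>UNIV. d1 lab Q j i k x * d1 lab Q k i j x) +
     L3 * (\<Sum>i\<in>UNIV. \<Sum>j\<in>UNIV. \<Sum>k\<in>UNIV. d1 lab Q j i j x * d1 lab Q k i k x)"

definition energy ::
    "('n::finite \<Rightarrow> 3) \<Rightarrow> real \<Rightarrow> real \<Rightarrow> real \<Rightarrow> real \<Rightarrow> (real^'n \<Rightarrow> real^3^3) \<Rightarrow> ereal" where
  "energy lab L1 L2 L3 \<alpha> Q =
     ereal (1/2 * (\<integral> x. elastic_density lab L1 L2 L3 Q x \<partial>lebesgue_on unit_cell)) +
     ereal_integral (lebesgue_on unit_cell) (\<lambda>x. singular_potential (Q x)) -
     ereal (\<alpha> * (L2_norm Q)\<^sup>2)"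

definition variation ::
    "('n::finite \<Rightarrow> 3) \<Rightarrow> real \<Rightarrow> real \<Rightarrow> real \<Rightarrow> real \<Rightarrow> (real^'n \<Rightarrow> real^3^3) \<Rightarrow> real^'n \<Rightarrow> real^3^3" where
  "variation lab L1 L2 L3 \<alpha> Q x = - (\<chi> i j.
     L1 * (\<Sum>k\<in>UNIV. d2 lab Q k k i j x) +
     (L2 + L3) / 2 * (\<Sum>k\<in>UNIV. d2 lab Q j k i k x + d2 lab Q i k j k x) -
     (L2 + L3) / 3 * (\<Sum>k\<in>UNIV. \<Sum>l\<in>UNIV. d2 lab Q k l l k x) * (if i = j then 1 else 0) -
     DQf (Q x) $ i $ j + 2 * \<alpha> * Q x $ i $ j)"

text \<open>The same expression in the sense of distributions, for \<open>Q\<close> with integrable \<open>DQf (Q x)\<close>: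
  \<open>G\<close> is the variation at \<open>Q\<close>.\<close>

definition distr_variation ::
    "('n::finite \<Rightarrow> 3) \<Rightarrow> real \<Rightarrow> real \<Rightarrow> real \<Rightarrow> real \<Rightarrow>
      (real^'n \<Rightarrow> real^3^3) \<Rightarrow> (real^'n \<Rightarrow> real^3^3) \<Rightarrow> bool" where
  "distr_variation lab L1 L2 L3 \<alpha> Q G \<longleftrightarrow>
     integrable (lebesgue_on unit_cell) (\<lambda>x. DQf (Q x)) \<and>
     (\<forall>\<phi>\<in>torus_test. \<forall>i j.
        let pair = (\<lambda>u \<psi>. \<integral> x. u x * \<psi> x \<partial>lebesgue_on unit_cell) in
        - pair (\<lambda>x. G x $ i $ j) \<phi> =
          L1 * (\<Sum>k\<in>UNIV. pair (\<lambda>x. Q x $ i $ j) (test_d2 lab \<phi> k k)) +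
          (L2 + L3) / 2 * (\<Sum>k\<in>UNIV. pair (\<lambda>x. Q x $ i $ k) (test_d2 lab \<phi> j k) +
                                        pair (\<lambda>x. Q x $ j $ k) (test_d2 lab \<phi> i k)) -
          (L2 + L3) / 3 * (\<Sum>k\<in>UNIV. \<Sum>l\<in>UNIV. pair (\<lambda>x. Q x $ l $ k) (test_d2 lab \<phi> k l)) *
            (if i = j then 1 else 0) -
          pair (\<lambda>x. DQf (Q x) $ i $ j) \<phi> + 2 * \<alpha> * pair (\<lambda>x. Q x $ i $ j) \<phi>)"


section \<open>Strong solutions\<close>

definition space_time :: "real \<Rightarrow> (real \<times> (real^'n::finite)) measure" where
  "space_time T = lebesgue_on ({0<..<T} \<times> unit_cell)"

text \<open>\<open>P\<close> is the weak derivative \<open>\<partial>\<^sub>t Q\<close> on \<open>(0,T)\<close> of the \<open>L\<^sup>2\<close>-valued function \<open>Q\<close>.\<close>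

definition has_weak_time_deriv ::
    "real \<Rightarrow> (real \<Rightarrow> real^'n::finite \<Rightarrow> real^3^3) \<Rightarrow> (real \<Rightarrow> real^'n \<Rightarrow> real^3^3) \<Rightarrow> bool" where
  "has_weak_time_deriv T Q P \<longleftrightarrow>
     (\<forall>\<psi>::real \<Rightarrow> real. smooth \<psi> \<and> (\<exists>a b. 0 < a \<and> b < T \<and> (\<forall>t. t \<notin> {a..b} \<longrightarrow> \<psi> t = 0)) \<longrightarrow>
        (AE x in lebesgue_on unit_cell.
           (\<integral> t. deriv \<psi> t *\<^sub>R Q t x \<partial>lebesgue_on {0<..<T}) =
           - (\<integral> t. \<psi> t *\<^sub>R P t x \<partial>lebesgue_on {0<..<T})))"

text \<open>In the last conjunct the equation is stated for a.e. \<open>t\<close> and a.e. \<open>x\<close>, rather than a.e. for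
  the product measure, because \<open>weak_deriv\<close> picks a representative separately for every \<open>t\<close>.\<close>

definition strong_solution_on ::
    "('n::finite \<Rightarrow> 3) \<Rightarrow> real \<Rightarrow> real \<Rightarrow> real \<Rightarrow> real \<Rightarrow> real \<Rightarrow>
      (real \<Rightarrow> real^'n \<Rightarrow> real^3^3) \<Rightarrow> bool" where
  "strong_solution_on lab L1 L2 L3 \<alpha> T Q \<longleftrightarrow>
     (AE (t, x) in space_time T. Q t x \<in> Qphy) \<and>
     \<comment> \<open>\<open>Q \<in> C([0,T]; L\<^sup>2)\<close>\<close>
     (\<forall>t\<in>{0..T}. in_L2 (Q t) \<and>
        ((\<lambda>s. L2_norm (\<lambda>x. Q s x - Q t x)) \<longlongrightarrow> 0) (at t within {0..T})) \<and>
     \<comment> \<open>\<open>Q \<in> L\<^sup>2(0,T; H\<^sup>2)\<close>\<close>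
     (\<lambda>(t, x). Q t x) \<in> borel_measurable (space_time T) \<and>
     (AE t in lebesgue_on {0<..<T}. in_H2 (Q t)) \<and>
     (\<integral>\<^sup>+ t. ennreal ((H2_norm (Q t))\<^sup>2) \<partial>lebesgue_on {0<..<T}) < \<infinity> \<and>
     \<comment> \<open>\<open>\<partial>\<^sub>t Q \<in> L\<^sup>2(0,T; L\<^sup>2)\<close>, and the equation\<close>
     (\<exists>P. (\<lambda>(t, x). P t x) \<in> borel_measurable (space_time T) \<and>
        integrable (space_time T) (\<lambda>(t, x). (norm (P t x))\<^sup>2) \<and>
        has_weak_time_deriv T Q P \<and>
        (AE t in lebesgue_on {0<..<T}. AE x in lebesgue_on unit_cell.
           P t x = - variation lab L1 L2 L3 \<alpha> (Q t) x))"

definition global_strong_solution ::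
    "('n::finite \<Rightarrow> 3) \<Rightarrow> real \<Rightarrow> real \<Rightarrow> real \<Rightarrow> real \<Rightarrow>
      (real^'n \<Rightarrow> real^3^3) \<Rightarrow> (real \<Rightarrow> real^'n \<Rightarrow> real^3^3) \<Rightarrow> bool" where
  "global_strong_solution lab L1 L2 L3 \<alpha> Q0 Q \<longleftrightarrow>
     (\<forall>T>0. strong_solution_on lab L1 L2 L3 \<alpha> T Q) \<and>
     (AE x in lebesgue_on unit_cell. Q 0 x = Q0 x)"


section \<open>Contact set and Hausdorff dimension\<close>

definition continuous_rep :: "(real^'n::finite \<Rightarrow> 'b::euclidean_space) \<Rightarrow> (real^'n \<Rightarrow> 'b) \<Rightarrow> bool" where
  "continuous_rep v u \<longleftrightarrow>
     periodic u \<and> continuous_on UNIV u \<and> (AE x in lebesgue_on unit_cell. u x = v x)"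

definition contact_set :: "(real^'n \<Rightarrow> real^3^3) \<Rightarrow> (real^'n) set" where
  "contact_set u = {x \<in> unit_cell. singular_potential (u x) = \<infinity>}"

definition torus_dist :: "real^'n::finite \<Rightarrow> real^'n \<Rightarrow> real" where
  "torus_dist x y = (INF k\<in>{k. \<forall>i. k $ i \<in> \<int>}. dist x (y + k))"

definition diam :: "('a \<Rightarrow> 'a \<Rightarrow> real) \<Rightarrow> 'a set \<Rightarrow> real" where
  "diam d U = (if U = {} then 0 else (SUP (x, y)\<in>U \<times> U. d x y))"

text \<open>Hausdorff measure with respect to a distance function \<open>d\<close>, for \<open>s > 0\<close>
  (note that \<open>0 powr 0 = 0\<close>).\<close>

definition hausdorff_measure :: "('a \<Rightarrow> 'a \<Rightarrow> real) \<Rightarrow> real \<Rightarrow> 'a set \<Rightarrow> ennreal" where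
  "hausdorff_measure d s A = (SUP \<delta>\<in>{0<..}.
     INF U\<in>{U :: nat \<Rightarrow> 'a set. A \<subseteq> (\<Union>m. U m) \<and> (\<forall>m. \<forall>x\<in>U m. \<forall>y\<in>U m. d x y \<le> \<delta>)}.
       (\<Sum>m. ennreal (diam d (U m) powr s)))"

definition hausdorff_dim :: "('a \<Rightarrow> 'a \<Rightarrow> real) \<Rightarrow> 'a set \<Rightarrow> ereal" where
  "hausdorff_dim d A = Inf {ereal s | s. s > 0 \<and> hausdorff_measure d s A = 0}"

end

theory Submission
  imports Defs
begin

text \<open>At almost every time the solution is an \<open>H\<^sup>2\<close> map \<open>v\<close> on the torus with values in
  \<open>Qphy\<close> almost everywhere, and the equation expresses \<open>DQf v\<close> by second derivatives of \<open>v\<close>, by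
  \<open>v\<close> and by the time derivative, so that \<open>DQf v\<close> is square integrable. The theorem is therefore a
  statement about one such map, and it follows from two estimates.

  The first is about the potential. Every \<open>Q\<close> in \<open>Qphy\<close> is the second moment of a Gibbs density
  \<open>\<rho>\<close> proportional to \<open>exp (B : n n)\<close> on the sphere, and \<open>DQf Q = B\<close>: Gibbs' inequality bounds the
  potential near \<open>Q\<close> from below by an affine function with gradient \<open>B\<close>, and linearly tilted
  Gibbs densities bound it from above up to a quadratic error. For a unit vector \<open>e\<close> one has
  \<open>e \<bullet> Q e + 1/3 = \<integral> \<rho>(n) (n \<bullet> e)\<^sup>2\<close>. This cannot be much smaller than \<open>1 / (1 + |B|)\<close>: turning the
  sphere by an angle of order \<open>(1 + |B|) powr (-1/2)\<close> in both directions does not decrease the mean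
  of \<open>\<rho>\<close> by more than a constant factor, because \<open>B : n n\<close> changes in opposite ways to first order
  and by a bounded amount to second order. Hence \<open>1 / (e \<bullet> Q e + 1/3) \<le> C (1 + |DQf Q|)\<close>
  (\<open>DQf_blowup\<close>).

  The second is about functions with a weak Laplacian \<open>h\<close> in \<open>L\<^sup>2\<close>. The derivative in \<open>r\<close> of a radial
  average of \<open>v\<close> at scale \<open>r\<close> is \<open>r\<close> times a radial average of \<open>h\<close> at scale \<open>r\<close>. In dimension \<open>n < 4\<close> the
  Cauchy-Schwarz inequality makes it integrable down to \<open>r = 0\<close>; so the averages converge
  uniformly, their limit is the continuous representative \<open>u\<close>, and their distance from \<open>u x\<close> is at
  most \<open>C r powr (2 - n/2)\<close> times the \<open>L\<^sup>2\<close> norm of \<open>h\<close> in the ball of radius \<open>r\<close> around \<open>x\<close>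
  (\<open>mollify_scale_estimate\<close>, \<open>continuous_representative\<close>).

  If \<open>x\<close> is a contact point, then \<open>e \<bullet> u x e = - 1/3\<close> for some unit vector \<open>e\<close>. The function
  \<open>g = e \<bullet> v e + 1/3\<close> is nonnegative, its average around \<open>x\<close> is small by the second estimate, and
  by the first estimate the integral of \<open>g\<^sup>-\<^sup>2\<close> is controlled by that of \<open>(1 + |DQf v|)\<^sup>2\<close>. As \<open>g\<close> and
  \<open>1 / g\<close> are not both small, the ball of radius \<open>r\<close> around \<open>x\<close> carries at least \<open>\<kappa> r powr (n - 2)\<close> of the
  integral of a fixed integrable function (\<open>zero_costs_energy\<close>, \<open>contact_points_carry_energy\<close>). For
  \<open>n = 2\<close> this is absurd as \<open>r\<close> tends to \<open>0\<close>. For \<open>n = 3\<close> it bounds the number of \<open>2 r\<close>-separated contact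
  points by \<open>C / r\<close>, so that the \<open>s\<close>-dimensional Hausdorff measure of the contact set vanishes for
  every \<open>s > 1\<close>.\<close>

text \<open>All powers of \<open>1 / t\<close> are included so that the family is closed under differentiation up to linear
  combinations.\<close>

section \<open>Smooth test functions supported in small balls of the torus\<close>

definition bump :: "nat \<Rightarrow> real \<Rightarrow> real" where
  "bump k t = (if t > 0 then (1 / t) ^ k * exp (- (1 / t)) else 0)"

lemma bump_nonneg: "bump k t \<ge> 0"
  by (simp add: bump_def)

lemma bump_pos: "t > 0 \<Longrightarrow> bump k t > 0"
  by (simp add: bump_def)

lemma bump_eq_0: "t \<le> 0 \<Longrightarrow> bump k t = 0"
  by (simp add: bump_def)

lemma bump_tendsto_0: "(bump k \<longlongrightarrow> 0) (at 0)"
  unfolding filterlim_at_split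
proof
  show "(bump k \<longlongrightarrow> 0) (at_left 0)"
    by (rule tendsto_eventually) (auto simp: eventually_at_filter bump_def)
  have "((\<lambda>t::real. inverse t ^ k / exp (inverse t)) \<longlongrightarrow> 0) (at_right 0)"
    by (rule filterlim_compose[OF tendsto_power_div_exp_0 filterlim_inverse_at_top_right])
  moreover have "\<forall>\<^sub>F t in at_right 0. inverse t ^ k / exp (inverse t) = bump k t"
    by (auto simp: eventually_at_filter bump_def exp_minus divide_inverse)
  ultimately show "(bump k \<longlongrightarrow> 0) (at_right 0)"
    by (rule Lim_transform_eventually)
qed

lemma inverse_power_has_derivative:
  fixes t :: real
  assumes "t \<noteq> 0"
  shows "((\<lambda>t. (1 / t) ^ k) has_real_derivative - real k * (1 / t) ^ (k + 1)) (at t)"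
proof -
  have g: "((\<lambda>t. 1 / t) has_real_derivative - (1 / t)\<^sup>2) (at t)"
    using assms by (auto intro!: derivative_eq_intros simp: power2_eq_square)
  show ?thesis
  proof (cases k)
    case (Suc j)
    have eq: "real (Suc j) * (- u\<^sup>2 * u ^ j) = - real (Suc j) * u ^ (Suc j + 1)" for u :: real
      by (simp add: power2_eq_square algebra_simps)
    show ?thesis
      unfolding Suc by (rule DERIV_cong[OF DERIV_power[OF g]])
        (use eq[of "1 / t"] in \<open>simp only: diff_Suc_Suc diff_zero\<close>)
  qed simp
qed

lemma bump_has_derivative:
  "(bump k has_real_derivative bump (k + 2) t - real k * bump (k + 1) t) (at t)"
proof -
  consider "t > 0" | "t < 0" | "t = 0" by linarith
  thus ?thesis
  proof cases
    case 1
    have "((\<lambda>t. (1 / t) ^ k * exp (- (1 / t))) has_real_derivative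
        bump (k + 2) t - real k * bump (k + 1) t) (at t)"
    proof -
      have "((\<lambda>t. exp (- (1 / t))) has_real_derivative exp (- (1 / t)) * (1 / t)\<^sup>2) (at t)"
        using 1 by (auto intro!: derivative_eq_intros simp: power2_eq_square)
      from DERIV_mult[OF inverse_power_has_derivative this, of k] show ?thesis
        using 1 by (simp add: bump_def power2_eq_square algebra_simps)
    qed
    moreover have "eventually (\<lambda>s. s \<in> {0<..}) (nhds t)"
      using 1 by (intro eventually_nhds_in_open) auto
    hence "\<forall>\<^sub>F s in nhds t. bump k s = (1 / s) ^ k * exp (- (1 / s))"
      by eventually_elim (simp add: bump_def)
    ultimately show ?thesis
      by (subst DERIV_cong_ev[OF refl _ refl])
  next
    case 2
    have "eventually (\<lambda>s. s \<in> {..<0}) (nhds t)"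
      using 2 by (intro eventually_nhds_in_open) auto
    hence ev: "\<forall>\<^sub>F s in nhds t. bump k s = 0"
      by eventually_elim (simp add: bump_def)
    show ?thesis
      using 2 by (subst DERIV_cong_ev[OF refl ev refl]) (simp add: bump_def)
  next
    case 3
    have "\<forall>\<^sub>F h in at 0. bump (Suc k) h = (bump k (0 + h) - bump k 0) / h"
      by (auto simp: eventually_at_filter bump_def)
    from Lim_transform_eventually[OF bump_tendsto_0 this] show ?thesis
      by (simp add: 3 DERIV_def bump_def)
  qed
qed

lemma isCont_bump: "isCont (bump k) t"
  by (rule DERIV_isCont[OF bump_has_derivative])

lemma continuous_on_bump [continuous_intros]:
  "continuous_on S f \<Longrightarrow> continuous_on S (\<lambda>x. bump k (f x))"
  by (rule continuous_on_compose2[of UNIV "bump k"])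
     (auto intro!: continuous_at_imp_continuous_on isCont_bump)

lemma bump_field_derivative [derivative_intros]:
  "(f has_derivative f') (at x within S) \<Longrightarrow>
   ((\<lambda>x. bump k (f x)) has_derivative
     (\<lambda>h. f' h * (bump (k + 2) (f x) - real k * bump (k + 1) (f x)))) (at x within S)"
  using has_derivative_compose[of f f' x S "bump k"
      "\<lambda>h. h * (bump (k + 2) (f x) - real k * bump (k + 1) (f x))"]
    bump_has_derivative[of k "f x"]
  by (simp add: has_field_derivative_def mult_commute_abs)

text \<open>The functions \<open>p(z) b(1 - |z|\<^sup>2)\<close> with a polynomial \<open>p\<close> and a bump \<open>b\<close>, and their sums. Smoothness is
  an assertion about all iterated directional derivatives; it follows because this class contains
  the derivatives of its members.\<close>

inductive bump_poly :: "('a::euclidean_space \<Rightarrow> real) \<Rightarrow> bool" where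
  base: "bump_poly (\<lambda>z. bump k (1 - z \<bullet> z))"
| add: "bump_poly a \<Longrightarrow> bump_poly b \<Longrightarrow> bump_poly (\<lambda>z. a z + b z)"
| cmult: "bump_poly a \<Longrightarrow> bump_poly (\<lambda>z. c * a z)"
| inner: "bump_poly a \<Longrightarrow> bump_poly (\<lambda>z. (z \<bullet> v) * a z)"

lemma bump_poly_support: "bump_poly a \<Longrightarrow> norm z \<ge> 1 \<Longrightarrow> a z = 0"
proof (induction rule: bump_poly.induct)
  case (base k)
  hence "1 \<le> (norm z)\<^sup>2" by (simp add: one_le_power)
  thus ?case by (simp add: bump_eq_0 power2_norm_eq_inner)
qed auto

lemma bump_poly_has_derivative:
  "bump_poly a \<Longrightarrow> \<exists>a'. (\<forall>z. (a has_derivative a' z) (at z)) \<and> (\<forall>w. bump_poly (\<lambda>z. a' z w))"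
proof (induction rule: bump_poly.induct)
  case (base k)
  let ?a' = "\<lambda>z w. (- 2) * ((z \<bullet> w) * bump (k + 2) (1 - z \<bullet> z)) + 2 * real k * ((z \<bullet> w) * bump (k + 1) (1 - z \<bullet> z))"
  have "((\<lambda>z. bump k (1 - z \<bullet> z)) has_derivative ?a' z) (at z)" for z :: 'a
    by (auto intro!: derivative_eq_intros simp: inner_commute algebra_simps)
  moreover have "bump_poly (\<lambda>z. ?a' z w)" for w :: 'a
    by (intro bump_poly.intros)
  ultimately show ?case by (intro exI[of _ ?a']) blast
next
  case (add a b)
  then obtain a' b' where "\<forall>z. (a has_derivative a' z) (at z)" "\<forall>w. bump_poly (\<lambda>z. a' z w)"
    "\<forall>z. (b has_derivative b' z) (at z)" "\<forall>w. bump_poly (\<lambda>z. b' z w)" by blast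
  thus ?case
    by (intro exI[of _ "\<lambda>z w. a' z w + b' z w"]) (auto intro!: derivative_eq_intros bump_poly.add)
next
  case (cmult a c)
  then obtain a' where "\<forall>z. (a has_derivative a' z) (at z)" "\<forall>w. bump_poly (\<lambda>z. a' z w)" by blast
  thus ?case
    by (intro exI[of _ "\<lambda>z w. c * a' z w"]) (auto intro!: derivative_eq_intros bump_poly.cmult)
next
  case (inner a v)
  then obtain a' where a': "\<forall>z. (a has_derivative a' z) (at z)" "\<forall>w. bump_poly (\<lambda>z. a' z w)" by blast
  have "bump_poly (\<lambda>z. (w \<bullet> v) * a z + (z \<bullet> v) * a' z w)" for w
    using a' inner by (intro bump_poly.intros) auto
  moreover have "((\<lambda>z. (z \<bullet> v) * a z) has_derivative (\<lambda>w. (w \<bullet> v) * a z + (z \<bullet> v) * a' z w)) (at z)" for z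
    using a'(1) by (auto intro!: derivative_eq_intros)
  ultimately show ?case
    by (intro exI[of _ "\<lambda>z w. (w \<bullet> v) * a z + (z \<bullet> v) * a' z w"]) blast
qed

lemma continuous_on_bump_poly:
  assumes "bump_poly a"
  shows "continuous_on S a"
proof -
  obtain a' where "\<And>z. (a has_derivative a' z) (at z)" using bump_poly_has_derivative[OF assms] by auto
  from has_derivative_continuous[OF this] show ?thesis
    by (intro continuous_at_imp_continuous_on) simp
qed

text \<open>The representative modulo \<open>\<int>\<^sup>n\<close> in the cell centred at the origin. Functions of \<open>wrap (y - x)\<close> are
  periodic in \<open>y\<close>, and near \<open>y = x\<close> they are translates of functions on \<open>\<real>\<^sup>n\<close>.\<close>

definition wrap :: "real^'n \<Rightarrow> real^'n" where
  "wrap z = (\<chi> i. z $ i - of_int (round (z $ i)))"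

lemma wrap_add_integer: "(\<And>i. k $ i \<in> \<int>) \<Longrightarrow> wrap (z + k) = wrap z"
proof -
  assume k: "\<And>i. k $ i \<in> \<int>"
  have shift: "round (x + of_int m) = round x + m" for x :: real and m
  proof -
    have "x + of_int m + 1/2 = (x + 1/2) + of_int m" by simp
    thus ?thesis by (simp only: round_def floor_add_int)
  qed
  have "z $ i + k $ i - of_int (round (z $ i + k $ i)) = z $ i - of_int (round (z $ i))" for i
    using k[of i] by (auto simp: shift elim!: Ints_cases)
  thus ?thesis by (simp add: wrap_def vec_eq_iff)
qed

lemma axis_integer: "axis i (1::real) $ j \<in> \<int>"
  by (simp add: axis_def)

lemma wrap_add_axis: "wrap (z + axis i 1) = wrap z"
  by (rule wrap_add_integer) (rule axis_integer)

lemma wrap_diff_integer: "(z - wrap z) $ i \<in> \<int>"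
  by (simp add: wrap_def)

lemma periodic_wrap: "periodic (\<lambda>y. F (wrap (y - x)))"
  using wrap_add_axis[of "_ - x"] by (simp add: periodic_def diff_add_eq)

lemma wrap_locally_translation:
  fixes z :: "real^'n"
  assumes "\<And>i. \<bar>wrap z $ i\<bar> < 1/2"
  shows "\<forall>\<^sub>F z' in nhds z. wrap z' = wrap z + (z' - z)"
proof -
  have "\<forall>\<^sub>F z' in nhds z. round (z' $ i) = round (z $ i)" for i
  proof -
    have "\<forall>\<^sub>F z' in nhds z. \<bar>z' $ i - of_int (round (z $ i))\<bar> < 1/2"
    proof (rule order_tendstoD)
      show "((\<lambda>z'. \<bar>z' $ i - of_int (round (z $ i))\<bar>) \<longlongrightarrow> \<bar>z $ i - of_int (round (z $ i))\<bar>) (nhds z)"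
        by (intro tendsto_intros filterlim_ident)
      show "\<bar>z $ i - of_int (round (z $ i))\<bar> < 1/2" using assms[of i] by (simp add: wrap_def)
    qed
    thus ?thesis
    proof eventually_elim
      case (elim z')
      thus ?case by (intro round_unique) arith+
    qed
  qed
  hence "\<forall>\<^sub>F z' in nhds z. \<forall>i. round (z' $ i) = round (z $ i)"
    by (rule eventually_all_finite)
  thus ?thesis by eventually_elim (simp add: wrap_def vec_eq_iff)
qed

text \<open>Where \<open>wrap\<close> jumps its norm is at least \<open>1/2\<close>; hence functions supported in a ball of radius
  \<open>r < 1/2\<close> do not see the jump.\<close>

lemma wrap_locally_large:
  fixes z :: "real^'n"
  assumes "\<bar>wrap z $ i\<bar> \<ge> 1/2" "r < 1/2"
  shows "\<forall>\<^sub>F z' in nhds z. norm (wrap z') > r"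
proof -
  have "\<forall>\<^sub>F z' in nhds z. \<bar>z' $ i - z $ i\<bar> < 1/2 - r"
  proof (rule order_tendstoD)
    show "((\<lambda>z'. \<bar>z' $ i - z $ i\<bar>) \<longlongrightarrow> \<bar>z $ i - z $ i\<bar>) (nhds z)" by (intro tendsto_intros filterlim_ident)
  qed (use assms in simp)
  thus ?thesis
  proof eventually_elim
    case (elim z')
    have "1/2 \<le> \<bar>z $ i - of_int (round (z' $ i))\<bar>"
      using assms(1) round_diff_minimal[of "z $ i" "round (z' $ i)"] by (simp add: wrap_def)
    moreover have "\<bar>z $ i - k\<bar> \<le> \<bar>z' $ i - k\<bar> + \<bar>z' $ i - z $ i\<bar>" for k by arith
    ultimately have "1/2 \<le> \<bar>wrap z' $ i\<bar> + \<bar>z' $ i - z $ i\<bar>"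
      unfolding wrap_def vec_lambda_beta by (rule order_trans)
    hence "r < \<bar>wrap z' $ i\<bar>" using elim by linarith
    also have "\<dots> \<le> norm (wrap z')" by (rule component_le_norm_cart)
    finally show ?case .
  qed
qed

definition periodized :: "(real^'n \<Rightarrow> real) \<Rightarrow> real \<Rightarrow> real^'n \<Rightarrow> real^'n \<Rightarrow> real" where
  "periodized a r x y = a ((1 / r) *\<^sub>R wrap (y - x))"

text \<open>Near a point whose wrapped coordinates all lie strictly inside \<open>(-1/2, 1/2)\<close>, wrapping is a
  translation; near all other points both sides vanish.\<close>

lemma periodized_has_derivative:
  assumes a: "bump_poly a" and a': "\<And>z. (a has_derivative a' z) (at z)" "\<And>w. bump_poly (\<lambda>z. a' z w)"
    and r: "0 < r" "r < 1/2"
  shows "(periodized a r x has_derivative (\<lambda>w. (1 / r) * periodized (\<lambda>z. a' z w) r x y)) (at y)"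
proof (cases "\<forall>i. \<bar>wrap (y - x) $ i\<bar> < 1/2")
  case True
  have "\<forall>\<^sub>F y' in nhds y. wrap (y' - x) = wrap (y - x) + (y' - x - (y - x))"
  proof -
    have "filterlim (\<lambda>y'. y' - x) (nhds (y - x)) (nhds y)" by (intro tendsto_intros filterlim_ident)
    from filterlim_iff[THEN iffD1, OF this, rule_format, OF wrap_locally_translation[of "y - x"]] True
    show ?thesis by blast
  qed
  hence ev: "\<forall>\<^sub>F y' in nhds y. a ((1 / r) *\<^sub>R (wrap (y - x) + (y' - y))) = periodized a r x y'"
    by eventually_elim (simp add: periodized_def)
  define z where "z = (1 / r) *\<^sub>R wrap (y - x)"
  have "bounded_linear (a' z)" using a'(1) has_derivative_bounded_linear by blast
  hence "a' z ((1 / r) *\<^sub>R w) = (1 / r) * a' z w" for w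
    by (simp add: linear_simps(5))
  moreover have "((\<lambda>y'. a ((1 / r) *\<^sub>R (wrap (y - x) + (y' - y)))) has_derivative
      (\<lambda>w. a' z ((1 / r) *\<^sub>R w))) (at y)"
  proof (rule has_derivative_compose[of _ _ _ _ a "a' z"])
    show "((\<lambda>y'. (1 / r) *\<^sub>R (wrap (y - x) + (y' - y))) has_derivative (\<lambda>w. (1 / r) *\<^sub>R w)) (at y)"
      by (auto intro!: derivative_eq_intros)
    show "(a has_derivative a' z) (at ((1 / r) *\<^sub>R (wrap (y - x) + (y - y))))"
      using a'(1) by (simp add: z_def)
  qed
  ultimately have "((\<lambda>y'. a ((1 / r) *\<^sub>R (wrap (y - x) + (y' - y)))) has_derivative
      (\<lambda>w. (1 / r) * periodized (\<lambda>z. a' z w) r x y)) (at y)"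
    by (simp add: periodized_def z_def)
  from has_derivative_transform_eventually[OF this filter_leD[OF at_within_le_nhds ev]
      eventually_nhds_x_imp_x[OF ev] UNIV_I] show ?thesis .
next
  case False
  then obtain i where i: "\<bar>wrap (y - x) $ i\<bar> \<ge> 1/2" by (auto simp: not_less)
  have "filterlim (\<lambda>y'. y' - x) (nhds (y - x)) (nhds y)" by (intro tendsto_intros filterlim_ident)
  from filterlim_iff[THEN iffD1, OF this, rule_format, OF wrap_locally_large[OF i r(2)]]
  have large: "\<forall>\<^sub>F y' in nhds y. norm (wrap (y' - x)) > r" .
  hence ev: "\<forall>\<^sub>F y' in nhds y. 0 = periodized a r x y'"
  proof eventually_elim
    case (elim y')
    thus ?case using r bump_poly_support[OF a, of "(1 / r) *\<^sub>R wrap (y' - x)"]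
      by (simp add: periodized_def divide_le_eq)
  qed
  have "periodized (\<lambda>z. a' z w) r x y = 0" for w
    using bump_poly_support[OF a'(2)[of w], of "(1 / r) *\<^sub>R wrap (y - x)"] r eventually_nhds_x_imp_x[OF large]
    by (simp add: periodized_def)
  hence "((\<lambda>y'. 0) has_derivative (\<lambda>w. (1 / r) * periodized (\<lambda>z. a' z w) r x y)) (at y)"
    by simp
  from has_derivative_transform_eventually[OF this filter_leD[OF at_within_le_nhds ev]
      eventually_nhds_x_imp_x[OF ev] UNIV_I] show ?thesis .
qed

lemma smoothI_class:
  assumes "\<phi> \<in> S" "\<And>\<phi> x. \<phi> \<in> S \<Longrightarrow> \<phi> differentiable (at x)" "\<And>\<phi> w. \<phi> \<in> S \<Longrightarrow> dir_deriv w \<phi> \<in> S"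
  shows "smooth \<phi>"
proof -
  have "foldr dir_deriv ws \<phi> \<in> S" for ws
    by (induction ws) (use assms in auto)
  thus ?thesis using assms by (simp add: smooth_def)
qed

lemma dir_derivI:
  assumes "\<And>x. (\<phi> has_derivative \<phi>' x) (at x)"
  shows "dir_deriv w \<phi> = (\<lambda>x. \<phi>' x w)"
  using frechet_derivative_at[OF assms] by (metis dir_deriv_def)

lemma dir_deriv_periodized:
  assumes a: "bump_poly a" and a': "\<And>z. (a has_derivative a' z) (at z)" "\<And>w. bump_poly (\<lambda>z. a' z w)"
    and r: "0 < r" "r < 1/2"
  shows "dir_deriv w (periodized a r x) = periodized (\<lambda>z. (1 / r) * a' z w) r x"
  by (subst dir_derivI[OF periodized_has_derivative[OF assms]]) (auto simp: periodized_def)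

lemma periodized_torus_test:
  assumes "bump_poly a" "0 < r" "r < 1/2"
  shows "periodized a r x \<in> torus_test"
proof -
  have "smooth (periodized a r x)"
  proof (rule smoothI_class[where S="{periodized a r x | a. bump_poly a}"])
    fix \<phi> y assume "\<phi> \<in> {periodized a r x |a. bump_poly a}"
    then obtain b where b: "\<phi> = periodized b r x" "bump_poly b" by blast
    obtain b' where b': "\<And>z. (b has_derivative b' z) (at z)" "\<And>w. bump_poly (\<lambda>z. b' z w)"
      using bump_poly_has_derivative[OF b(2)] by blast
    show "\<phi> differentiable (at y)"
      using periodized_has_derivative[OF b(2) b' assms(2,3), of x y] b(1)
      by (auto simp: differentiable_def)
    fix w show "dir_deriv w \<phi> \<in> {periodized a r x |a. bump_poly a}"
      using dir_deriv_periodized[OF b(2) b' assms(2,3), of w x] bump_poly.cmult[OF b'(2)] b(1) by blast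
  qed (use assms in blast)
  thus ?thesis
    by (auto simp: torus_test_def periodized_def[abs_def] intro: periodic_wrap)
qed

text \<open>The Laplacian of \<open>bump 0 (1 - |z|\<^sup>2)\<close>. It is also the derivative at \<open>r = 1\<close> of the scaled profile
  defined below, and this coincidence links averages at different scales to the Laplacian.\<close>

definition lap_bump :: "real^'n \<Rightarrow> real" where
  "lap_bump z = - 2 * real CARD('n) * bump 2 (1 - z \<bullet> z)
     + 4 * (z \<bullet> z) * (bump 4 (1 - z \<bullet> z) - 2 * bump 3 (1 - z \<bullet> z))"

lemma laplacian_periodized_bump:
  fixes x :: "real^'n::finite"
  assumes r: "0 < r" "r < 1/2"
  shows "(\<Sum>i\<in>UNIV. dir_deriv (axis i 1) (dir_deriv (axis i 1) (periodized (\<lambda>z. bump 0 (1 - z \<bullet> z)) r x)) y)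
     = (1 / r)\<^sup>2 * periodized lap_bump r x y"
proof -
  let ?\<psi> = "\<lambda>z::real^'n. bump 0 (1 - z \<bullet> z)"
  define a' where "a' z w = (- 2) * ((z \<bullet> w) * bump 2 (1 - z \<bullet> z))" for z w :: "real^'n"
  define a'' where "a'' v z w = (- 2) * ((w \<bullet> v) * bump 2 (1 - z \<bullet> z))
     + 4 * ((z \<bullet> v) * ((z \<bullet> w) * bump 4 (1 - z \<bullet> z))) + (- 8) * ((z \<bullet> v) * ((z \<bullet> w) * bump 3 (1 - z \<bullet> z)))" for v z w :: "real^'n"
  have 1: "(?\<psi> has_derivative a' z) (at z)" "bump_poly (\<lambda>z. a' z w)" for z w
  proof -
    show "(?\<psi> has_derivative a' z) (at z)"
      unfolding a'_def by (auto intro!: derivative_eq_intros simp: inner_commute numeral_2_eq_2)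
    show "bump_poly (\<lambda>z. a' z w)" unfolding a'_def by (intro bump_poly.intros)
  qed
  have n2: "bump_poly (\<lambda>z. a'' v z w)" for v w
    unfolding a''_def by (intro bump_poly.intros)
  have 2: "((\<lambda>z. (1 / r) * a' z v) has_derivative (\<lambda>w. (1 / r) * a'' v z w)) (at z)" for v z
  proof -
    have "((\<lambda>z. a' z v) has_derivative a'' v z) (at z)"
      unfolding a'_def a''_def
      by (auto intro!: derivative_eq_intros simp: inner_commute algebra_simps eval_nat_numeral)
    from has_derivative_mult_right[OF this, of "1 / r"] show ?thesis .
  qed
  have "dir_deriv v (dir_deriv v (periodized ?\<psi> r x)) = periodized (\<lambda>z. (1 / r) * ((1 / r) * a'' v z v)) r x" for v
    unfolding dir_deriv_periodized[OF bump_poly.base 1 r]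
    by (rule dir_deriv_periodized[OF bump_poly.cmult[OF 1(2)] 2 bump_poly.cmult[OF n2] r])
  hence "(\<Sum>i\<in>UNIV. dir_deriv (axis i 1) (dir_deriv (axis i 1) (periodized ?\<psi> r x)) y)
     = (1 / r)\<^sup>2 * periodized (\<lambda>z. \<Sum>i\<in>UNIV. a'' (axis i 1) z (axis i 1)) r x y"
    by (simp add: periodized_def power2_eq_square sum_distrib_left mult.assoc)
  also have "(\<lambda>z. \<Sum>i\<in>UNIV. a'' (axis i 1) z (axis i 1)) = lap_bump"
  proof
    fix z :: "real^'n"
    have a'': "a'' (axis i 1) z (axis i 1) = (- 2) * bump 2 (1 - z \<bullet> z)
        + (4 * bump 4 (1 - z \<bullet> z) - 8 * bump 3 (1 - z \<bullet> z)) * (z $ i * z $ i)" for i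
      by (simp add: a''_def inner_axis algebra_simps)
    have "(\<Sum>i\<in>UNIV. z $ i * z $ i) = z \<bullet> z" by (simp add: inner_vec_def)
    thus "(\<Sum>i\<in>UNIV. a'' (axis i 1) z (axis i 1)) = lap_bump z"
      unfolding a'' lap_bump_def sum.distrib sum_distrib_left[symmetric] by (simp add: algebra_simps)
  qed
  finally show ?thesis .
qed

text \<open>The averaging kernel at scale \<open>r\<close>. For \<open>r = 1\<close> it is \<open>\<eta>(z) = 2 bump 2 (1 - |z|\<^sup>2)\<close>, which is chosen such
  that \<open>z \<eta>(z)\<close> is minus the gradient of \<open>\<psi>(z) = bump 0 (1 - |z|\<^sup>2)\<close>.\<close>

definition profile :: "real \<Rightarrow> real^'n \<Rightarrow> real" where
  "profile r z = (1 / r) ^ CARD('n) * (2 * bump 2 (1 - ((1 / r) *\<^sub>R z) \<bullet> ((1 / r) *\<^sub>R z)))"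

text \<open>The scale derivative of \<open>r\<^sup>-\<^sup>n \<eta>(z/r)\<close> is \<open>- r\<^sup>-\<^sup>n\<^sup>-\<^sup>1 (div (z \<eta>))(z/r)\<close>, and \<open>div (z \<eta>) = - \<Delta>\<psi>\<close>.\<close>

lemma profile_scale_derivative:
  fixes z :: "real^'n"
  assumes "r > 0"
  shows "((\<lambda>r. profile r z) has_real_derivative (1 / r) ^ (CARD('n) + 1) * lap_bump ((1 / r) *\<^sub>R z)) (at r)"
proof -
  define n where "n = CARD('n)"
  define q where "q = z \<bullet> z"
  have n: "n > 0" by (simp add: n_def)
  have b: "(bump 2 has_real_derivative bump 4 t - 2 * bump 3 t) (at t)" for t
    using bump_has_derivative[of 2 t] by simp
  have "((\<lambda>r. (1 / r) ^ n * (2 * bump 2 (1 - (1 / r)\<^sup>2 * q))) has_real_derivative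
     (1 / r) ^ (n + 1) * (- 2 * real n * bump 2 (1 - (1 / r)\<^sup>2 * q)
        + 4 * ((1 / r)\<^sup>2 * q) * (bump 4 (1 - (1 / r)\<^sup>2 * q) - 2 * bump 3 (1 - (1 / r)\<^sup>2 * q)))) (at r)"
  proof -
    have "((\<lambda>r. 1 - (1 / r)\<^sup>2 * q) has_real_derivative 2 * (1 / r) ^ 3 * q) (at r)"
      using inverse_power_has_derivative[of r 2] assms
      by (auto intro!: derivative_eq_intros simp: numeral_3_eq_3)
    from DERIV_cmult[OF DERIV_chain2[OF b this], of 2]
    have "((\<lambda>r. 2 * bump 2 (1 - (1 / r)\<^sup>2 * q)) has_real_derivative
       2 * ((bump 4 (1 - (1 / r)\<^sup>2 * q) - 2 * bump 3 (1 - (1 / r)\<^sup>2 * q)) * (2 * (1 / r) ^ 3 * q))) (at r)" .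
    note D = DERIV_cong[OF DERIV_mult[OF inverse_power_has_derivative this]]
    have eq: "- real n * u ^ (n + 1) * (2 * b) + 2 * (c * (2 * u ^ 3 * q)) * u ^ n
        = u ^ (n + 1) * (- 2 * real n * b + 4 * (u\<^sup>2 * q) * c)" for u b c :: real
      by (simp add: power2_eq_square power3_eq_cube algebra_simps)
    show ?thesis by (rule D[OF _ eq]) (use assms in simp)
  qed
  thus ?thesis
    by (simp add: profile_def[abs_def] lap_bump_def n_def q_def power2_eq_square mult.assoc)
qed

section \<open>Integration over the torus\<close>

abbreviation torus_measure :: "(real^'n::finite) measure" where
  "torus_measure \<equiv> lebesgue_on unit_cell"

lemma unit_cell_borel [measurable, simp]: "unit_cell \<in> sets (borel :: (real^'n::finite) measure)"
proof -
  have "unit_cell = {x :: real^'n. (\<forall>i\<in>UNIV. 0 \<le> x $ i) \<and> (\<forall>i\<in>UNIV. x $ i < 1)}"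
    by (auto simp: unit_cell_def)
  also have "\<dots> = (\<Inter>i\<in>UNIV. {x. 0 \<le> x $ i}) \<inter> (\<Inter>i\<in>UNIV. {x. x $ i < 1})" by auto
  also have "\<dots> \<in> sets borel"
    by (intro sets.Int sets.finite_INT borel_closed borel_open closed_Collect_le open_Collect_less
        continuous_intros) auto
  finally show ?thesis .
qed

lemma unit_cell_lebesgue [measurable, simp]: "unit_cell \<in> sets (lebesgue :: (real^'n::finite) measure)"
  by (simp add: sets_completionI_sets)

lemma unit_cell_subset_cbox: "unit_cell \<subseteq> cbox 0 (\<chi> i. 1 :: real^'n::finite)"
  by (auto simp: unit_cell_def mem_box_cart less_imp_le)

lemma finite_measure_torus: "finite_measure (torus_measure :: (real^'n::finite) measure)"
proof
  have "emeasure (torus_measure :: (real^'n) measure) (space torus_measure) = emeasure lebesgue (unit_cell :: (real^'n) set)"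
    by (simp add: emeasure_restrict_space)
  also have "\<dots> \<le> emeasure lebesgue (cbox 0 (\<chi> i. 1) :: (real^'n) set)"
    by (intro emeasure_mono unit_cell_subset_cbox) auto
  also have "\<dots> < \<infinity>" using emeasure_lborel_cbox_finite by auto
  finally show "emeasure (torus_measure :: (real^'n) measure) (space torus_measure) \<noteq> \<infinity>" by simp
qed

interpretation torus: finite_measure "torus_measure :: (real^'n::finite) measure"
  by (rule finite_measure_torus)

lemma borel_measurable_torus:
  fixes f :: "real^'n::finite \<Rightarrow> 'b::topological_space"
  shows "f \<in> borel_measurable borel \<Longrightarrow> f \<in> borel_measurable torus_measure"
  by (intro measurable_restrict_space1 measurable_completion) simp

lemma nn_integral_torus:
  fixes f :: "real^'n::finite \<Rightarrow> ennreal"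
  shows "(\<integral>\<^sup>+x. f x \<partial>torus_measure) = (\<integral>\<^sup>+x. f x * indicator unit_cell x \<partial>lborel)"
  by (subst nn_integral_restrict_space) (auto simp: nn_integral_completion)

definition centered_cell :: "(real^'n) set" where
  "centered_cell = {z. \<forall>i. - 1/2 \<le> z $ i \<and> z $ i < 1/2}"

lemma wrap_centered: "wrap z = z \<longleftrightarrow> z \<in> centered_cell"
proof -
  have "round t = 0 \<longleftrightarrow> - 1/2 \<le> t \<and> t < 1/2" for t :: real
    by (auto simp: round_def floor_eq_iff)
  thus ?thesis by (auto simp: wrap_def vec_eq_iff centered_cell_def)
qed

lemma borel_measurable_wrap [measurable]: "wrap \<in> borel_measurable (borel :: (real^'n::finite) measure)"
proof (rule borel_measurable_euclidean_space[THEN iffD2], rule ballI)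
  fix b :: "real^'n" assume "b \<in> Basis"
  then obtain i where b: "b = axis i 1" by (auto simp: Basis_vec_def)
  have m: "(\<lambda>z::real^'n. z $ i) \<in> borel_measurable borel"
    by (intro borel_measurable_continuous_onI continuous_intros)
  have "(\<lambda>z::real^'n. z $ i - of_int \<lfloor>z $ i + 1/2\<rfloor>) \<in> borel_measurable borel"
    using m by (intro borel_measurable_diff borel_measurable_real_floor[THEN measurable_compose[rotated]] borel_measurable_add) auto
  thus "(\<lambda>z. wrap z \<bullet> b) \<in> borel_measurable borel"
    by (simp add: b inner_axis wrap_def round_def)
qed

text \<open>Integer vectors are kept in the countable type \<open>int^'n\<close>, so that sums over the lattice are
  integrals with respect to a \<open>\<sigma>\<close>-finite counting measure.\<close>

definition lattice_vec :: "int^'n \<Rightarrow> real^'n" where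
  "lattice_vec k = (\<chi> i. of_int (k $ i))"

lemma wrap_add_lattice: "wrap (z + lattice_vec k) = wrap z"
  by (rule wrap_add_integer) (simp add: lattice_vec_def)

lemma nn_integral_count_space_unique:
  assumes "\<And>k. P k \<longleftrightarrow> k = k0"
  shows "(\<integral>\<^sup>+k. of_bool (P k) \<partial>count_space UNIV) = (1 :: ennreal)"
proof -
  have "(\<integral>\<^sup>+k. of_bool (P k) \<partial>count_space UNIV) = (\<integral>\<^sup>+k. indicator {k0} k \<partial>count_space UNIV)"
    by (intro nn_integral_cong) (auto simp: assms)
  thus ?thesis by simp
qed

lemma sum_translates_unit_cell:
  "(\<integral>\<^sup>+k. indicator unit_cell (z + lattice_vec k) \<partial>count_space UNIV) = (1 :: ennreal)"
proof -
  have "0 \<le> t + of_int m \<and> t + of_int m < 1 \<longleftrightarrow> m = - \<lfloor>t\<rfloor>" for t :: real and m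
    using floor_eq_iff[of t "- m"] by auto
  hence "z + lattice_vec k \<in> unit_cell \<longleftrightarrow> k = (\<chi> i. - \<lfloor>z $ i\<rfloor>)" for k
    by (simp add: unit_cell_def lattice_vec_def vec_eq_iff)
  from nn_integral_count_space_unique[of "\<lambda>k. z + lattice_vec k \<in> unit_cell", OF this] show ?thesis
    by (simp add: indicator_def)
qed

lemma sum_translates_centered_cell:
  "(\<integral>\<^sup>+k. indicator centered_cell (z - lattice_vec k) \<partial>count_space UNIV) = (1 :: ennreal)"
proof -
  have "- 1/2 \<le> t - of_int m \<and> t - of_int m < 1/2 \<longleftrightarrow> m = \<lfloor>t + 1/2\<rfloor>" for t :: real and m
  proof -
    have fl: "m = \<lfloor>t + 1/2\<rfloor> \<longleftrightarrow> of_int m \<le> t + 1/2 \<and> t + 1/2 < of_int m + 1"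
      using floor_eq_iff[of "t + 1/2" m] by metis
    show ?thesis unfolding fl by auto
  qed
  hence "z - lattice_vec k \<in> centered_cell \<longleftrightarrow> k = (\<chi> i. \<lfloor>z $ i + 1/2\<rfloor>)" for k
    by (simp add: centered_cell_def lattice_vec_def vec_eq_iff)
  from nn_integral_count_space_unique[of "\<lambda>k. z - lattice_vec k \<in> centered_cell", OF this] show ?thesis
    by (simp add: indicator_def)
qed

lemma centered_cell_borel [measurable, simp]: "centered_cell \<in> sets (borel :: (real^'n::finite) measure)"
proof -
  have "(\<lambda>z::real^'n. wrap z - z) -` {0} \<inter> space borel \<in> sets borel"
    by (intro measurable_sets[of _ borel borel]) auto
  moreover have "(\<lambda>z::real^'n. wrap z - z) -` {0} \<inter> space borel = centered_cell"
    by (auto simp: wrap_centered)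
  ultimately show ?thesis by simp
qed

lemma nn_integral_translate:
  fixes f :: "'a::euclidean_space \<Rightarrow> ennreal"
  assumes [measurable]: "f \<in> borel_measurable borel"
  shows "(\<integral>\<^sup>+z. f (c + z) \<partial>lborel) = (\<integral>\<^sup>+z. f z \<partial>lborel)"
proof -
  have "(\<integral>\<^sup>+z. f z \<partial>lborel) = (\<integral>\<^sup>+z. f z \<partial>distr lborel borel ((+) c))"
    by (simp add: lborel_distr_plus)
  also have "\<dots> = (\<integral>\<^sup>+z. f (c + z) \<partial>lborel)"
    by (rule nn_integral_distr) auto
  finally show ?thesis by simp
qed

text \<open>Translation invariance of the torus: the translated cell is cut along the lattice translates of
  the centred cell, the pieces are moved into the centred cell, and there they fit together.\<close>

lemma nn_integral_torus_wrap:
  fixes F :: "real^'n::finite \<Rightarrow> ennreal"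
  assumes [measurable]: "F \<in> borel_measurable borel"
  shows "(\<integral>\<^sup>+y. F (wrap (y - x)) \<partial>torus_measure) = (\<integral>\<^sup>+z. F z * indicator centered_cell z \<partial>lborel)"
proof -
  have "(\<integral>\<^sup>+y. F (wrap (y - x)) \<partial>torus_measure)
      = (\<integral>\<^sup>+y. F (wrap (y - x)) * indicator unit_cell y \<partial>lborel)"
    by (rule nn_integral_torus)
  also have "\<dots> = (\<integral>\<^sup>+z. F (wrap z) * indicator unit_cell (x + z) \<partial>lborel)"
    by (subst nn_integral_translate[of _ x, symmetric]) auto
  also have "\<dots> = (\<integral>\<^sup>+z. \<integral>\<^sup>+k. F (wrap z) * indicator unit_cell (x + z) *
        indicator centered_cell (z - lattice_vec k) \<partial>count_space UNIV \<partial>lborel)"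
    by (simp add: nn_integral_cmult sum_translates_centered_cell)
  also have "\<dots> = (\<integral>\<^sup>+k. \<integral>\<^sup>+z. F (wrap z) * indicator unit_cell (x + z) *
        indicator centered_cell (z - lattice_vec k) \<partial>lborel \<partial>count_space UNIV)"
    by (rule nn_integral_count_space_nn_integral) auto
  also have "\<dots> = (\<integral>\<^sup>+k. \<integral>\<^sup>+z. F (wrap z) * indicator unit_cell (x + z + lattice_vec k) *
        indicator centered_cell z \<partial>lborel \<partial>count_space UNIV)"
  proof (rule nn_integral_cong)
    fix k :: "int^'n"
    have "(\<integral>\<^sup>+z. F (wrap z) * indicator unit_cell (x + z) * indicator centered_cell (z - lattice_vec k) \<partial>lborel)
      = (\<integral>\<^sup>+z. F (wrap (lattice_vec k + z)) * indicator unit_cell (x + (lattice_vec k + z)) *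
          indicator centered_cell (lattice_vec k + z - lattice_vec k) \<partial>lborel)"
      by (rule nn_integral_translate[symmetric]) auto
    thus "(\<integral>\<^sup>+z. F (wrap z) * indicator unit_cell (x + z) * indicator centered_cell (z - lattice_vec k) \<partial>lborel)
      = (\<integral>\<^sup>+z. F (wrap z) * indicator unit_cell (x + z + lattice_vec k) * indicator centered_cell z \<partial>lborel)"
      using wrap_add_lattice[of _ k] by (simp add: add_ac)
  qed
  also have "\<dots> = (\<integral>\<^sup>+z. \<integral>\<^sup>+k. F (wrap z) * indicator centered_cell z *
        indicator unit_cell (x + z + lattice_vec k) \<partial>count_space UNIV \<partial>lborel)"
    by (subst nn_integral_count_space_nn_integral) (auto simp: mult_ac)
  also have "\<dots> = (\<integral>\<^sup>+z. F (wrap z) * indicator centered_cell z \<partial>lborel)"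
    by (simp add: nn_integral_cmult sum_translates_unit_cell)
  also have "\<dots> = (\<integral>\<^sup>+z. F z * indicator centered_cell z \<partial>lborel)"
    by (intro nn_integral_cong) (auto simp: indicator_def wrap_centered[THEN iffD2])
  finally show ?thesis .
qed

lemma norm_lt_half_centered: "norm z < 1/2 \<Longrightarrow> z \<in> centered_cell"
proof -
  assume z: "norm z < 1/2"
  have "- 1/2 \<le> z $ i \<and> z $ i < 1/2" for i
    using component_le_norm_cart[of z i] z by arith
  thus ?thesis by (simp add: centered_cell_def)
qed

lemma measure_torus_ball:
  fixes x :: "real^'n::finite"
  assumes "0 < r"
  shows "measure torus_measure {y \<in> unit_cell. norm (wrap (y - x)) < r} \<le> unit_ball_vol CARD('n) * r ^ CARD('n)"
    and "{y \<in> unit_cell. norm (wrap (y - x)) < r} \<in> sets torus_measure"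
proof -
  let ?B = "{y \<in> unit_cell. norm (wrap (y - x)) < r}"
  have sb: "{y \<in> unit_cell. norm (wrap (y - x)) < r} \<in> sets borel" by measurable
  thus s: "?B \<in> sets torus_measure"
    by (auto simp: sets_restrict_space intro!: image_eqI[of _ _ ?B])
  have "emeasure torus_measure ?B = (\<integral>\<^sup>+y. indicator (ball 0 r) (wrap (y - x)) \<partial>torus_measure)"
    using s by (subst nn_integral_indicator[symmetric], simp)
      (intro nn_integral_cong, auto simp: indicator_def)
  also have "\<dots> = (\<integral>\<^sup>+z. indicator (ball 0 r) z * indicator centered_cell (z :: real^'n) \<partial>lborel)"
    by (rule nn_integral_torus_wrap[where F="indicator (ball 0 r)"], intro borel_measurable_indicator) simp
  also have "\<dots> \<le> (\<integral>\<^sup>+z. indicator (ball 0 r) z \<partial>(lborel :: (real^'n) measure))"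
    by (intro nn_integral_mono) (auto simp: indicator_def)
  also have "\<dots> = ennreal (unit_ball_vol CARD('n) * r ^ CARD('n))"
    using assms by (simp add: emeasure_ball)
  finally show "measure torus_measure ?B \<le> unit_ball_vol CARD('n) * r ^ CARD('n)"
    unfolding measure_def using assms by (intro enn2real_leI) auto
qed

lemma borel_measurable_profile [measurable]: "profile r \<in> borel_measurable (borel :: (real^'n::finite) measure)"
  unfolding profile_def by (intro borel_measurable_continuous_onI continuous_intros)

lemma profile_nonneg: "r > 0 \<Longrightarrow> profile r z \<ge> 0"
  by (simp add: profile_def bump_nonneg)

lemma profile_support: "0 < r \<Longrightarrow> norm z \<ge> r \<Longrightarrow> profile r z = 0"
proof -
  assume r: "0 < r" "norm z \<ge> r"
  hence "1 \<le> norm ((1 / r) *\<^sub>R z)" by simp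
  hence "1 \<le> (norm ((1 / r) *\<^sub>R z))\<^sup>2" by (rule one_le_power)
  hence "1 - ((1 / r) *\<^sub>R z) \<bullet> ((1 / r) *\<^sub>R z) \<le> 0" by (simp only: power2_norm_eq_inner)
  thus ?thesis by (simp add: profile_def bump_eq_0 del: inner_scaleR_left inner_scaleR_right)
qed

text \<open>The mass of the kernel depends neither on the point nor on the scale; it is written as the mass of
  the unit profile on \<open>\<real>\<^sup>n\<close>.\<close>

lemma nn_integral_profile:
  fixes x :: "real^'n::finite"
  assumes r: "0 < r" "r < 1/2"
  shows "(\<integral>\<^sup>+y. ennreal (profile r (wrap (y - x))) \<partial>torus_measure) = (\<integral>\<^sup>+z. ennreal (profile 1 (z :: real^'n)) \<partial>lborel)"
proof -
  have "(\<integral>\<^sup>+y. ennreal (profile r (wrap (y - x))) \<partial>torus_measure)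
      = (\<integral>\<^sup>+z. ennreal (profile r z) * indicator centered_cell (z :: real^'n) \<partial>lborel)"
    by (rule nn_integral_torus_wrap) auto
  also have "\<dots> = (\<integral>\<^sup>+z. ennreal (profile r (z :: real^'n)) \<partial>lborel)"
  proof (intro nn_integral_cong)
    fix z :: "real^'n"
    show "ennreal (profile r z) * indicator centered_cell z = ennreal (profile r z)"
      using profile_support[of r z] norm_lt_half_centered[of z] r
      by (cases "norm z < r") (auto simp: indicator_def)
  qed
  also have "\<dots> = (\<integral>\<^sup>+z. ennreal (profile r (z :: real^'n)) \<partial>density (distr lborel borel (\<lambda>z. 0 + r *\<^sub>R z)) (\<lambda>_. ennreal (\<bar>r\<bar> ^ DIM(real^'n))))"
    by (rule arg_cong[where f="\<lambda>M. nn_integral M (\<lambda>z. ennreal (profile r z))"], rule lborel_affine)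
      (use r in simp)
  also have "\<dots> = (\<integral>\<^sup>+z. ennreal (r ^ CARD('n)) * ennreal (profile r (r *\<^sub>R z :: real^'n)) \<partial>lborel)"
    using r by (subst nn_integral_density, simp, simp, subst nn_integral_distr) auto
  also have "\<dots> = (\<integral>\<^sup>+z. ennreal (profile 1 (z :: real^'n)) \<partial>lborel)"
    using r by (intro nn_integral_cong) (simp add: profile_def power_divide flip: ennreal_mult')
  finally show ?thesis .
qed

lemma bounded_of_support:
  fixes a :: "'a::euclidean_space \<Rightarrow> real"
  assumes "continuous_on UNIV a" "\<And>z. norm z \<ge> 1 \<Longrightarrow> a z = 0"
  obtains C where "C \<ge> 0" "\<And>z. \<bar>a z\<bar> \<le> C"
proof -
  have "bounded (a ` cball 0 1)"
    by (intro compact_imp_bounded compact_continuous_image continuous_on_subset[OF assms(1)]) auto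
  then obtain C where "\<And>z. norm z \<le> 1 \<Longrightarrow> \<bar>a z\<bar> \<le> C"
    unfolding bounded_iff by (metis image_eqI mem_cball_0 real_norm_def)
  hence "\<bar>a z\<bar> \<le> max 0 C" for z
    using assms(2)[of z] by (cases "norm z \<le> 1") (auto intro: max.coboundedI2)
  thus ?thesis using that[of "max 0 C"] by auto
qed

lemma profile_bounded:
  assumes "r > 0"
  obtains C where "C \<ge> 0" "\<And>z::real^'n::finite. \<bar>profile r z\<bar> \<le> C"
proof -
  have n: "bump_poly (\<lambda>z::real^'n. (1 / r) ^ CARD('n) * (2 * bump 2 (1 - z \<bullet> z)))"
    by (intro bump_poly.intros)
  obtain C where C: "C \<ge> 0" "\<And>z::real^'n. \<bar>(1 / r) ^ CARD('n) * (2 * bump 2 (1 - z \<bullet> z))\<bar> \<le> C"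
    using bounded_of_support[OF continuous_on_bump_poly[OF n] bump_poly_support[OF n]] by blast
  show ?thesis
  proof (rule that[OF C(1)])
    fix z :: "real^'n"
    show "\<bar>profile r z\<bar> \<le> C" unfolding profile_def by (rule C(2))
  qed
qed

definition profile_mass :: "'n::finite itself \<Rightarrow> real" where
  "profile_mass _ = (\<integral>z. profile 1 (z :: real^'n) \<partial>lborel)"

lemma integrable_profile: "integrable lborel (profile 1 :: real^'n::finite \<Rightarrow> real)"
proof -
  obtain C where C: "C \<ge> 0" "\<And>z::real^'n. \<bar>profile 1 z\<bar> \<le> C" using profile_bounded[of 1] by auto
  have "integrable lborel (\<lambda>z::real^'n. indicator (ball 0 1) z *\<^sub>R C)"
    using emeasure_lborel_ball_finite[of "0::real^'n" 1] by (intro integrable_real_indicator integrable_scaleR_left) auto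
  thus ?thesis
  proof (rule Bochner_Integration.integrable_bound)
    show "AE z::real^'n in lborel. norm (profile 1 z) \<le> norm (indicator (ball 0 1) z *\<^sub>R C)"
      using C profile_support[of 1] by (intro AE_I2) (auto simp: indicator_def not_less intro: order_trans[OF C(2)])
  qed auto
qed

lemma profile_mass_pos: "profile_mass TYPE('n::finite) > 0"
proof -
  have nn: "0 \<le> profile 1 z" for z :: "real^'n" by (simp add: profile_nonneg)
  hence "profile_mass TYPE('n) \<ge> 0" by (simp add: profile_mass_def)
  moreover have "profile_mass TYPE('n) \<noteq> 0"
  proof
    assume "profile_mass TYPE('n) = 0"
    hence "AE z::real^'n in lborel. profile 1 z = 0"
      using integral_nonneg_eq_0_iff_AE[OF integrable_profile AE_I2[OF nn]] by (simp add: profile_mass_def)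
    moreover have "profile 1 z \<noteq> 0" if "z \<in> ball 0 1" for z :: "real^'n"
    proof -
      have "(norm z)\<^sup>2 < 1" using that abs_square_less_1[of "norm z"] by simp
      thus ?thesis using bump_pos[of "1 - z \<bullet> z" 2] by (simp add: profile_def power2_norm_eq_inner)
    qed
    ultimately have "AE z::real^'n in lborel. z \<notin> ball 0 1" by auto
    hence "ball (0::real^'n) 1 \<in> null_sets lborel" by (simp add: AE_iff_null_sets)
    hence "negligible (ball (0::real^'n) 1)"
      by (simp add: negligible_iff_null_sets null_sets_completionI)
    thus False using open_not_negligible[of "ball (0::real^'n) 1"] by auto
  qed
  ultimately show ?thesis by simp
qed

lemma integral_profile:
  fixes x :: "real^'n::finite"
  assumes "0 < r" "r < 1/2"
  shows "(\<integral>y. profile r (wrap (y - x)) \<partial>torus_measure) = profile_mass TYPE('n)"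
proof -
  have m: "(\<lambda>y. profile r (wrap (y - x))) \<in> borel_measurable torus_measure"
    by (rule borel_measurable_torus) measurable
  have "(\<integral>y. profile r (wrap (y - x)) \<partial>torus_measure)
     = enn2real (\<integral>\<^sup>+y. ennreal (profile r (wrap (y - x))) \<partial>torus_measure)"
    using assms by (intro integral_eq_nn_integral m) (auto simp: profile_nonneg)
  also have "\<dots> = enn2real (\<integral>\<^sup>+z. ennreal (profile 1 (z :: real^'n)) \<partial>lborel)"
    by (simp only: nn_integral_profile[OF assms])
  also have "\<dots> = profile_mass TYPE('n)"
    unfolding profile_mass_def by (subst integral_eq_nn_integral) (auto simp: profile_nonneg)
  finally show ?thesis .
qed

text \<open>Rounding finds a nearest lattice point, so that the norm of \<open>wrap z\<close> is the distance of \<open>z\<close> from the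
  lattice.\<close>

lemma norm_wrap_le: "(\<And>i. k $ i \<in> \<int>) \<Longrightarrow> norm (wrap z) \<le> norm (z - k)"
proof (rule norm_le_componentwise_cart)
  fix i assume "\<And>i. k $ i \<in> \<int>"
  then obtain m where "k $ i = of_int m" using Ints_cases by metis
  thus "norm (wrap z $ i) \<le> norm ((z - k) $ i)"
    using round_diff_minimal[of "z $ i" m] by (simp add: wrap_def)
qed

lemma norm_wrap_minus: "norm (wrap (- z)) = norm (wrap z)"
proof -
  have "norm (wrap (- z)) \<le> norm (wrap z)" for z :: "real^'a"
  proof -
    have "norm (wrap (- z)) \<le> norm (- z - (wrap z - z))"
      using wrap_diff_integer[of z] by (intro norm_wrap_le) (metis Ints_minus minus_diff_eq vector_uminus_component)
    thus ?thesis by simp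
  qed
  from this[of z] this[of "- z"] show ?thesis by simp
qed

lemma norm_wrap_sym: "norm (wrap (x - y)) = norm (wrap (y - x))"
  using norm_wrap_minus[of "y - x"] by simp

lemma profile_norm_cong: "norm z = norm z' \<Longrightarrow> profile r z = profile r (z' :: real^'n)" for z :: "real^'n"
  by (simp add: profile_def dot_square_norm)

lemma profile_wrap_sym: "profile r (wrap (x - y)) = profile r (wrap (y - x))"
  by (rule profile_norm_cong[OF norm_wrap_sym])

lemma profile_periodized:
  "profile r (wrap (y - x)) = periodized (\<lambda>z. (1 / r) ^ CARD('n) * (2 * bump 2 (1 - z \<bullet> z))) r x (y :: real^'n::finite)"
  by (simp only: profile_def periodized_def)

lemma continuous_profile_wrap:
  fixes x :: "real^'n::finite"
  assumes "0 < r" "r < 1/2"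
  shows "continuous_on UNIV (\<lambda>y. profile r (wrap (y - x)))" "continuous_on UNIV (\<lambda>y. profile r (wrap (x - y)))"
proof -
  have n: "bump_poly (\<lambda>z::real^'n. (1 / r) ^ CARD('n) * (2 * bump 2 (1 - z \<bullet> z)))"
    by (intro bump_poly.intros)
  obtain a' where "\<And>z::real^'n. ((\<lambda>z. (1 / r) ^ CARD('n) * (2 * bump 2 (1 - z \<bullet> z))) has_derivative a' z) (at z)"
      "\<And>w. bump_poly (\<lambda>z. a' z w)"
    using bump_poly_has_derivative[OF n] by auto
  from has_derivative_continuous[OF periodized_has_derivative[OF n this assms]]
  show 1: "continuous_on UNIV (\<lambda>y. profile r (wrap (y - x)))"
    unfolding profile_periodized by (intro continuous_at_imp_continuous_on) auto
  thus "continuous_on UNIV (\<lambda>y. profile r (wrap (x - y)))"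
    by (simp add: profile_wrap_sym)
qed

section \<open>Mollification\<close>

text \<open>The kernel is not normalised: \<open>mollify r v\<close> approximates \<open>profile_mass\<close> times \<open>v\<close>.\<close>

definition mollify :: "real \<Rightarrow> (real^'n::finite \<Rightarrow> 'b::euclidean_space) \<Rightarrow> real^'n \<Rightarrow> 'b" where
  "mollify r v x = (\<integral>y. profile r (wrap (y - x)) *\<^sub>R v y \<partial>torus_measure)"

lemma integrable_torus_bounded_scaleR:
  fixes v :: "real^'n::finite \<Rightarrow> 'b::euclidean_space"
  assumes "integrable torus_measure v" "h \<in> borel_measurable torus_measure" "\<And>y. y \<in> unit_cell \<Longrightarrow> \<bar>h y\<bar> \<le> C"
  shows "integrable torus_measure (\<lambda>y. h y *\<^sub>R v y)"
proof (rule Bochner_Integration.integrable_bound)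
  show "integrable torus_measure (\<lambda>y. C * norm (v y))" using assms by auto
  show "(\<lambda>y. h y *\<^sub>R v y) \<in> borel_measurable torus_measure"
    using assms by (intro borel_measurable_scaleR) auto
  show "AE y in torus_measure. norm (h y *\<^sub>R v y) \<le> norm (C * norm (v y))"
    using assms(3) by (intro AE_I2) (auto simp: abs_mult intro!: mult_right_mono order_trans[OF assms(3) abs_ge_self])
qed

lemma integrable_mollify:
  fixes v :: "real^'n::finite \<Rightarrow> 'b::euclidean_space"
  assumes "integrable torus_measure v" "r > 0"
  shows "integrable torus_measure (\<lambda>y. profile r (wrap (y - x)) *\<^sub>R v y)"
proof -
  obtain C where "\<And>z::real^'n. \<bar>profile r z\<bar> \<le> C" using profile_bounded[OF assms(2)] by blast
  thus ?thesis
    by (intro integrable_torus_bounded_scaleR[OF assms(1)] borel_measurable_torus) auto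
qed

lemma continuous_mollify:
  fixes v :: "real^'n::finite \<Rightarrow> 'b::euclidean_space"
  assumes v: "integrable torus_measure v" and r: "0 < r" "r < 1/2"
  shows "continuous_on UNIV (mollify r v)"
  unfolding continuous_on_sequentially
proof (intro ballI allI impI, elim conjE)
  fix x :: "nat \<Rightarrow> real^'n" and a assume x: "x \<longlonglongrightarrow> a"
  obtain C where C: "C \<ge> 0" "\<And>z::real^'n. \<bar>profile r z\<bar> \<le> C" using profile_bounded[OF r(1)] by blast
  have "(\<lambda>n. \<integral>y. profile r (wrap (y - x n)) *\<^sub>R v y \<partial>torus_measure)
      \<longlonglongrightarrow> (\<integral>y. profile r (wrap (y - a)) *\<^sub>R v y \<partial>torus_measure)"
  proof (rule integral_dominated_convergence[where w="\<lambda>y. C * norm (v y)"])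
    show "AE y in torus_measure. (\<lambda>n. profile r (wrap (y - x n)) *\<^sub>R v y) \<longlonglongrightarrow> profile r (wrap (y - a)) *\<^sub>R v y"
    proof (rule AE_I2)
      fix y :: "real^'n"
      have cont: "isCont (\<lambda>x. profile r (wrap (y - x))) a"
        using continuous_profile_wrap(2)[OF r, of y] by (simp add: continuous_on_eq_continuous_at)
      thus "(\<lambda>n. profile r (wrap (y - x n)) *\<^sub>R v y) \<longlonglongrightarrow> profile r (wrap (y - a)) *\<^sub>R v y"
        by (intro tendsto_intros isCont_tendsto_compose[OF cont x])
    qed
    show "AE y in torus_measure. norm (profile r (wrap (y - x n)) *\<^sub>R v y) \<le> C * norm (v y)" for n
      using C(2) by (intro AE_I2) (auto intro!: mult_right_mono)
  qed (use v integrable_mollify[OF v r(1)] in auto)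
  thus "(mollify r v \<circ> x) \<longlonglongrightarrow> mollify r v a"
    by (simp add: comp_def mollify_def)
qed

lemma periodic_mollify:
  fixes v :: "real^'n::finite \<Rightarrow> 'b::euclidean_space"
  shows "periodic (mollify r v)"
proof -
  have "wrap (y - (x + axis i 1)) = wrap (y - x)" for y x :: "real^'n" and i
    using wrap_add_axis[of "y - (x + axis i 1)" i] by (simp add: algebra_simps)
  thus ?thesis by (simp add: periodic_def mollify_def)
qed

lemma periodic_lattice:
  fixes u :: "real^'n::finite \<Rightarrow> 'b"
  assumes u: "periodic u"
  shows "u (x + lattice_vec k) = u x"
proof -
  have nat: "u (x + real m *\<^sub>R axis i 1) = u x" for x :: "real^'n" and m i
  proof (induction m)
    case (Suc m)
    have "x + real (Suc m) *\<^sub>R axis i 1 = (x + real m *\<^sub>R axis i 1) + axis i 1"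
      by (simp add: algebra_simps)
    moreover have "u ((x + real m *\<^sub>R axis i 1) + axis i 1) = u (x + real m *\<^sub>R axis i 1)"
      using u unfolding periodic_def by blast
    ultimately show ?case using Suc by metis
  qed simp
  have int: "u (x + of_int m *\<^sub>R axis i 1) = u x" for x :: "real^'n" and m i
  proof (cases m)
    case (nonneg n)
    thus ?thesis using nat by simp
  next
    case (neg n)
    thus ?thesis using nat[of "x + of_int m *\<^sub>R axis i 1" "Suc n" i]
      by (simp del: of_nat_Suc add: add.assoc flip: scaleR_add_left)
  qed
  have "u (x + (\<Sum>i\<in>I. of_int (k $ i) *\<^sub>R axis i 1)) = u x" if "finite I" for I
    using that
  proof (induction I)
    case (insert i I)
    thus ?case using int[of "x + (\<Sum>i\<in>I. of_int (k $ i) *\<^sub>R axis i 1)" "k $ i" i]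
      by (simp add: add.assoc add.commute[of "of_int (k $ i) *\<^sub>R axis i 1"])
  qed simp
  from this[of UNIV] have "u (x + (\<Sum>i\<in>UNIV. of_int (k $ i) *\<^sub>R axis i 1)) = u x" by simp
  moreover have "(\<Sum>i\<in>UNIV. of_int (k $ i) *\<^sub>R axis i 1) = (lattice_vec k :: real^'n)"
    by (simp add: vec_eq_iff lattice_vec_def axis_def if_distrib sum.delta cong: if_cong)
  ultimately show ?thesis by simp
qed

lemma lattice_vec_cases:
  assumes "\<And>i. (k :: real^'n::finite) $ i \<in> \<int>"
  obtains m where "k = lattice_vec m"
proof -
  have "k = lattice_vec (\<chi> i. \<lfloor>k $ i\<rfloor>)"
    using assms by (simp add: lattice_vec_def vec_eq_iff of_int_floor)
  thus ?thesis using that by blast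
qed

lemma periodic_wrap_eq:
  fixes u :: "real^'n::finite \<Rightarrow> 'b"
  assumes "periodic u"
  shows "u (x + wrap (y - x)) = u y"
proof -
  obtain k where k: "(y - x) - wrap (y - x) = lattice_vec k"
    using lattice_vec_cases[OF wrap_diff_integer] by blast
  have "y = (x + wrap (y - x)) + lattice_vec k" using k by (simp add: algebra_simps)
  thus ?thesis using periodic_lattice[OF assms] by metis
qed

lemma periodic_bounded:
  fixes u :: "real^'n::finite \<Rightarrow> 'b::euclidean_space"
  assumes "continuous_on UNIV u"
  obtains C where "C \<ge> 0" "\<And>x. x \<in> unit_cell \<Longrightarrow> norm (u x) \<le> C"
proof -
  have "bounded (u ` cbox 0 (\<chi> i. 1))"
    by (intro compact_imp_bounded compact_continuous_image continuous_on_subset[OF assms] compact_cbox) auto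
  then obtain C where "\<And>x. x \<in> unit_cell \<Longrightarrow> norm (u x) \<le> C"
    unfolding bounded_iff using unit_cell_subset_cbox by blast
  thus ?thesis using that[of "max 0 C"] by (meson max.cobounded1 max.coboundedI2)
qed

lemma mollify_tendsto:
  fixes \<phi> :: "real^'n::finite \<Rightarrow> real"
  assumes \<phi>: "continuous_on UNIV \<phi>" "periodic \<phi>" and r: "\<And>m. 0 < r m" "\<And>m. r m < 1/2" "r \<longlonglongrightarrow> 0"
  shows "(\<lambda>m. mollify (r m) \<phi> y) \<longlonglongrightarrow> profile_mass TYPE('n) * \<phi> y"
proof -
  let ?c = "profile_mass TYPE('n)"
  have c: "?c > 0" by (rule profile_mass_pos)
  have int\<phi>: "integrable torus_measure \<phi>"
  proof -
    obtain C where "\<And>x. x \<in> unit_cell \<Longrightarrow> norm (\<phi> x) \<le> C" using periodic_bounded[OF \<phi>(1)] by blast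
    thus ?thesis
      using borel_measurable_torus[OF borel_measurable_continuous_onI[OF \<phi>(1)]]
      by (intro torus.integrable_const_bound[where B=C] AE_I2) auto
  qed
  have one: "integrable torus_measure (\<lambda>x::real^'n. 1::real)" by simp
  show ?thesis
  proof (rule LIMSEQ_I)
    fix e :: real assume "e > 0"
    hence e: "e / (2 * ?c) > 0" using c by simp
    have "isCont \<phi> y" using \<phi>(1) by (simp add: continuous_on_eq_continuous_at)
    then obtain d where d: "d > 0" "\<And>x. norm (x - y) < d \<Longrightarrow> \<bar>\<phi> x - \<phi> y\<bar> < e / (2 * ?c)"
      using e unfolding continuous_at_eps_delta dist_norm by (metis real_norm_def)
    obtain N where N: "\<And>m. m \<ge> N \<Longrightarrow> r m < d"
      using order_tendstoD(2)[OF r(3) d(1)] by (auto simp: eventually_sequentially)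
    show "\<exists>N. \<forall>m\<ge>N. norm (mollify (r m) \<phi> y - ?c * \<phi> y) < e"
    proof (intro exI allI impI)
      fix m assume m: "m \<ge> N"
      define p where "p x = profile (r m) (wrap (x - y))" for x
      have ip: "integrable torus_measure p" unfolding p_def using integrable_mollify[OF one r(1)] by simp
      have ip\<phi>: "integrable torus_measure (\<lambda>x. p x * \<phi> x)"
        unfolding p_def using integrable_mollify[OF int\<phi> r(1)] by simp
      have mass: "(\<integral>x. p x \<partial>torus_measure) = ?c" unfolding p_def using integral_profile r by blast
      have "mollify (r m) \<phi> y - ?c * \<phi> y = (\<integral>x. p x * \<phi> x \<partial>torus_measure) - (\<integral>x. p x * \<phi> y \<partial>torus_measure)"
        using mass by (simp add: mollify_def p_def)
      also have "\<dots> = (\<integral>x. p x * \<phi> x - p x * \<phi> y \<partial>torus_measure)"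
        using ip ip\<phi> by (intro Bochner_Integration.integral_diff[symmetric]) auto
      also have "norm \<dots> \<le> (\<integral>x. p x * (e / (2 * ?c)) \<partial>torus_measure)"
      proof (rule Bochner_Integration.integral_norm_bound_integral)
        fix x
        show "norm (p x * \<phi> x - p x * \<phi> y) \<le> p x * (e / (2 * ?c))"
        proof (cases "norm (wrap (x - y)) < r m")
          case True
          hence "\<bar>\<phi> (y + wrap (x - y)) - \<phi> y\<bar> < e / (2 * ?c)"
            using N[OF m] by (intro d) simp
          hence "\<bar>\<phi> x - \<phi> y\<bar> \<le> e / (2 * ?c)" using periodic_wrap_eq[OF \<phi>(2)] by simp
          hence "p x * \<bar>\<phi> x - \<phi> y\<bar> \<le> p x * (e / (2 * ?c))"
            using r(1) by (intro mult_left_mono) (auto simp: p_def profile_nonneg)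
          moreover have "0 \<le> p x" using r(1) by (simp add: p_def profile_nonneg)
          hence "norm (p x * \<phi> x - p x * \<phi> y) = p x * \<bar>\<phi> x - \<phi> y\<bar>"
            unfolding right_diff_distrib[symmetric] by (simp add: abs_mult)
          ultimately show ?thesis by simp
        next
          case False
          hence "p x = 0" unfolding p_def using r(1) by (intro profile_support) auto
          thus ?thesis by simp
        qed
      qed (use ip ip\<phi> in auto)
      also have "\<dots> = ?c * (e / (2 * ?c))" using mass ip by simp
      also have "\<dots> < e" using c \<open>e > 0\<close> by simp
      finally show "norm (mollify (r m) \<phi> y - ?c * \<phi> y) < e" .
    qed
  qed
qed

lemma set_integral_torus_eqI_0:
  fixes f :: "real^'n::finite \<Rightarrow> 'b::euclidean_space"
  assumes f: "integrable torus_measure f"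
    and zero: "\<And>A. A \<in> sets borel \<Longrightarrow> (\<integral>x. indicator A x *\<^sub>R f x \<partial>torus_measure) = 0"
  shows "AE x in torus_measure. f x = 0"
proof (rule torus.density_zero[OF f])
  fix A assume "A \<in> sets (torus_measure :: (real^'n) measure)"
  hence "A \<in> sets (lebesgue :: (real^'n) measure)"
    by (auto simp: sets_restrict_space intro: sets.Int)
  then obtain S N N' where A: "A = S \<union> N" "N \<subseteq> N'" "N' \<in> null_sets lborel" "S \<in> sets lborel"
    by (rule sets_completionE)
  have "AE x in torus_measure. x \<notin> N'"
  proof -
    have "AE x in lebesgue. x \<notin> N'" by (intro AE_completion AE_not_in A(3))
    hence "AE x in lebesgue. x \<in> unit_cell \<longrightarrow> x \<notin> N'" by eventually_elim simp
    thus ?thesis by (subst AE_restrict_space_iff) auto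
  qed
  hence ae: "AE x in torus_measure. indicator A x *\<^sub>R f x = indicator S x *\<^sub>R f x"
  proof eventually_elim
    case (elim x)
    thus ?case using A by (auto simp: indicator_def)
  qed
  have S: "indicator S \<in> borel_measurable (torus_measure :: (real^'n) measure)"
    using A by (intro borel_measurable_torus) auto
  have "(\<integral>x. indicator A x *\<^sub>R f x \<partial>torus_measure) = (\<integral>x. indicator S x *\<^sub>R f x \<partial>torus_measure)"
  proof (rule integral_cong_AE[OF _ _ ae])
    show "(\<lambda>x. indicator S x *\<^sub>R f x) \<in> borel_measurable torus_measure"
      using S f by (intro borel_measurable_scaleR) auto
    show "(\<lambda>x. indicator A x *\<^sub>R f x) \<in> borel_measurable torus_measure"
      using \<open>A \<in> sets torus_measure\<close> f by (intro borel_measurable_scaleR) auto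
  qed
  thus "set_lebesgue_integral torus_measure A f = 0"
    using zero[of S] A by (simp add: set_lebesgue_integral_def)
qed

section \<open>Continuous periodic functions separate integrable functions\<close>

definition open_cell :: "(real^'n) set" where
  "open_cell = {x. \<forall>i. 0 < x $ i \<and> x $ i < 1}"

lemma open_open_cell: "open (open_cell :: (real^'n::finite) set)"
proof -
  have "open_cell = (box 0 (\<chi> i. 1) :: (real^'n) set)" by (auto simp: open_cell_def mem_box_cart)
  thus ?thesis using open_box[of 0 "\<chi> i. 1 :: real^'n"] by argo
qed

lemma AE_open_cell: "AE x in torus_measure. x \<in> (open_cell :: (real^'n::finite) set)"
proof -
  have "AE x in lebesgue. x \<notin> {x :: real^'n. x $ i = 0}" for i
    using negligible_standard_hyperplane_cart
    by (intro AE_not_in) (simp add: negligible_iff_null_sets)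
  hence "AE x in lebesgue. \<forall>i. x \<notin> {x :: real^'n. x $ i = 0}"
    by (simp add: AE_all_countable)
  hence "AE x in lebesgue. x \<in> unit_cell \<longrightarrow> x \<in> (open_cell :: (real^'n) set)"
    by eventually_elim (auto simp: unit_cell_def open_cell_def less_le)
  thus ?thesis by (subst AE_restrict_space_iff) auto
qed

lemma unit_cell_lattice_unique:
  assumes "x \<in> unit_cell" "x + lattice_vec k \<in> unit_cell"
  shows "lattice_vec k = (0 :: real^'n)"
proof -
  have "k $ i = 0" for i
  proof -
    have "0 \<le> x $ i" "x $ i < 1" "0 \<le> x $ i + of_int (k $ i)" "x $ i + of_int (k $ i) < 1"
      using assms by (auto simp: unit_cell_def lattice_vec_def)
    hence "of_int (k $ i) < (1::real)" "of_int (k $ i) > (-1::real)" by linarith+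
    thus ?thesis by linarith
  qed
  thus ?thesis by (simp add: lattice_vec_def vec_eq_iff)
qed

text \<open>The complement of all lattice translates of an open set \<open>U\<close> inside the cell is closed and periodic.
  The distance from it is a continuous periodic function that is positive, within the cell,
  exactly on \<open>U\<close>; cut-off multiples of it increase to the indicator of \<open>U\<close>.\<close>

lemma integral_open_eq_0:
  fixes f :: "real^'n::finite \<Rightarrow> 'b::euclidean_space"
  assumes f: "integrable torus_measure f"
    and zero: "\<And>\<phi>. continuous_on UNIV \<phi> \<Longrightarrow> periodic \<phi> \<Longrightarrow> (\<integral>x. \<phi> x *\<^sub>R f x \<partial>torus_measure) = 0"
    and U: "open U" "U \<subseteq> open_cell"
  shows "(\<integral>x. indicator U x *\<^sub>R f x \<partial>torus_measure) = 0"
proof -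
  \<comment> \<open>Nonempty, as it contains the lattice: no lattice point lies in the open cell.\<close>
  define C where "C = - (\<Union>k. (+) (lattice_vec k) ` U)"
  have oc: "open_cell \<subseteq> (unit_cell :: (real^'n) set)"
    by (auto simp: open_cell_def unit_cell_def less_imp_le)
  have clC: "closed C"
    unfolding C_def using U(1) by (intro closed_Compl open_UN) (auto intro: open_translation)
  have memC: "x \<in> C \<longleftrightarrow> (\<forall>k. x - lattice_vec k \<notin> U)" for x
  proof -
    have "x \<in> (+) a ` U \<longleftrightarrow> x - a \<in> U" for a
      by (auto simp: image_iff intro!: bexI[of _ "x - a"])
    thus ?thesis by (auto simp: C_def)
  qed
  have lat: "c + lattice_vec l \<in> C" if "c \<in> C" for c l
  proof -
    have "c + lattice_vec l - lattice_vec k = c - lattice_vec (k - l)" for k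
      by (simp add: lattice_vec_def vec_eq_iff)
    thus ?thesis using that unfolding memC by metis
  qed
  have neC: "C \<noteq> {}"
  proof -
    have "0 - lattice_vec k \<notin> U" for k
    proof
      assume "0 - lattice_vec k \<in> U"
      hence "0 < - real_of_int (k $ i) \<and> - real_of_int (k $ i) < 1" for i
        using U(2) by (auto simp: open_cell_def lattice_vec_def)
      hence "0 < - (k $ i) \<and> - (k $ i) < 1" for i by (metis of_int_0_less_iff of_int_less_1_iff of_int_minus)
      thus False by force
    qed
    thus ?thesis using memC[of 0] by blast
  qed
  have cell: "x \<in> C \<longleftrightarrow> x \<notin> U" if "x \<in> unit_cell" for x
  proof
    assume "x \<in> C"
    moreover have "lattice_vec 0 = (0 :: real^'n)" by (simp add: lattice_vec_def vec_eq_iff)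
    ultimately show "x \<notin> U" unfolding memC by (metis diff_zero)
  next
    assume x: "x \<notin> U"
    show "x \<in> C" unfolding memC
    proof (intro allI notI)
      fix k assume k: "x - lattice_vec k \<in> U"
      have "x - lattice_vec k + lattice_vec k \<in> unit_cell" using that by simp
      hence "lattice_vec k = (0 :: real^'n)"
        using unit_cell_lattice_unique[of "x - lattice_vec k" k] k U(2) oc by blast
      thus False using k x by simp
    qed
  qed
  define \<phi> where "\<phi> m x = min 1 (real m * infdist x C)" for m x
  have cont: "continuous_on UNIV (\<phi> m)" for m
    unfolding \<phi>_def by (intro continuous_intros)
  have per: "periodic (\<phi> m)" for m
  proof -
    have le: "infdist (x + lattice_vec l) C \<le> infdist x C" for x l
      unfolding infdist_notempty[OF neC, of x]
    proof (rule cINF_greatest[OF neC])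
      fix c assume "c \<in> C"
      from infdist_le[OF lat[OF this]] show "infdist (x + lattice_vec l) C \<le> dist x c"
        by (metis dist_add_cancel2)
    qed
    have "infdist (x + axis i 1) C = infdist x C" for x i
    proof -
      have ax: "lattice_vec (axis i 1) = (axis i 1 :: real^'n)" "lattice_vec (- axis i 1) = (- axis i 1 :: real^'n)"
        by (auto simp: lattice_vec_def axis_def vec_eq_iff)
      show ?thesis using le[of x "axis i 1"] le[of "x + axis i 1" "- axis i 1"] by (simp add: ax)
    qed
    thus ?thesis by (simp add: periodic_def \<phi>_def)
  qed
  have bd: "\<bar>\<phi> m x\<bar> \<le> 1" for m x by (simp add: \<phi>_def infdist_nonneg)
  have "(\<lambda>m. \<integral>x. \<phi> m x *\<^sub>R f x \<partial>torus_measure) \<longlonglongrightarrow> (\<integral>x. indicator U x *\<^sub>R f x \<partial>torus_measure)"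
  proof (rule integral_dominated_convergence[where w="\<lambda>x. norm (f x)"])
    show "AE x in torus_measure. (\<lambda>m. \<phi> m x *\<^sub>R f x) \<longlonglongrightarrow> indicator U x *\<^sub>R f x"
    proof (rule AE_I2)
      fix x :: "real^'n" assume "x \<in> space torus_measure"
      hence x: "x \<in> unit_cell" by simp
      show "(\<lambda>m. \<phi> m x *\<^sub>R f x) \<longlonglongrightarrow> indicator U x *\<^sub>R f x"
      proof (cases "x \<in> U")
        case True
        hence "infdist x C > 0" using cell[OF x] in_closed_iff_infdist_zero[OF clC neC] infdist_nonneg[of x C]
          by (metis less_eq_real_def)
        then obtain N where N: "1 \<le> real N * infdist x C"
          by (metis less_imp_le reals_Archimedean3)
        have "\<phi> m x = 1" if "m \<ge> N" for m
          using N mult_right_mono[of "real N" "real m" "infdist x C"] that infdist_nonneg[of x C]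
          by (simp add: \<phi>_def)
        hence "(\<lambda>m. \<phi> m x) \<longlonglongrightarrow> 1"
          by (intro tendsto_eventually) (auto simp: eventually_sequentially)
        thus ?thesis using True by (auto intro!: tendsto_eq_intros)
      next
        case False
        hence "infdist x C = 0" using cell[OF x] by simp
        thus ?thesis using False by (simp add: \<phi>_def)
      qed
    qed
    show "AE x in torus_measure. norm (\<phi> m x *\<^sub>R f x) \<le> norm (f x)" for m
      using bd[of m] by (intro AE_I2) (simp add: mult_left_le_one_le)
    show "(\<lambda>x. indicator U x *\<^sub>R f x) \<in> borel_measurable torus_measure"
      using f U(1) by (intro borel_measurable_scaleR[OF borel_measurable_torus]) auto
    show "(\<lambda>x. \<phi> m x *\<^sub>R f x) \<in> borel_measurable torus_measure" for m
      using f by (intro borel_measurable_scaleR[OF borel_measurable_torus] borel_measurable_continuous_onI cont) auto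
  qed (use f in auto)
  moreover have "(\<integral>x. \<phi> m x *\<^sub>R f x \<partial>torus_measure) = 0" for m by (rule zero[OF cont per])
  ultimately show ?thesis by (simp add: LIMSEQ_const_iff)
qed

text \<open>The integral over open subsets of the cell vanishes by approximation, hence over all Borel sets by
  Dynkin's theorem on generators closed under intersection.\<close>

lemma continuous_periodic_test_eq_0:
  fixes f :: "real^'n::finite \<Rightarrow> 'b::euclidean_space"
  assumes f: "integrable torus_measure f"
    and zero: "\<And>\<phi>. continuous_on UNIV \<phi> \<Longrightarrow> periodic \<phi> \<Longrightarrow> (\<integral>x. \<phi> x *\<^sub>R f x \<partial>torus_measure) = 0"
  shows "AE x in torus_measure. f x = 0"
proof (rule set_integral_torus_eqI_0[OF f])
  fix A :: "(real^'n) set" assume "A \<in> sets borel"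
  hence A: "A \<in> sigma_sets UNIV {S. open S}" by (simp add: borel_def)
  define J where "J A = (\<integral>x. indicator (A \<inter> open_cell) x *\<^sub>R f x \<partial>torus_measure)" for A
  have ind: "integrable torus_measure (\<lambda>x. indicator B x *\<^sub>R f x)" if "B \<in> sets borel" for B
    using that by (intro integrable_torus_bounded_scaleR[OF f, of _ 1] borel_measurable_torus) auto
  have ocb: "open_cell \<in> sets (borel :: (real^'n) measure)" by (simp add: open_open_cell)
  have sig: "X \<in> sets borel" if "X \<in> sigma_sets UNIV {S. open S}" for X :: "(real^'n) set"
    using that by (simp add: borel_def)
  have "J A = 0"
  proof (rule sigma_sets_induct_disjoint[OF _ _ A])
    show "Int_stable {S :: (real^'n) set. open S}" by (auto simp: Int_stable_def)
    show "J X = 0" if "X \<in> {S. open S}" for X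
      unfolding J_def using that open_open_cell by (intro integral_open_eq_0[OF f zero]) auto
    show "J {} = 0" by (simp add: J_def)
    show "J (UNIV - X) = 0" if X: "X \<in> sigma_sets UNIV {S. open S}" "J X = 0" for X
    proof -
      have "J (UNIV - X) = (\<integral>x. indicator open_cell x *\<^sub>R f x - indicator (X \<inter> open_cell) x *\<^sub>R f x \<partial>torus_measure)"
        unfolding J_def by (intro Bochner_Integration.integral_cong) (auto simp: indicator_def)
      also have "\<dots> = (\<integral>x. indicator open_cell x *\<^sub>R f x \<partial>torus_measure) - J X"
        unfolding J_def using ocb sig[OF X(1)] by (intro Bochner_Integration.integral_diff ind sets.Int)
      also have "\<dots> = 0"
        using X(2) integral_open_eq_0[OF f zero open_open_cell] by simp
      finally show ?thesis .
    qed
    show "J (\<Union>i. X i) = 0"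
      if X: "disjoint_family X" "range X \<subseteq> sigma_sets UNIV {S. open S}" "\<And>i::nat. J (X i) = 0" for X
    proof -
      define Y where "Y i = X i \<inter> open_cell \<inter> unit_cell" for i
      have Xb: "X i \<in> sets borel" for i using X(2) sig by blast
      have Yt: "Y i \<in> sets torus_measure" for i
        using Xb ocb by (auto simp: sets_restrict_space Y_def intro!: image_eqI[of _ _ "Y i"] sets_completionI_sets)
      have "(LINT x:(\<Union>i. Y i)|torus_measure. f x) = (\<Sum>i. (LINT x:(Y i)|torus_measure. f x))"
      proof (rule lebesgue_integral_countable_add[OF Yt])
        show "Y i \<inter> Y j = {}" if "i \<noteq> j" for i j
          using X(1) that by (auto simp: disjoint_family_on_def Y_def)
        show "set_integrable torus_measure (\<Union>i. Y i) f"
          unfolding set_integrable_def by (intro integrable_mult_indicator f sets.countable_UN) (use Yt in auto)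
      qed
      also have "(\<lambda>i. LINT x:(Y i)|torus_measure. f x) = (\<lambda>i. J (X i))"
        unfolding J_def set_lebesgue_integral_def
        by (intro ext Bochner_Integration.integral_cong) (auto simp: Y_def indicator_def)
      also have "(LINT x:(\<Union>i. Y i)|torus_measure. f x) = J (\<Union>i. X i)"
        unfolding J_def set_lebesgue_integral_def
        by (intro Bochner_Integration.integral_cong) (auto simp: Y_def indicator_def)
      finally show ?thesis using X(3) by simp
    qed
  qed auto
  moreover have "(\<integral>x. indicator A x *\<^sub>R f x \<partial>torus_measure) = J A"
    unfolding J_def
  proof (rule integral_cong_AE)
    show "AE x in torus_measure. indicator A x *\<^sub>R f x = indicator (A \<inter> open_cell) x *\<^sub>R f x"
      using AE_open_cell by eventually_elim (auto simp: indicator_def)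
  qed (use ind \<open>A \<in> sets borel\<close> ocb in auto)
  ultimately show "(\<integral>x. indicator A x *\<^sub>R f x \<partial>torus_measure) = 0" by simp
qed

lemma integrable_torus_pair_bounded:
  fixes v :: "real^'n::finite \<Rightarrow> 'b::euclidean_space" and h :: "'a::second_countable_topology \<Rightarrow> real^'n \<Rightarrow> real"
  assumes v: "integrable torus_measure v" and N: "finite_measure N" "(\<lambda>x. x) \<in> N \<rightarrow>\<^sub>M borel"
    and h: "(\<lambda>(x, y). h x y) \<in> borel_measurable (borel \<Otimes>\<^sub>M borel)"
    and C: "\<And>x y. x \<in> space N \<Longrightarrow> \<bar>h x y\<bar> \<le> C"
  shows "integrable (N \<Otimes>\<^sub>M torus_measure) (\<lambda>(x, y). h x y *\<^sub>R v y)"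
proof -
  interpret N: finite_measure N by (rule N(1))
  interpret P: pair_sigma_finite N "torus_measure :: (real^'n) measure"
    by (intro pair_sigma_finite.intro N.sigma_finite_measure_axioms torus.sigma_finite_measure_axioms)
  have id: "(\<lambda>x. x) \<in> (torus_measure :: (real^'n) measure) \<rightarrow>\<^sub>M borel"
    by (rule borel_measurable_torus) simp
  have mh: "(\<lambda>(x, y). h x y) \<in> borel_measurable (N \<Otimes>\<^sub>M torus_measure)"
  proof -
    have f: "(\<lambda>p. fst p) \<in> N \<Otimes>\<^sub>M (torus_measure :: (real^'n) measure) \<rightarrow>\<^sub>M borel"
      by (rule measurable_compose[OF measurable_fst N(2)])
    have s: "(\<lambda>p. snd p) \<in> N \<Otimes>\<^sub>M (torus_measure :: (real^'n) measure) \<rightarrow>\<^sub>M borel"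
      by (rule measurable_compose[OF measurable_snd id])
    from measurable_compose[OF measurable_Pair[OF f s] h] show ?thesis
      by (simp only: case_prod_beta' fst_conv snd_conv)
  qed
  have mv: "(\<lambda>p. v (snd p)) \<in> borel_measurable (N \<Otimes>\<^sub>M torus_measure)"
    by (rule measurable_compose[OF measurable_snd]) (use v in simp)
  have "integrable (N \<Otimes>\<^sub>M torus_measure) (\<lambda>p. norm (v (snd p)))"
    by (rule P.Fubini_integrable[OF measurable_compose[OF mv borel_measurable_norm]]) (use v in auto)
  hence i: "integrable (N \<Otimes>\<^sub>M torus_measure) (\<lambda>p. C * norm (v (snd p)))"
    by simp
  show ?thesis
  proof (rule Bochner_Integration.integrable_bound[OF i])
    show "(\<lambda>(x, y). h x y *\<^sub>R v y) \<in> borel_measurable (N \<Otimes>\<^sub>M torus_measure)"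
      using borel_measurable_scaleR[OF mh mv] by (simp add: case_prod_beta)
    show "AE p in N \<Otimes>\<^sub>M torus_measure. norm (case p of (x, y) \<Rightarrow> h x y *\<^sub>R v y) \<le> norm (C * norm (v (snd p)))"
      by (intro AE_I2) (auto simp: space_pair_measure abs_mult intro!: mult_right_mono order_trans[OF C abs_ge_self])
  qed
qed

text \<open>The kernel is even, so that mollification can be moved to the other factor.\<close>

lemma mollify_symmetric:
  fixes v :: "real^'n::finite \<Rightarrow> 'b::euclidean_space" and \<phi> :: "real^'n \<Rightarrow> real"
  assumes v: "integrable torus_measure v" and \<phi>: "continuous_on UNIV \<phi>" and r: "r > 0"
  shows "(\<integral>x. \<phi> x *\<^sub>R mollify r v x \<partial>torus_measure) = (\<integral>y. mollify r \<phi> y *\<^sub>R v y \<partial>torus_measure)"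
proof -
  interpret P: pair_sigma_finite "torus_measure :: (real^'n) measure" "torus_measure :: (real^'n) measure"
    by (intro pair_sigma_finite.intro finite_measure.axioms torus.sigma_finite_measure_axioms)
  obtain C where C: "C \<ge> 0" "\<And>z::real^'n. \<bar>profile r z\<bar> \<le> C" using profile_bounded[OF r] by blast
  obtain D where D: "D \<ge> 0" "\<And>x. x \<in> unit_cell \<Longrightarrow> norm (\<phi> x) \<le> D" using periodic_bounded[OF \<phi>] by blast
  have [measurable]: "\<phi> \<in> borel_measurable borel" by (rule borel_measurable_continuous_onI[OF \<phi>])
  have int: "integrable (torus_measure \<Otimes>\<^sub>M torus_measure) (\<lambda>(x, y). (\<phi> x * profile r (wrap (y - x))) *\<^sub>R v y)"
  proof (rule integrable_torus_pair_bounded[OF v finite_measure_torus])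
    show "(\<lambda>x. x) \<in> (torus_measure :: (real^'n) measure) \<rightarrow>\<^sub>M borel"
      by (rule borel_measurable_torus) simp
    show "(\<lambda>(x, y). \<phi> x * profile r (wrap (y - x))) \<in> borel_measurable (borel \<Otimes>\<^sub>M borel)" by measurable
    show "\<bar>\<phi> x * profile r (wrap (y - x))\<bar> \<le> D * C" if "x \<in> space torus_measure" for x y
      unfolding abs_mult using C D that by (intro mult_mono) auto
  qed
  have "(\<integral>x. \<phi> x *\<^sub>R mollify r v x \<partial>torus_measure)
      = (\<integral>x. \<integral>y. (\<phi> x * profile r (wrap (y - x))) *\<^sub>R v y \<partial>torus_measure \<partial>torus_measure)"
    by (simp add: mollify_def flip: scaleR_scaleR)
  also have "\<dots> = (\<integral>y. \<integral>x. (\<phi> x * profile r (wrap (y - x))) *\<^sub>R v y \<partial>torus_measure \<partial>torus_measure)"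
    using P.Fubini_integral[OF int] by simp
  also have "\<dots> = (\<integral>y. mollify r \<phi> y *\<^sub>R v y \<partial>torus_measure)"
  proof (intro Bochner_Integration.integral_cong refl)
    fix y
    have \<phi>i: "integrable torus_measure \<phi>"
      using D by (intro torus.integrable_const_bound[where B=D] AE_I2 borel_measurable_torus) auto
    have "integrable torus_measure (\<lambda>x. \<phi> x * profile r (wrap (y - x)))"
      using integrable_mollify[OF \<phi>i r, of y] by (simp add: profile_wrap_sym[of r y] mult.commute)
    hence "(\<integral>x. (\<phi> x * profile r (wrap (y - x))) *\<^sub>R v y \<partial>torus_measure)
        = (\<integral>x. \<phi> x * profile r (wrap (y - x)) \<partial>torus_measure) *\<^sub>R v y"
      by (rule integral_scaleR_left)
    thus "(\<integral>x. (\<phi> x * profile r (wrap (y - x))) *\<^sub>R v y \<partial>torus_measure) = mollify r \<phi> y *\<^sub>R v y"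
      by (simp add: mollify_def profile_wrap_sym[of r y] mult.commute)
  qed
  finally show ?thesis .
qed

text \<open>Mollification is moved to a continuous test function, for which its convergence is elementary.
  This identifies pointwise limits of mollified integrable functions without the Lebesgue
  differentiation theorem.\<close>

lemma AE_eq_mollify_limit:
  fixes v u :: "real^'n::finite \<Rightarrow> 'b::euclidean_space"
  assumes v: "integrable torus_measure v" and u: "continuous_on UNIV u"
    and r: "\<And>m. 0 < r m" "\<And>m. r m < 1/2" "r \<longlonglongrightarrow> 0"
    and lim: "\<And>x. (\<lambda>m. mollify (r m) v x) \<longlonglongrightarrow> profile_mass TYPE('n) *\<^sub>R u x"
    and bd: "\<And>m x. norm (mollify (r m) v x) \<le> K"
  shows "AE x in torus_measure. u x = v x"
proof -
  let ?c = "profile_mass TYPE('n)"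
  have c: "?c > 0" by (rule profile_mass_pos)
  have intc: "integrable torus_measure g" if g: "continuous_on UNIV g" for g :: "real^'n \<Rightarrow> 'c::euclidean_space"
  proof -
    obtain C where "\<And>x. x \<in> unit_cell \<Longrightarrow> norm (g x) \<le> C" using periodic_bounded[OF g] by blast
    thus ?thesis
      using borel_measurable_torus[OF borel_measurable_continuous_onI[OF g]]
      by (intro torus.integrable_const_bound[where B=C] AE_I2) auto
  qed
  have "AE x in torus_measure. u x - v x = 0"
  proof (rule continuous_periodic_test_eq_0)
    show "integrable torus_measure (\<lambda>x. u x - v x)" using intc[OF u] v by auto
    fix \<phi> :: "real^'n \<Rightarrow> real" assume \<phi>: "continuous_on UNIV \<phi>" "periodic \<phi>"
    obtain D where D: "D \<ge> 0" "\<And>x. x \<in> unit_cell \<Longrightarrow> norm (\<phi> x) \<le> D" using periodic_bounded[OF \<phi>(1)] by blast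
    have mphi: "\<phi> \<in> borel_measurable torus_measure" using intc[OF \<phi>(1)] by simp
    have iu: "integrable torus_measure (\<lambda>x. \<phi> x *\<^sub>R u x)"
      by (intro integrable_torus_bounded_scaleR[OF intc[OF u] mphi, of D]) (use D in auto)
    have iv: "integrable torus_measure (\<lambda>x. \<phi> x *\<^sub>R v x)"
      by (intro integrable_torus_bounded_scaleR[OF v mphi, of D]) (use D in auto)
    have 1: "(\<lambda>m. \<integral>x. \<phi> x *\<^sub>R mollify (r m) v x \<partial>torus_measure)
       \<longlonglongrightarrow> (\<integral>x. \<phi> x *\<^sub>R (?c *\<^sub>R u x) \<partial>torus_measure)"
    proof (rule integral_dominated_convergence[where w="\<lambda>_. D * K"])
      show "AE x in torus_measure. (\<lambda>m. \<phi> x *\<^sub>R mollify (r m) v x) \<longlonglongrightarrow> \<phi> x *\<^sub>R (?c *\<^sub>R u x)"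
        using lim by (intro AE_I2 tendsto_intros)
      show "AE x in torus_measure. norm (\<phi> x *\<^sub>R mollify (r m) v x) \<le> D * K" for m
        using D bd by (intro AE_I2) (auto intro!: mult_mono)
      show "(\<lambda>x. \<phi> x *\<^sub>R mollify (r m) v x) \<in> borel_measurable torus_measure" for m
        using mphi intc[OF continuous_mollify[OF v r(1,2)]] by (intro borel_measurable_scaleR) auto
      show "(\<lambda>x. \<phi> x *\<^sub>R (?c *\<^sub>R u x)) \<in> borel_measurable torus_measure"
        using mphi intc[OF u] by (intro borel_measurable_scaleR) auto
    qed simp
    have 2: "(\<lambda>m. \<integral>y. mollify (r m) \<phi> y *\<^sub>R v y \<partial>torus_measure)
       \<longlonglongrightarrow> (\<integral>y. (?c * \<phi> y) *\<^sub>R v y \<partial>torus_measure)"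
    proof (rule integral_dominated_convergence[where w="\<lambda>y. ?c * D * norm (v y)"])
      show "AE y in torus_measure. (\<lambda>m. mollify (r m) \<phi> y *\<^sub>R v y) \<longlonglongrightarrow> (?c * \<phi> y) *\<^sub>R v y"
        by (intro AE_I2 tendsto_intros mollify_tendsto \<phi> r)
      have "\<bar>mollify (r m) \<phi> y\<bar> \<le> ?c * D" for m y
      proof -
        have one: "integrable torus_measure (\<lambda>x::real^'n. 1::real)" by simp
        have "norm (mollify (r m) \<phi> y) \<le> (\<integral>x. profile (r m) (wrap (x - y)) * D \<partial>torus_measure)"
          unfolding mollify_def
          using integrable_mollify[OF intc[OF \<phi>(1)] r(1)] integrable_mollify[OF one r(1)] D(2) profile_nonneg[OF r(1)]
          by (intro Bochner_Integration.integral_norm_bound_integral)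
            (auto simp: abs_mult abs_of_nonneg[OF profile_nonneg[OF r(1)]] intro!: mult_left_mono)
        also have "\<dots> = ?c * D" using integral_profile[OF r(1)[of m] r(2)[of m], of y] by simp
        finally show ?thesis by simp
      qed
      thus "AE y in torus_measure. norm (mollify (r m) \<phi> y *\<^sub>R v y) \<le> ?c * D * norm (v y)" for m
        by (intro AE_I2) (auto intro!: mult_right_mono)
      show "(\<lambda>y. mollify (r m) \<phi> y *\<^sub>R v y) \<in> borel_measurable torus_measure" for m
        using v intc[OF continuous_mollify[OF intc[OF \<phi>(1)] r(1,2)]] by (intro borel_measurable_scaleR) auto
      show "(\<lambda>y. (?c * \<phi> y) *\<^sub>R v y) \<in> borel_measurable torus_measure"
        using v mphi by (intro borel_measurable_scaleR) auto
    qed (use v in auto)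
    have "(\<integral>x. \<phi> x *\<^sub>R (?c *\<^sub>R u x) \<partial>torus_measure) = (\<integral>y. (?c * \<phi> y) *\<^sub>R v y \<partial>torus_measure)"
      using LIMSEQ_unique[OF 1] 2 mollify_symmetric[OF v \<phi>(1) r(1)] by simp
    hence "?c *\<^sub>R (\<integral>x. \<phi> x *\<^sub>R u x \<partial>torus_measure) = ?c *\<^sub>R (\<integral>y. \<phi> y *\<^sub>R v y \<partial>torus_measure)"
      by (simp add: scaleR_left_commute flip: scaleR_scaleR)
    hence "(\<integral>x. \<phi> x *\<^sub>R u x \<partial>torus_measure) = (\<integral>y. \<phi> y *\<^sub>R v y \<partial>torus_measure)" using c by simp
    thus "(\<integral>x. \<phi> x *\<^sub>R (u x - v x) \<partial>torus_measure) = 0"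
      using Bochner_Integration.integral_diff[OF iu iv] by (simp add: scaleR_diff_right)
  qed
  thus ?thesis by eventually_elim simp
qed

section \<open>Averages at different scales and the weak Laplacian\<close>

definition weak_laplacian :: "(real^'n::finite \<Rightarrow> 'b::euclidean_space) \<Rightarrow> (real^'n \<Rightarrow> 'b) \<Rightarrow> bool" where
  "weak_laplacian v h \<longleftrightarrow> (\<forall>\<phi>\<in>torus_test.
     (\<integral>x. (\<Sum>i\<in>UNIV. dir_deriv (axis i 1) (dir_deriv (axis i 1) \<phi>) x) *\<^sub>R v x \<partial>torus_measure)
       = (\<integral>x. \<phi> x *\<^sub>R h x \<partial>torus_measure))"

definition torus_ball :: "real^'n \<Rightarrow> real \<Rightarrow> (real^'n) set" where
  "torus_ball x r = {y \<in> unit_cell. norm (wrap (y - x)) < r}"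

lemma torus_ball_sets [measurable]: "torus_ball x r \<in> sets (torus_measure :: (real^'n::finite) measure)"
proof -
  have "{y \<in> unit_cell. norm (wrap (y - x)) < r} \<in> sets borel" by measurable
  thus ?thesis by (auto simp: torus_ball_def sets_restrict_space intro!: image_eqI[of _ _ "torus_ball x r"])
qed

lemma continuous_lap_bump: "continuous_on S (lap_bump :: real^'n::finite \<Rightarrow> real)"
  unfolding lap_bump_def by (intro continuous_intros)

lemma lap_bump_bounded: "\<exists>L\<ge>0. \<forall>z::real^'n::finite. \<bar>lap_bump z\<bar> \<le> L"
proof -
  have "lap_bump z = 0" if "norm z \<ge> 1" for z :: "real^'n"
  proof -
    have "1 \<le> (norm z)\<^sup>2" using that by (rule one_le_power)
    thus ?thesis by (simp add: lap_bump_def bump_eq_0 power2_norm_eq_inner)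
  qed
  from bounded_of_support[OF continuous_lap_bump this] show ?thesis by metis
qed

text \<open>By the choice of the kernel its scale derivative is a test function's Laplacian, and the weak
  Laplacian \<open>h\<close> takes over. The Cauchy-Schwarz inequality is used in the additive form
  \<open>2 |h| \<le> l |h|\<^sup>2 + 1/l\<close>, with a parameter \<open>c\<close> that is still free for the applications.\<close>

lemma scale_derivative_bound:
  fixes v h :: "real^'n::finite \<Rightarrow> 'b::euclidean_space"
  assumes lap: "weak_laplacian v h" and h: "integrable torus_measure h"
    and h2: "integrable torus_measure (\<lambda>x. (norm (h x))\<^sup>2)"
    and \<tau>: "0 < \<tau>" "\<tau> \<le> r" "r < 1/2" and c: "c > 0"
  shows "norm (\<integral>y. ((1 / \<tau>) ^ (CARD('n) + 1) * lap_bump ((1 / \<tau>) *\<^sub>R wrap (y - x))) *\<^sub>R v y \<partial>torus_measure)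
     \<le> 1/2 * \<tau> powr (1 - CARD('n) / 2) *
        (c * (\<integral>y. indicator (torus_ball x r) y * (norm (h y))\<^sup>2 \<partial>torus_measure) + unit_ball_vol CARD('n) / c)"
proof -
  define n where "n = CARD('n)"
  define w where "w = unit_ball_vol (real n)"
  define m where "m = (\<integral>y. indicator (torus_ball x r) y * (norm (h y))\<^sup>2 \<partial>torus_measure)"
  define \<psi> where "\<psi> = periodized (\<lambda>z::real^'n. bump 0 (1 - z \<bullet> z)) \<tau> x"
  \<comment> \<open>The parameter that balances the volume of the ball of radius \<open>\<tau>\<close> against the integral of \<open>|h|\<^sup>2\<close>.\<close>
  define l where "l = c * \<tau> powr (n / 2)"
  have n: "n > 0" by (simp add: n_def)
  have l: "l > 0" using c \<tau> by (simp add: l_def)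
  have \<tau>': "\<tau> < 1/2" using \<tau> by simp
  have "\<psi> \<in> torus_test" unfolding \<psi>_def by (intro periodized_torus_test bump_poly.base \<tau> \<tau>')
  hence eq: "(\<integral>y. ((1 / \<tau>)\<^sup>2 * lap_bump ((1 / \<tau>) *\<^sub>R wrap (y - x))) *\<^sub>R v y \<partial>torus_measure)
      = (\<integral>y. \<psi> y *\<^sub>R h y \<partial>torus_measure)"
  proof -
    assume "\<psi> \<in> torus_test"
    with lap have "(\<integral>y. (\<Sum>i\<in>UNIV. dir_deriv (axis i 1) (dir_deriv (axis i 1) \<psi>) y) *\<^sub>R v y \<partial>torus_measure)
        = (\<integral>y. \<psi> y *\<^sub>R h y \<partial>torus_measure)"
      unfolding weak_laplacian_def by blast
    moreover have "(\<Sum>i\<in>UNIV. dir_deriv (axis i 1) (dir_deriv (axis i 1) \<psi>) y)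
        = (1 / \<tau>)\<^sup>2 * lap_bump ((1 / \<tau>) *\<^sub>R wrap (y - x))" for y
      using laplacian_periodized_bump[OF \<tau>(1) \<tau>', of x y] by (simp only: \<psi>_def periodized_def[of lap_bump])
    ultimately show ?thesis by simp
  qed
  have "(1 / \<tau>) ^ (n + 1) = (1 / \<tau>) ^ (n - 1) * (1 / \<tau>)\<^sup>2"
    using n by (simp flip: power_add)
  hence "(\<integral>y. ((1 / \<tau>) ^ (n + 1) * lap_bump ((1 / \<tau>) *\<^sub>R wrap (y - x))) *\<^sub>R v y \<partial>torus_measure)
     = (1 / \<tau>) ^ (n - 1) *\<^sub>R (\<integral>y. ((1 / \<tau>)\<^sup>2 * lap_bump ((1 / \<tau>) *\<^sub>R wrap (y - x))) *\<^sub>R v y \<partial>torus_measure)"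
    by (simp only: mult.assoc scaleR_scaleR[symmetric] integral_scaleR_right)
  also note eq
  finally have G: "norm (\<integral>y. ((1 / \<tau>) ^ (n + 1) * lap_bump ((1 / \<tau>) *\<^sub>R wrap (y - x))) *\<^sub>R v y \<partial>torus_measure)
     = (1 / \<tau>) ^ (n - 1) * norm (\<integral>y. \<psi> y *\<^sub>R h y \<partial>torus_measure)"
    using \<tau> by simp
  have \<psi>: "\<bar>\<psi> y\<bar> \<le> 1" "y \<in> unit_cell \<Longrightarrow> y \<notin> torus_ball x \<tau> \<Longrightarrow> \<psi> y = 0" for y
  proof -
    show "\<bar>\<psi> y\<bar> \<le> 1" by (simp add: \<psi>_def periodized_def bump_def)
    assume "y \<in> unit_cell" "y \<notin> torus_ball x \<tau>"
    hence "norm ((1 / \<tau>) *\<^sub>R wrap (y - x)) \<ge> 1" using \<tau> by (simp add: torus_ball_def)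
    from bump_poly_support[OF bump_poly.base this, of 0] show "\<psi> y = 0" by (simp add: \<psi>_def periodized_def)
  qed
  have i1: "integrable torus_measure (\<lambda>y. indicator (torus_ball x \<rho>) y * (norm (h y))\<^sup>2)" for \<rho>
    using integrable_mult_indicator[OF torus_ball_sets h2, of x \<rho>] by (simp only: real_scaleR_def)
  have i2: "integrable torus_measure (\<lambda>y. indicator (torus_ball x \<tau>) y :: real)"
    by (intro integrable_real_indicator) (auto simp: torus.emeasure_finite less_top[symmetric])
  have i0: "integrable torus_measure (\<lambda>y. \<psi> y *\<^sub>R h y)"
  proof (rule integrable_torus_bounded_scaleR[OF h, of _ 1])
    show "\<psi> \<in> borel_measurable torus_measure"
    proof (rule borel_measurable_torus)
      have 1: "(\<lambda>y. (1 / \<tau>) *\<^sub>R wrap (y - x)) \<in> borel_measurable borel" by measurable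
      have 2: "(\<lambda>z::real^'n. bump 0 (1 - z \<bullet> z)) \<in> borel_measurable borel"
        by (intro borel_measurable_continuous_onI continuous_intros)
      show "\<psi> \<in> borel_measurable borel"
        using measurable_compose[OF 1 2] unfolding \<psi>_def periodized_def .
    qed
  qed (rule \<psi>(1))
  have "norm (\<integral>y. \<psi> y *\<^sub>R h y \<partial>torus_measure)
     \<le> (\<integral>y. l / 2 * (indicator (torus_ball x r) y * (norm (h y))\<^sup>2) + 1 / (2 * l) * indicator (torus_ball x \<tau>) y \<partial>torus_measure)"
  proof (rule Bochner_Integration.integral_norm_bound_integral[OF i0])
    show "integrable torus_measure (\<lambda>y. l / 2 * (indicator (torus_ball x r) y * (norm (h y))\<^sup>2) + 1 / (2 * l) * indicator (torus_ball x \<tau>) y)"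
      using i1[of r] i2 by auto
    fix y :: "real^'n" assume "y \<in> space torus_measure"
    hence y: "y \<in> unit_cell" by simp
    show "norm (\<psi> y *\<^sub>R h y) \<le> l / 2 * (indicator (torus_ball x r) y * (norm (h y))\<^sup>2) + 1 / (2 * l) * indicator (torus_ball x \<tau>) y"
    proof (cases "y \<in> torus_ball x \<tau>")
      case True
      hence "y \<in> torus_ball x r" using \<tau> by (auto simp: torus_ball_def)
      have "0 \<le> (l * norm (h y) - 1)\<^sup>2 / (2 * l)" using l by simp
      also have "\<dots> = l / 2 * (norm (h y))\<^sup>2 + 1 / (2 * l) - norm (h y)"
        using l by (simp add: field_simps power2_eq_square)
      finally have "norm (h y) \<le> l / 2 * (norm (h y))\<^sup>2 + 1 / (2 * l)" by simp
      moreover have "norm (\<psi> y *\<^sub>R h y) \<le> 1 * norm (h y)"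
        using \<psi>(1) by (simp add: mult_left_le_one_le)
      ultimately show ?thesis using True \<open>y \<in> torus_ball x r\<close> by simp
    qed (use \<psi>(2)[OF y] l in simp)
  qed
  also have "\<dots> = l / 2 * m + 1 / (2 * l) * measure torus_measure (torus_ball x \<tau>)"
  proof -
    have "torus_ball x \<tau> \<inter> unit_cell = torus_ball x \<tau>" by (auto simp: torus_ball_def)
    thus ?thesis using i1[of r] i2 by (simp add: m_def)
  qed
  also have "\<dots> \<le> l / 2 * m + 1 / (2 * l) * (w * \<tau> ^ n)"
    using measure_torus_ball(1)[OF \<tau>(1), of x] l
    by (intro add_left_mono mult_left_mono) (auto simp: w_def n_def torus_ball_def)
  also have "\<dots> = 1/2 * \<tau> powr (n / 2) * (c * m + w / c)"
  proof -
    have "\<tau> ^ n = \<tau> powr (n / 2) * \<tau> powr (n / 2)"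
      using \<tau> by (simp add: powr_realpow flip: powr_add)
    thus ?thesis using c \<tau> by (simp add: l_def field_simps)
  qed
  finally have "norm (\<integral>y. \<psi> y *\<^sub>R h y \<partial>torus_measure) \<le> 1/2 * \<tau> powr (n / 2) * (c * m + w / c)" .
  hence "(1 / \<tau>) ^ (n - 1) * norm (\<integral>y. \<psi> y *\<^sub>R h y \<partial>torus_measure)
     \<le> (1 / \<tau>) ^ (n - 1) * (1/2 * \<tau> powr (n / 2) * (c * m + w / c))"
    using \<tau> by (intro mult_left_mono) auto
  also have "(1 / \<tau>) ^ (n - 1) * (1/2 * \<tau> powr (n / 2) * (c * m + w / c))
     = 1/2 * ((1 / \<tau>) ^ (n - 1) * \<tau> powr (n / 2)) * (c * m + w / c)" by simp
  also have "(1 / \<tau>) ^ (n - 1) * \<tau> powr (n / 2) = \<tau> powr (1 - n / 2)"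
  proof -
    have "(1 / \<tau>) ^ (n - 1) = \<tau> powr (- real (n - 1))"
      using \<tau> by (simp add: powr_minus powr_realpow power_one_over inverse_eq_divide)
    thus ?thesis using n by (simp add: of_nat_diff flip: powr_add)
  qed
  finally show ?thesis unfolding G[unfolded n_def] n_def m_def w_def .
qed

lemma integral_powr_le:
  fixes a :: real
  assumes "0 < s" "s \<le> r" "a \<ge> -1/2"
  shows "(\<integral>\<tau>. indicator {s..r} \<tau> * \<tau> powr a \<partial>lborel) \<le> 2 * r powr (a + 1)"
    and "integrable lborel (\<lambda>\<tau>. indicator {s..r} \<tau> * \<tau> powr a)"
proof -
  have d: "DERIV (\<lambda>\<tau>. \<tau> powr (a + 1) / (a + 1)) \<tau> :> \<tau> powr a" if "s \<le> \<tau>" "\<tau> \<le> r" for \<tau>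
  proof -
    have "DERIV (\<lambda>\<tau>. \<tau> powr (a + 1)) \<tau> :> (a + 1) * \<tau> powr (a + 1 - 1)"
      using that assms by (intro has_real_derivative_powr) auto
    from DERIV_cdivide[OF this, of "a + 1"] show ?thesis using assms by simp
  qed
  have c: "isCont (\<lambda>\<tau>. \<tau> powr a) \<tau>" if "s \<le> \<tau>" "\<tau> \<le> r" for \<tau>
    using that assms by (auto intro!: continuous_intros)
  have I: "has_bochner_integral lborel (\<lambda>\<tau>. \<tau> powr a * indicator {s..r} \<tau>) (r powr (a + 1) / (a + 1) - s powr (a + 1) / (a + 1))"
    by (rule has_bochner_integral_FTC_Icc_real[OF assms(2) d c]) auto
  thus "integrable lborel (\<lambda>\<tau>. indicator {s..r} \<tau> * \<tau> powr a)"
    by (simp add: mult.commute has_bochner_integral_iff)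
  have "(\<integral>\<tau>. indicator {s..r} \<tau> * \<tau> powr a \<partial>lborel) = r powr (a + 1) / (a + 1) - s powr (a + 1) / (a + 1)"
    using I by (simp add: mult.commute has_bochner_integral_iff)
  also have "\<dots> \<le> r powr (a + 1) / (a + 1)" using assms by simp
  also have "\<dots> \<le> 2 * r powr (a + 1)"
    using assms mult_left_mono[of "1" "2 * (a + 1)" "r powr (a + 1)"] by (simp add: field_simps)
  finally show "(\<integral>\<tau>. indicator {s..r} \<tau> * \<tau> powr a \<partial>lborel) \<le> 2 * r powr (a + 1)" .
qed

text \<open>Integration of the previous bound over the scales between \<open>s\<close> and \<open>r\<close>. In dimension at most three
  \<open>\<tau> powr (1 - n/2)\<close> is integrable at \<open>0\<close>, so that the bound does not depend on \<open>s\<close>.\<close>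

lemma mollify_scale_estimate:
  fixes v h :: "real^'n::finite \<Rightarrow> 'b::euclidean_space"
  assumes lap: "weak_laplacian v h" and v: "integrable torus_measure v" and h: "integrable torus_measure h"
    and h2: "integrable torus_measure (\<lambda>x. (norm (h x))\<^sup>2)"
    and sr: "0 < s" "s \<le> r" "r < 1/2" and c: "c > 0" and n3: "CARD('n) \<le> 3"
  shows "norm (mollify r v x - mollify s v x) \<le> r powr (2 - CARD('n) / 2) *
        (c * (\<integral>y. indicator (torus_ball x r) y * (norm (h y))\<^sup>2 \<partial>torus_measure) + unit_ball_vol CARD('n) / c)"
proof -
  define n where "n = CARD('n)"
  define J where "J = c * (\<integral>y. indicator (torus_ball x r) y * (norm (h y))\<^sup>2 \<partial>torus_measure) + unit_ball_vol CARD('n) / c"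
  define k where "k \<tau> y = indicator {s..r} \<tau> * ((1 / \<tau>) ^ (n + 1) * lap_bump ((1 / \<tau>) *\<^sub>R wrap (y - x)))" for \<tau> and y :: "real^'n"
  define N where "N = restrict_space lborel {s..r}"
  have J: "J \<ge> 0" unfolding J_def using c by (intro add_nonneg_nonneg mult_nonneg_nonneg Bochner_Integration.integral_nonneg divide_nonneg_pos) auto
  have spN: "space N = {s..r}" by (simp add: N_def space_restrict_space)
  have finN: "finite_measure N"
    using sr(2) by (intro finite_measureI) (simp add: N_def emeasure_restrict_space)
  interpret N: finite_measure N by (rule finN)
  interpret P: pair_sigma_finite N "torus_measure :: (real^'n) measure"
    by (intro pair_sigma_finite.intro N.sigma_finite_measure_axioms torus.sigma_finite_measure_axioms)
  from lap_bump_bounded[where 'n='n] obtain L where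
    L0: "L \<ge> 0" and L: "\<forall>z::real^'n. \<bar>lap_bump z\<bar> \<le> L" by blast
  have [measurable]: "lap_bump \<in> borel_measurable (borel :: (real^'n) measure)"
    by (intro borel_measurable_continuous_onI continuous_lap_bump)
  have mk: "(\<lambda>(\<tau>, y). k \<tau> y) \<in> borel_measurable (borel \<Otimes>\<^sub>M borel)"
    unfolding k_def by measurable
  have bk: "\<bar>k \<tau> y\<bar> \<le> (1 / s) ^ (n + 1) * L" if "\<tau> \<in> space N" for \<tau> y
  proof -
    have \<tau>: "s \<le> \<tau>" "\<tau> \<le> r" "\<tau> > 0" using that sr by (auto simp: spN)
    have le: "(1 / \<tau>) ^ (n + 1) \<le> (1 / s) ^ (n + 1)"
      by (rule power_mono) (use \<tau> sr in \<open>auto simp: frac_le\<close>)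
    have eq: "\<bar>k \<tau> y\<bar> = (1 / \<tau>) ^ (n + 1) * \<bar>lap_bump ((1 / \<tau>) *\<^sub>R wrap (y - x))\<bar>"
      using \<tau> by (simp add: k_def abs_mult)
    show ?thesis unfolding eq by (rule mult_mono[OF le L[rule_format]]) (use sr in auto)
  qed
  have int: "integrable (N \<Otimes>\<^sub>M torus_measure) (\<lambda>(\<tau>, y). k \<tau> y *\<^sub>R v y)"
  proof (rule integrable_torus_pair_bounded[OF v finN _ mk bk])
    show "(\<lambda>\<tau>. \<tau>) \<in> N \<rightarrow>\<^sub>M borel"
      unfolding N_def by (rule measurable_restrict_space1) simp
  qed
  \<comment> \<open>The kernel \<open>k\<close> is the scale derivative of the profile; Fubini's theorem exchanges the scale and the space variable.\<close>
  have inner: "(\<integral>\<tau>. k \<tau> y \<partial>N) = profile r (wrap (y - x)) - profile s (wrap (y - x))" for y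
  proof -
    have "(\<integral>\<tau>. k \<tau> y \<partial>N) = (\<integral>\<tau>. (1 / \<tau>) ^ (n + 1) * lap_bump ((1 / \<tau>) *\<^sub>R wrap (y - x)) * indicator {s..r} \<tau> \<partial>lborel)"
      unfolding N_def by (subst integral_restrict_space)
        (auto simp: k_def indicator_def intro!: Bochner_Integration.integral_cong)
    also have "\<dots> = profile r (wrap (y - x)) - profile s (wrap (y - x))"
    proof (rule integral_FTC_Icc_real[OF sr(2)])
      fix \<tau> assume "s \<le> \<tau>" "\<tau> \<le> r"
      hence "\<tau> > 0" using sr by simp
      thus "DERIV (\<lambda>\<tau>. profile \<tau> (wrap (y - x))) \<tau> :> (1 / \<tau>) ^ (n + 1) * lap_bump ((1 / \<tau>) *\<^sub>R wrap (y - x))"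
        unfolding n_def by (rule profile_scale_derivative)
      have "continuous_on {0<..} (\<lambda>\<tau>. (1 / \<tau>) ^ (n + 1) * lap_bump ((1 / \<tau>) *\<^sub>R wrap (y - x)))"
        by (intro continuous_intros continuous_on_compose2[OF continuous_lap_bump[of UNIV]]) auto
      from this[unfolded continuous_on_eq_continuous_at[OF open_greaterThan]]
      show "isCont (\<lambda>\<tau>. (1 / \<tau>) ^ (n + 1) * lap_bump ((1 / \<tau>) *\<^sub>R wrap (y - x))) \<tau>"
        using \<open>\<tau> > 0\<close> by blast
    qed
    finally show ?thesis .
  qed
  have "mollify r v x - mollify s v x
     = (\<integral>y. (profile r (wrap (y - x)) - profile s (wrap (y - x))) *\<^sub>R v y \<partial>torus_measure)"
    unfolding mollify_def scaleR_diff_left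
    by (rule Bochner_Integration.integral_diff[symmetric]; rule integrable_mollify[OF v]) (use sr in auto)
  also have "\<dots> = (\<integral>y. \<integral>\<tau>. k \<tau> y *\<^sub>R v y \<partial>N \<partial>torus_measure)"
  proof (intro Bochner_Integration.integral_cong refl)
    fix y
    have "integrable N (\<lambda>\<tau>. k \<tau> y)"
    proof (rule N.integrable_const_bound[where B="(1 / s) ^ (n + 1) * L"])
      show "(\<lambda>\<tau>. k \<tau> y) \<in> borel_measurable N"
        unfolding k_def N_def by (intro measurable_restrict_space1) measurable
    qed (use bk in \<open>auto intro!: AE_I2\<close>)
    hence "(\<integral>\<tau>. k \<tau> y *\<^sub>R v y \<partial>N) = (\<integral>\<tau>. k \<tau> y \<partial>N) *\<^sub>R v y" by (rule integral_scaleR_left)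
    thus "(profile r (wrap (y - x)) - profile s (wrap (y - x))) *\<^sub>R v y = (\<integral>\<tau>. k \<tau> y *\<^sub>R v y \<partial>N)"
      by (simp add: inner)
  qed
  also have "\<dots> = (\<integral>\<tau>. \<integral>y. k \<tau> y *\<^sub>R v y \<partial>torus_measure \<partial>N)"
    using P.Fubini_integral[OF int] .
  also have "norm \<dots> \<le> (\<integral>\<tau>. 1/2 * (indicator {s..r} \<tau> * \<tau> powr (1 - n / 2)) * J \<partial>N)"
  proof (rule Bochner_Integration.integral_norm_bound_integral)
    show "integrable N (\<lambda>\<tau>. \<integral>y. k \<tau> y *\<^sub>R v y \<partial>torus_measure)"
      using P.integrable_fst'[OF int] by simp
    have "integrable lborel (\<lambda>\<tau>. indicator {s..r} \<tau> * \<tau> powr (1 - n / 2))"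
      using sr n3 by (intro integral_powr_le) (auto simp: n_def)
    thus "integrable N (\<lambda>\<tau>. 1/2 * (indicator {s..r} \<tau> * \<tau> powr (1 - n / 2)) * J)"
    proof -
      assume i: "integrable lborel (\<lambda>\<tau>. indicator {s..r} \<tau> * \<tau> powr (1 - n / 2))"
      have "integrable lborel (\<lambda>\<tau>. 1/2 * (indicator {s..r} \<tau> * \<tau> powr (1 - n / 2)) * J)"
        by (intro integrable_mult_left integrable_mult_right i)
      moreover have "(\<lambda>\<tau>. indicator {s..r} \<tau> *\<^sub>R (1/2 * (indicator {s..r} \<tau> * \<tau> powr (1 - n / 2)) * J))
          = (\<lambda>\<tau>. 1/2 * (indicator {s..r} \<tau> * \<tau> powr (1 - n / 2)) * J)"
        by (simp add: fun_eq_iff indicator_def)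
      ultimately show ?thesis
        unfolding N_def by (subst integrable_restrict_space) simp_all
    qed
    fix \<tau> assume "\<tau> \<in> space N"
    hence \<tau>: "0 < \<tau>" "\<tau> \<le> r" "\<tau> \<in> {s..r}" using sr by (auto simp: spN)
    show "norm (\<integral>y. k \<tau> y *\<^sub>R v y \<partial>torus_measure) \<le> 1/2 * (indicator {s..r} \<tau> * \<tau> powr (1 - n / 2)) * J"
      using scale_derivative_bound[OF lap h h2 \<tau>(1,2) sr(3) c, of x] \<tau>(3)
      by (simp add: k_def J_def n_def)
  qed
  also have "\<dots> = 1/2 * J * (\<integral>\<tau>. indicator {s..r} \<tau> * \<tau> powr (1 - n / 2) \<partial>lborel)"
  proof -
    have "(\<integral>\<tau>. indicator {s..r} \<tau> * \<tau> powr (1 - n / 2) \<partial>N) = (\<integral>\<tau>. indicator {s..r} \<tau> * \<tau> powr (1 - n / 2) \<partial>lborel)"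
      unfolding N_def by (subst integral_restrict_space)
        (auto simp: indicator_def intro!: Bochner_Integration.integral_cong)
    thus ?thesis by simp
  qed
  also have "\<dots> \<le> 1/2 * J * (2 * r powr (1 - n / 2 + 1))"
    using sr n3 J by (intro mult_left_mono integral_powr_le) (auto simp: n_def)
  also have "\<dots> = r powr (2 - n / 2) * J" by (simp add: algebra_simps)
  finally show ?thesis by (simp add: J_def n_def)
qed

lemma integral_torus_ball_le:
  fixes f :: "real^'n::finite \<Rightarrow> real"
  assumes f: "integrable torus_measure f" "\<And>x. f x \<ge> 0"
  shows "(\<integral>y. indicator (torus_ball x r) y * f y \<partial>torus_measure) \<le> (\<integral>y. f y \<partial>torus_measure)"
    and "integrable torus_measure (\<lambda>y. indicator (torus_ball x r) y * f y)"
proof -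
  show i: "integrable torus_measure (\<lambda>y. indicator (torus_ball x r) y * f y)"
    using integrable_mult_indicator[OF torus_ball_sets f(1), of x r] by (simp only: real_scaleR_def)
  show "(\<integral>y. indicator (torus_ball x r) y * f y \<partial>torus_measure) \<le> (\<integral>y. f y \<partial>torus_measure)"
    using f by (intro integral_mono i) (auto simp: indicator_def)
qed

definition mesh :: "nat \<Rightarrow> real" where "mesh m = 1 / (real m + 3)"

lemma mesh: "0 < mesh m" "mesh m < 1/2" "mesh \<longlonglongrightarrow> 0" "m \<le> k \<Longrightarrow> mesh k \<le> mesh m"
proof -
  show "mesh \<longlonglongrightarrow> 0"
    using LIMSEQ_ignore_initial_segment[OF lim_1_over_n, of 3] by (simp add: mesh_def[abs_def])
qed (auto simp: mesh_def field_simps)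

lemma mollify_bounded:
  fixes v :: "real^'n::finite \<Rightarrow> 'b::euclidean_space"
  assumes v: "integrable torus_measure v" and r: "r > 0"
  obtains K where "\<And>x. norm (mollify r v x) \<le> K"
proof -
  obtain C where C: "C \<ge> 0" "\<And>z::real^'n. \<bar>profile r z\<bar> \<le> C" using profile_bounded[OF r] by blast
  have "norm (mollify r v x) \<le> (\<integral>y. C * norm (v y) \<partial>torus_measure)" for x
    unfolding mollify_def
    using v C integrable_mollify[OF v r]
    by (intro Bochner_Integration.integral_norm_bound_integral) (auto intro!: mult_right_mono)
  thus ?thesis by (rule that)
qed

text \<open>The fundamental lemma of the calculus of variations: the averaging kernels are test functions.\<close>

lemma torus_test_eq_0:
  fixes v :: "real^'n::finite \<Rightarrow> 'b::euclidean_space"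
  assumes v: "integrable torus_measure v"
    and zero: "\<And>\<phi>. \<phi> \<in> torus_test \<Longrightarrow> (\<integral>x. \<phi> x *\<^sub>R v x \<partial>torus_measure) = 0"
  shows "AE x in torus_measure. v x = 0"
proof -
  have "mollify (mesh m) v x = 0" for m x
  proof -
    have "(\<lambda>y. profile (mesh m) (wrap (y - x))) \<in> torus_test"
      unfolding profile_periodized
      by (intro periodized_torus_test bump_poly.intros mesh)
    thus ?thesis unfolding mollify_def by (rule zero)
  qed
  hence "AE x in torus_measure. 0 = v x"
    by (intro AE_eq_mollify_limit[OF v _ mesh(1,2,3), of "\<lambda>_. 0" 0]) auto
  thus ?thesis by eventually_elim simp
qed

text \<open>The mollifications form a uniform Cauchy sequence by the scale estimate. This replaces the
  Sobolev embedding of \<open>H\<^sup>2\<close> into the continuous functions and yields a rate of convergence in terms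
  of the Laplacian near the point, which the contact set estimate needs.\<close>

lemma continuous_representative:
  fixes v h :: "real^'n::finite \<Rightarrow> 'b::euclidean_space"
  assumes lap: "weak_laplacian v h" and v: "integrable torus_measure v" and h: "integrable torus_measure h"
    and h2: "integrable torus_measure (\<lambda>x. (norm (h x))\<^sup>2)" and n3: "CARD('n) \<le> 3"
  obtains u where "continuous_on UNIV u" "periodic u" "AE x in torus_measure. u x = v x"
    "\<And>x. (\<lambda>m. mollify (mesh m) v x) \<longlonglongrightarrow> profile_mass TYPE('n) *\<^sub>R u x"
    "\<And>x r c. 0 < r \<Longrightarrow> r < 1/2 \<Longrightarrow> c > 0 \<Longrightarrow>
       norm (mollify r v x - profile_mass TYPE('n) *\<^sub>R u x) \<le> r powr (2 - CARD('n) / 2) *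
         (c * (\<integral>y. indicator (torus_ball x r) y * (norm (h y))\<^sup>2 \<partial>torus_measure) + unit_ball_vol CARD('n) / c)"
proof -
  let ?c0 = "profile_mass TYPE('n)"
  define a where "a = 2 - CARD('n) / (2::real)"
  have a: "a > 0" using n3 by (simp add: a_def)
  define f where "f m x = mollify (mesh m) v x" for m x
  define E where "E c x r = c * (\<integral>y. indicator (torus_ball x r) y * (norm (h y))\<^sup>2 \<partial>torus_measure) + unit_ball_vol CARD('n) / c" for c r and x :: "real^'n"
  define M where "M = (\<integral>y. (norm (h y))\<^sup>2 \<partial>torus_measure) + unit_ball_vol CARD('n)"
  have EM: "E 1 x r \<le> M" for x r
    using integral_torus_ball_le(1)[OF h2] by (simp add: E_def M_def)
  have M: "M \<ge> 0" unfolding M_def by (intro add_nonneg_nonneg Bochner_Integration.integral_nonneg) auto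
  have est: "norm (mollify r v x - mollify s v x) \<le> r powr a * E c x r"
    if "0 < s" "s \<le> r" "r < 1/2" "c > 0" for r s c x
    using mollify_scale_estimate[OF lap v h h2 that n3] by (simp add: E_def a_def)
  have estM: "norm (f m x - f k x) \<le> mesh m powr a * M" if "m \<le> k" for m k x
    unfolding f_def
    using est[OF mesh(1) mesh(4)[OF that] mesh(2), of 1 x] mult_left_mono[OF EM, of "mesh m powr a" x "mesh m"]
    by simp
  have small: "(\<lambda>m. mesh m powr a * M) \<longlonglongrightarrow> 0"
  proof -
    have "(\<lambda>m. mesh m powr a) \<longlonglongrightarrow> 0"
      by (rule tendsto_zero_powrI[OF mesh(3) tendsto_const _ a]) (simp add: less_imp_le[OF mesh(1)])
    thus ?thesis by (rule tendsto_mult_left_zero)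
  qed
  have "uniformly_Cauchy_on UNIV f"
  proof (rule uniformly_Cauchy_onI)
    fix e :: real assume "e > 0"
    then obtain N where N: "\<And>m. m \<ge> N \<Longrightarrow> mesh m powr a * M < e / 2"
      using order_tendstoD(2)[OF small, of "e / 2"] by (auto simp: eventually_sequentially)
    have "dist (f m x) (f k x) < e" if "m \<ge> N" "k \<ge> N" for m k x
    proof -
      have "dist (f m x) (f k x) \<le> dist (f N x) (f m x) + dist (f N x) (f k x)"
        by (rule dist_triangle3)
      also have "\<dots> \<le> mesh N powr a * M + mesh N powr a * M"
        using estM[OF that(1)] estM[OF that(2)] by (intro add_mono) (auto simp: dist_norm)
      also have "\<dots> < e" using N[OF order_refl] by linarith
      finally show ?thesis .
    qed
    thus "\<exists>M. \<forall>x\<in>UNIV. \<forall>m\<ge>M. \<forall>n\<ge>M. dist (f m x) (f n x) < e" by blast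
  qed
  hence "uniformly_convergent_on UNIV f" by (rule Cauchy_uniformly_convergent)
  then obtain l where l: "uniform_limit UNIV f l sequentially" by (auto simp: uniformly_convergent_on_def)
  have lim: "(\<lambda>m. f m x) \<longlonglongrightarrow> l x" for x using tendsto_uniform_limitI[OF l] by simp
  have cl: "continuous_on UNIV l"
    by (rule uniform_limit_theorem[OF _ l])
       (auto simp: f_def[abs_def] intro!: always_eventually continuous_mollify[OF v mesh(1,2)])
  have pl: "periodic l"
    unfolding periodic_def
  proof (intro allI)
    fix x i
    have "f m (x + axis i 1) = f m x" for m
      using periodic_mollify[of "mesh m" v] by (simp add: f_def periodic_def)
    thus "l (x + axis i 1) = l x" using LIMSEQ_unique[OF lim[of "x + axis i 1"]] lim[of x] by simp
  qed
  define u where "u x = (1 / ?c0) *\<^sub>R l x" for x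
  have c0: "?c0 > 0" by (rule profile_mass_pos)
  have lu: "l x = ?c0 *\<^sub>R u x" for x using c0 by (simp add: u_def)
  have cu: "continuous_on UNIV u" unfolding u_def by (intro continuous_intros cl)
  have limu: "(\<lambda>m. mollify (mesh m) v x) \<longlonglongrightarrow> ?c0 *\<^sub>R u x" for x
    using lim[of x] by (simp add: f_def lu)
  obtain K where K: "\<And>x. norm (f 0 x) \<le> K" using mollify_bounded[OF v mesh(1)[of 0]] by (auto simp: f_def)
  have bd: "norm (mollify (mesh m) v x) \<le> K + mesh 0 powr a * M" for m x
  proof -
    have "norm (f m x) \<le> norm (f 0 x) + norm (f 0 x - f m x)" by norm
    thus ?thesis using K[of x] estM[of 0 m x] by (simp add: f_def)
  qed
  have "AE x in torus_measure. u x = v x"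
    by (rule AE_eq_mollify_limit[OF v cu mesh(1,2,3) limu bd])
  moreover have "periodic u" using pl by (simp add: periodic_def u_def)
  moreover have "norm (mollify r v x - ?c0 *\<^sub>R u x) \<le> r powr a * E c x r" if rc: "0 < r" "r < 1/2" "c > 0" for x r c
  proof -
    obtain N where N: "\<And>m. m \<ge> N \<Longrightarrow> mesh m < r"
      using order_tendstoD(2)[OF mesh(3) rc(1)] by (auto simp: eventually_sequentially)
    have "(\<lambda>m. norm (mollify r v x - mollify (mesh m) v x)) \<longlonglongrightarrow> norm (mollify r v x - ?c0 *\<^sub>R u x)"
      by (intro tendsto_intros limu)
    moreover have "\<forall>m\<ge>N. norm (mollify r v x - mollify (mesh m) v x) \<le> r powr a * E c x r"
      using est[OF mesh(1) _ rc(2,3)] N by (simp add: less_imp_le)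
    ultimately show ?thesis by (rule Lim_bounded)
  qed
  ultimately show ?thesis using that[OF cu _ _ limu] by (simp add: a_def E_def)
qed

lemma profile_le_scaled:
  obtains P where "P > 0" "\<And>r (z :: real^'n::finite). r > 0 \<Longrightarrow> profile r z \<le> P * (1 / r) ^ CARD('n)"
proof -
  obtain C where C: "C \<ge> 0" "\<And>z::real^'n. \<bar>profile 1 z\<bar> \<le> C" using profile_bounded[of 1] by auto
  have "profile r z \<le> (C + 1) * (1 / r) ^ CARD('n)" if "r > 0" for r and z :: "real^'n"
  proof -
    have "profile r z = (1 / r) ^ CARD('n) * profile 1 ((1 / r) *\<^sub>R z)" by (simp add: profile_def)
    also have "\<dots> \<le> (1 / r) ^ CARD('n) * (C + 1)"
      using that C(2)[of "(1 / r) *\<^sub>R z"] by (intro mult_left_mono) auto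
    finally show ?thesis by (simp add: mult.commute)
  qed
  thus ?thesis using that[of "C + 1"] C(1) by auto
qed

text \<open>In the application \<open>g \<ge> 0\<close> vanishes at \<open>x\<close>, \<open>H\<close> is the square of its Laplacian, which controls the
  averages of \<open>g\<close> around \<open>x\<close>, and \<open>F\<close> dominates \<open>1 / g\<close>. Pointwise \<open>1 \<le> g / r + (r F)\<^sup>2\<close>, since one of
  \<open>g \<ge> r\<close> and \<open>r F \<ge> 1\<close> holds. Averaging this inequality at scale \<open>r\<close> and inserting the bound for the
  average of \<open>g\<close> leaves a positive lower bound for \<open>r powr (2 - n)\<close> times the integral of \<open>H + F\<^sup>2\<close>.\<close>

lemma zero_costs_energy:
  obtains \<kappa> where "\<kappa> > 0"
    "\<And>g F H x r. \<lbrakk>integrable torus_measure g; integrable torus_measure (\<lambda>y. (F y)\<^sup>2); integrable torus_measure H;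
       \<And>y. 0 \<le> H y; AE y in torus_measure. 0 \<le> g y \<and> 1 \<le> F y * g y; 0 < r; r < 1/2;
       \<And>c. c > 0 \<Longrightarrow> mollify r g x \<le> r powr (2 - CARD('n) / 2) *
         (c * (\<integral>y. indicator (torus_ball x r) y * H y \<partial>torus_measure) + unit_ball_vol CARD('n) / c)\<rbrakk>
     \<Longrightarrow> \<kappa> * r powr (real CARD('n) - 2) \<le> (\<integral>y. indicator (torus_ball x r) y * (H y + (F y)\<^sup>2) \<partial>(torus_measure :: (real^'n::finite) measure))"
proof -
  let ?c0 = "profile_mass TYPE('n)"
  define n where "n = real CARD('n)"
  define w where "w = unit_ball_vol n"
  have c0: "?c0 > 0" by (rule profile_mass_pos)
  have w: "w > 0" by (simp add: w_def n_def)
  obtain P where P: "P > 0" "\<And>r (z :: real^'n). r > 0 \<Longrightarrow> profile r z \<le> P * (1 / r) ^ CARD('n)"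
    using profile_le_scaled by metis
  \<comment> \<open>Chosen such that the term \<open>w / k\<close> below absorbs half of the mass of the kernel.\<close>
  define k where "k = 2 * w / ?c0"
  have k: "k > 0" using w c0 by (simp add: k_def)
  define \<kappa> where "\<kappa> = ?c0 / (2 * (k + P))"
  show ?thesis
  proof (rule that[of \<kappa>])
    show "\<kappa> > 0" using c0 k P by (simp add: \<kappa>_def)
    fix g F H :: "real^'n \<Rightarrow> real" and x :: "real^'n" and r :: real
    assume g: "integrable torus_measure g" and F: "integrable torus_measure (\<lambda>y. (F y)\<^sup>2)"
      and H: "integrable torus_measure H" "\<And>y. 0 \<le> H y"
      and gF: "AE y in torus_measure. 0 \<le> g y \<and> 1 \<le> F y * g y" and r: "0 < r" "r < 1/2"
      and avg: "\<And>c. c > 0 \<Longrightarrow> mollify r g x \<le> r powr (2 - CARD('n) / 2) *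
         (c * (\<integral>y. indicator (torus_ball x r) y * H y \<partial>torus_measure) + unit_ball_vol CARD('n) / c)"
    define p where "p y = profile r (wrap (y - x))" for y
    define m where "m = (\<integral>y. indicator (torus_ball x r) y * H y \<partial>torus_measure)"
    define N where "N = (\<integral>y. indicator (torus_ball x r) y * (F y)\<^sup>2 \<partial>torus_measure)"
    have p0: "p y \<ge> 0" for y using r by (simp add: p_def profile_nonneg)
    have pN: "p y \<le> indicator (torus_ball x r) y * (P * (1 / r) ^ CARD('n))" if "y \<in> unit_cell" for y
    proof (cases "y \<in> torus_ball x r")
      case True
      thus ?thesis using P(2)[OF r(1), of "wrap (y - x)"] by (simp add: p_def)
    next
      case False
      hence "p y = 0" unfolding p_def using that r by (intro profile_support) (auto simp: torus_ball_def)
      thus ?thesis using False by simp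
    qed
    have one: "integrable torus_measure (\<lambda>x::real^'n. 1::real)" by simp
    have ip: "integrable torus_measure p" unfolding p_def using integrable_mollify[OF one r(1), of x] by simp
    have ipg: "integrable torus_measure (\<lambda>y. p y * g y)" unfolding p_def using integrable_mollify[OF g r(1), of x] by simp
    have iF: "integrable torus_measure (\<lambda>y. indicator (torus_ball x r) y * (F y)\<^sup>2)"
      by (rule integral_torus_ball_le(2)[OF F]) simp
    have iH: "integrable torus_measure (\<lambda>y. indicator (torus_ball x r) y * H y)"
      by (rule integral_torus_ball_le(2)[OF H])
    have "?c0 = (\<integral>y. p y \<partial>torus_measure)" unfolding p_def using integral_profile[OF r, of x] by simp
    also have "\<dots> \<le> (\<integral>y. (1 / r) * (p y * g y) + (P * (1 / r) ^ CARD('n) * r\<^sup>2) * (indicator (torus_ball x r) y * (F y)\<^sup>2) \<partial>torus_measure)"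
    proof (rule integral_mono_AE[OF ip])
      show "integrable torus_measure (\<lambda>y. (1 / r) * (p y * g y) + (P * (1 / r) ^ CARD('n) * r\<^sup>2) * (indicator (torus_ball x r) y * (F y)\<^sup>2))"
        using ipg iF by (intro Bochner_Integration.integrable_add integrable_mult_right)
      have "AE y in torus_measure. y \<in> (unit_cell :: (real^'n) set)" by (rule AE_I2) simp
      with gF show "AE y in torus_measure. p y \<le> (1 / r) * (p y * g y) + (P * (1 / r) ^ CARD('n) * r\<^sup>2) * (indicator (torus_ball x r) y * (F y)\<^sup>2)"
      proof eventually_elim
        case (elim y)
        have nn: "0 \<le> (1 / r) * (p y * g y)" "0 \<le> (P * (1 / r) ^ CARD('n) * r\<^sup>2) * (indicator (torus_ball x r) y * (F y)\<^sup>2)"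
          using p0[of y] elim r P(1) by auto
        show ?case
        proof (cases "g y \<ge> r")
          case True
          hence "p y * r \<le> p y * g y" using p0[of y] by (intro mult_left_mono) auto
          hence "p y \<le> (1 / r) * (p y * g y)" using r by (simp add: field_simps)
          thus ?thesis using nn by linarith
        next
          case False
          have "F y > 0" using elim by (metis less_le_not_le mult_nonpos_nonneg not_le order_trans zero_less_one)
          hence "1 \<le> F y * r" using False elim mult_left_mono[of "g y" r "F y"] by linarith
          hence "1 \<le> (F y * r)\<^sup>2" by (rule one_le_power)
          hence "p y * 1 \<le> p y * (F y * r)\<^sup>2" using p0[of y] by (intro mult_left_mono)
          also have "\<dots> \<le> (indicator (torus_ball x r) y * (P * (1 / r) ^ CARD('n))) * (F y * r)\<^sup>2"
            using pN elim by (intro mult_right_mono) auto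
          also have "\<dots> = (P * (1 / r) ^ CARD('n) * r\<^sup>2) * (indicator (torus_ball x r) y * (F y)\<^sup>2)"
            by (simp add: power_mult_distrib)
          finally show ?thesis using nn by linarith
        qed
      qed
    qed
    also have "\<dots> = (1 / r) * mollify r g x + (P * (1 / r) ^ CARD('n) * r\<^sup>2) * N"
      using ipg iF by (simp add: mollify_def p_def N_def)
    also have "(1 / r) ^ CARD('n) * r\<^sup>2 = r powr (2 - n)"
    proof -
      have "(1 / r) ^ CARD('n) = r powr (- n)"
        using r by (simp add: n_def powr_minus powr_realpow power_one_over inverse_eq_divide)
      moreover have "r\<^sup>2 = r powr 2" using r by simp
      ultimately show ?thesis by (simp flip: powr_add)
    qed
    hence "P * (1 / r) ^ CARD('n) * r\<^sup>2 = P * r powr (2 - n)" by simp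
    also have "(1 / r) * mollify r g x \<le> k * r powr (2 - n) * m + w / k"
    proof -
      \<comment> \<open>With this parameter both terms of the bound for the average scale like the other contributions.\<close>
      define c where "c = k * r powr (1 - n / 2)"
      have c: "c > 0" using k r by (simp add: c_def)
      have "(1 / r) * mollify r g x \<le> (1 / r) * (r powr (2 - n / 2) * (c * m + w / c))"
        using avg[OF c] r by (intro mult_left_mono) (auto simp: m_def w_def n_def)
      also have "\<dots> = r powr (1 - n / 2) * (c * m + w / c)"
      proof -
        have "r powr (2 - n / 2) = r powr 1 * r powr (1 - n / 2)"
          by (subst powr_add[symmetric]) simp
        thus ?thesis using r by simp
      qed
      also have "\<dots> = k * (r powr (1 - n / 2) * r powr (1 - n / 2)) * m + w / k"
        using r k by (simp add: c_def field_simps)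
      also have "r powr (1 - n / 2) * r powr (1 - n / 2) = r powr (2 - n)" by (simp flip: powr_add)
      finally show ?thesis .
    qed
    finally have "?c0 \<le> k * r powr (2 - n) * m + w / k + P * r powr (2 - n) * N" by simp
    moreover have "w / k = ?c0 / 2" using w c0 by (simp add: k_def)
    ultimately have "?c0 / 2 \<le> r powr (2 - n) * (k * m + P * N)" by (simp add: algebra_simps)
    also have "\<dots> \<le> r powr (2 - n) * ((k + P) * (m + N))"
    proof -
      have "0 \<le> m" "0 \<le> N" unfolding m_def N_def using H by (auto intro!: Bochner_Integration.integral_nonneg)
      thus ?thesis using k P(1) by (intro mult_left_mono) (auto simp: algebra_simps)
    qed
    finally have "\<kappa> \<le> r powr (2 - n) * (m + N)"
      using k P(1) by (simp add: \<kappa>_def field_simps)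
    hence "\<kappa> * r powr (n - 2) \<le> r powr (2 - n) * (m + N) * r powr (n - 2)"
      by (intro mult_right_mono) auto
    also have "\<dots> = (r powr (2 - n) * r powr (n - 2)) * (m + N)" by simp
    also have "r powr (2 - n) * r powr (n - 2) = 1" using r by (simp flip: powr_add)
    also have "1 * (m + N) = (\<integral>y. indicator (torus_ball x r) y * (H y + (F y)\<^sup>2) \<partial>torus_measure)"
      using iH iF by (simp add: m_def N_def distrib_left)
    finally show "\<kappa> * r powr (real CARD('n) - 2) \<le> (\<integral>y. indicator (torus_ball x r) y * (H y + (F y)\<^sup>2) \<partial>torus_measure)"
      by (simp add: n_def)
  qed
qed

section \<open>Weak derivatives\<close>

lemma torus_test_differentiable: "\<phi> \<in> torus_test \<Longrightarrow> \<phi> differentiable (at x)"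
proof -
  assume "\<phi> \<in> torus_test"
  hence "foldr dir_deriv [] \<phi> differentiable (at x)" unfolding torus_test_def smooth_def by blast
  thus ?thesis by simp
qed

lemma torus_test_dir_deriv:
  assumes \<phi>: "\<phi> \<in> torus_test"
  shows "dir_deriv w \<phi> \<in> torus_test"
proof -
  have sm: "foldr dir_deriv ws \<phi> differentiable (at x)" for ws x
    using \<phi> by (simp add: torus_test_def smooth_def)
  have per: "\<phi> (x + axis i 1) = \<phi> x" for x i using \<phi> by (simp add: torus_test_def periodic_def)
  have "foldr dir_deriv ws (dir_deriv w \<phi>) = foldr dir_deriv (ws @ [w]) \<phi>" for ws by simp
  hence "smooth (dir_deriv w \<phi>)" using sm unfolding smooth_def by presburger
  moreover have "periodic (dir_deriv w \<phi>)"
    unfolding periodic_def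
  proof (intro allI)
    fix x i
    define \<phi>' where "\<phi>' = frechet_derivative \<phi> (at (x + axis i 1))"
    have D: "(\<phi> has_derivative \<phi>') (at (x + axis i 1))"
      unfolding \<phi>'_def using torus_test_differentiable[OF \<phi>] by (rule frechet_derivative_works[THEN iffD1])
    have "((\<lambda>x. x + axis i 1) has_derivative (\<lambda>h. h)) (at x)" by (auto intro!: derivative_eq_intros)
    from has_derivative_compose[OF this D] have "(\<phi> has_derivative \<phi>') (at x)" by (simp add: per)
    from frechet_derivative_at[OF this] show "dir_deriv w \<phi> (x + axis i 1) = dir_deriv w \<phi> x"
      by (simp add: dir_deriv_def \<phi>'_def)
  qed
  ultimately show ?thesis by (simp add: torus_test_def)
qed

lemma integrable_test_scaleR:
  fixes v :: "real^'n::finite \<Rightarrow> 'b::euclidean_space"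
  assumes \<phi>: "\<phi> \<in> torus_test" and v: "integrable torus_measure v"
  shows "integrable torus_measure (\<lambda>x. \<phi> x *\<^sub>R v x)"
proof -
  have c: "continuous_on UNIV \<phi>"
    using torus_test_differentiable[OF \<phi>]
    by (intro continuous_at_imp_continuous_on ballI differentiable_imp_continuous_within) simp
  obtain C where C: "\<And>x. x \<in> unit_cell \<Longrightarrow> norm (\<phi> x) \<le> C" using periodic_bounded[OF c] by blast
  show ?thesis
    by (rule integrable_torus_bounded_scaleR[OF v borel_measurable_torus[OF borel_measurable_continuous_onI[OF c]], of C])
       (use C in auto)
qed

lemma has_weak_derivD:
  assumes "has_weak_deriv w u v"
  shows "periodic u" "integrable torus_measure u" "periodic v" "integrable torus_measure v"
    and "\<phi> \<in> torus_test \<Longrightarrow> (\<integral>x. dir_deriv w \<phi> x *\<^sub>R u x \<partial>torus_measure) = - (\<integral>x. \<phi> x *\<^sub>R v x \<partial>torus_measure)"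
  using assms unfolding has_weak_deriv_def by blast+

text \<open>\<open>weak_deriv\<close> is an arbitrary choice among the weak derivatives; uniqueness up to null sets allows to
  replace it by a representative with known properties.\<close>

lemma weak_deriv_unique:
  fixes u v :: "real^'n::finite \<Rightarrow> 'b::euclidean_space"
  assumes "has_weak_deriv w u v" "has_weak_deriv w u' v'" "AE x in torus_measure. u x = u' x"
  shows "AE x in torus_measure. v x = v' x"
proof -
  note i = has_weak_derivD(2)[OF assms(1)] has_weak_derivD(2)[OF assms(2)]
    has_weak_derivD(4)[OF assms(1)] has_weak_derivD(4)[OF assms(2)]
  have "AE x in torus_measure. v x - v' x = 0"
  proof (rule torus_test_eq_0)
    show "integrable torus_measure (\<lambda>x. v x - v' x)" using i by auto
    fix \<phi> :: "real^'n \<Rightarrow> real" assume \<phi>: "\<phi> \<in> torus_test"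
    have "(\<integral>x. dir_deriv w \<phi> x *\<^sub>R u x \<partial>torus_measure) = (\<integral>x. dir_deriv w \<phi> x *\<^sub>R u' x \<partial>torus_measure)"
    proof (rule integral_cong_AE)
      show "AE x in torus_measure. dir_deriv w \<phi> x *\<^sub>R u x = dir_deriv w \<phi> x *\<^sub>R u' x"
        using assms(3) by eventually_elim simp
    qed (intro borel_measurable_integrable integrable_test_scaleR torus_test_dir_deriv \<phi> i)+
    hence "(\<integral>x. \<phi> x *\<^sub>R v x \<partial>torus_measure) = (\<integral>x. \<phi> x *\<^sub>R v' x \<partial>torus_measure)"
      using has_weak_derivD(5)[OF assms(1) \<phi>] has_weak_derivD(5)[OF assms(2) \<phi>] by simp
    thus "(\<integral>x. \<phi> x *\<^sub>R (v x - v' x) \<partial>torus_measure) = 0"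
      using Bochner_Integration.integral_diff[OF integrable_test_scaleR[OF \<phi> i(3)] integrable_test_scaleR[OF \<phi> i(4)]]
      by (simp add: scaleR_diff_right)
  qed
  thus ?thesis by eventually_elim simp
qed

lemma has_weak_deriv_weak_deriv: "has_weak_deriv w u v \<Longrightarrow> has_weak_deriv w u (weak_deriv w u)"
  unfolding weak_deriv_def by (rule someI[of "has_weak_deriv w u"])

lemma weak_deriv_AE_eq:
  fixes u v :: "real^'n::finite \<Rightarrow> 'b::euclidean_space"
  assumes "has_weak_deriv w u v"
  shows "AE x in torus_measure. weak_deriv w u x = v x"
  by (rule weak_deriv_unique[OF has_weak_deriv_weak_deriv[OF assms] assms]) simp

lemma has_weak_deriv_cong_AE:
  fixes u u' v :: "real^'n::finite \<Rightarrow> 'b::euclidean_space"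
  assumes v: "has_weak_deriv w u v" and u': "periodic u'" "integrable torus_measure u'"
    and ae: "AE x in torus_measure. u x = u' x"
  shows "has_weak_deriv w u' v"
proof -
  note i = has_weak_derivD(2)[OF v]
  have "(\<integral>x. dir_deriv w \<phi> x *\<^sub>R u x \<partial>torus_measure) = (\<integral>x. dir_deriv w \<phi> x *\<^sub>R u' x \<partial>torus_measure)"
    if \<phi>: "\<phi> \<in> torus_test" for \<phi>
  proof (rule integral_cong_AE)
    show "AE x in torus_measure. dir_deriv w \<phi> x *\<^sub>R u x = dir_deriv w \<phi> x *\<^sub>R u' x"
      using ae by eventually_elim simp
  qed (intro borel_measurable_integrable integrable_test_scaleR torus_test_dir_deriv \<phi> i u')+
  thus ?thesis using has_weak_derivD[OF v] u' unfolding has_weak_deriv_def by simp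
qed

lemma in_L2_integrable:
  fixes u :: "real^'n::finite \<Rightarrow> 'b::euclidean_space"
  assumes "in_L2 u"
  shows "integrable torus_measure u" "integrable torus_measure (\<lambda>x. (norm (u x))\<^sup>2)"
    "u \<in> borel_measurable torus_measure" "periodic u"
proof -
  show m: "u \<in> borel_measurable torus_measure" "periodic u"
    and i: "integrable torus_measure (\<lambda>x. (norm (u x))\<^sup>2)"
    using assms by (auto simp: in_L2_def)
  have "integrable torus_measure (\<lambda>x. 1 + (norm (u x))\<^sup>2)" using i by simp
  thus "integrable torus_measure u"
  proof (rule Bochner_Integration.integrable_bound[OF _ m(1)])
    have "t \<le> 1 + t\<^sup>2" if "t \<ge> 0" for t :: real
      using that zero_le_power2[of "t - 1/2"] by (simp add: power2_eq_square algebra_simps)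
    thus "AE x in torus_measure. norm (u x) \<le> norm (1 + (norm (u x))\<^sup>2)" by (intro AE_I2) auto
  qed
qed

lemma has_weak_deriv_component:
  fixes u v :: "real^'n::finite \<Rightarrow> 'b::euclidean_space"
  assumes "has_weak_deriv w u v"
  shows "has_weak_deriv w (\<lambda>x. u x \<bullet> b) (\<lambda>x. v x \<bullet> b)"
  unfolding has_weak_deriv_def
proof (intro conjI ballI)
  note uv = has_weak_derivD(1,3,2,4)[OF assms]
  show "periodic (\<lambda>x. u x \<bullet> b)" "periodic (\<lambda>x. v x \<bullet> b)"
    "integrable torus_measure (\<lambda>x. u x \<bullet> b)" "integrable torus_measure (\<lambda>x. v x \<bullet> b)"
    using uv by (simp_all add: periodic_def)
  fix \<phi> :: "real^'n \<Rightarrow> real" assume \<phi>: "\<phi> \<in> torus_test"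
  have eq: "(\<integral>x. dir_deriv w \<phi> x *\<^sub>R u x \<partial>torus_measure) = - (\<integral>x. \<phi> x *\<^sub>R v x \<partial>torus_measure)"
    by (rule has_weak_derivD(5)[OF assms \<phi>])
  have 1: "(\<integral>x. dir_deriv w \<phi> x *\<^sub>R (u x \<bullet> b) \<partial>torus_measure) = (\<integral>x. dir_deriv w \<phi> x *\<^sub>R u x \<partial>torus_measure) \<bullet> b"
    using integral_inner_left[OF integrable_test_scaleR[OF torus_test_dir_deriv[OF \<phi>] uv(3)], where c=b]
    by (simp only: inner_scaleR_left real_scaleR_def)
  have 2: "(\<integral>x. \<phi> x *\<^sub>R (v x \<bullet> b) \<partial>torus_measure) = (\<integral>x. \<phi> x *\<^sub>R v x \<partial>torus_measure) \<bullet> b"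
    using integral_inner_left[OF integrable_test_scaleR[OF \<phi> uv(4)], where c=b]
    by (simp only: inner_scaleR_left real_scaleR_def)
  show "(\<integral>x. dir_deriv w \<phi> x *\<^sub>R (u x \<bullet> b) \<partial>torus_measure) = - (\<integral>x. \<phi> x *\<^sub>R (v x \<bullet> b) \<partial>torus_measure)"
    unfolding 1 2 eq by simp
qed

text \<open>Square integrability without periodicity: the time derivative and \<open>DQf v\<close> are only known almost
  everywhere on the unit cell.\<close>

definition L2_class :: "(real^'n::finite \<Rightarrow> 'b::euclidean_space) \<Rightarrow> bool" where
  "L2_class u \<longleftrightarrow> u \<in> borel_measurable torus_measure \<and> integrable torus_measure (\<lambda>x. (norm (u x))\<^sup>2)"

lemma L2_class_cong_AE:
  fixes u v :: "real^'n::finite \<Rightarrow> 'b::euclidean_space"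
  assumes "L2_class u" "v \<in> borel_measurable torus_measure" "AE x in torus_measure. v x = u x"
  shows "L2_class v"
proof -
  have "integrable torus_measure (\<lambda>x. (norm (v x))\<^sup>2)"
  proof (rule integrable_cong_AE_imp)
    show "integrable torus_measure (\<lambda>x. (norm (u x))\<^sup>2)" using assms by (simp add: L2_class_def)
    show "AE x in torus_measure. (norm (u x))\<^sup>2 = (norm (v x))\<^sup>2" using assms(3) by eventually_elim simp
  qed (use assms in auto)
  thus ?thesis using assms by (simp add: L2_class_def)
qed

lemma L2_class_add:
  fixes u v :: "real^'n::finite \<Rightarrow> 'b::euclidean_space"
  assumes "L2_class u" "L2_class v"
  shows "L2_class (\<lambda>x. u x + v x)"
  unfolding L2_class_def
proof
  have m: "u \<in> borel_measurable torus_measure" "v \<in> borel_measurable torus_measure"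
    and i: "integrable torus_measure (\<lambda>x. 2 * (norm (u x))\<^sup>2 + 2 * (norm (v x))\<^sup>2)"
    using assms by (auto simp: L2_class_def)
  show s: "(\<lambda>x. u x + v x) \<in> borel_measurable torus_measure" using m by simp
  show "integrable torus_measure (\<lambda>x. (norm (u x + v x))\<^sup>2)"
  proof (rule Bochner_Integration.integrable_bound[OF i])
    show "AE x in torus_measure. norm ((norm (u x + v x))\<^sup>2) \<le> norm (2 * (norm (u x))\<^sup>2 + 2 * (norm (v x))\<^sup>2)"
    proof (rule AE_I2)
      fix x
      have "(norm (u x + v x))\<^sup>2 \<le> (norm (u x) + norm (v x))\<^sup>2" by (intro power_mono norm_triangle_ineq) simp
      also have "\<dots> \<le> 2 * (norm (u x))\<^sup>2 + 2 * (norm (v x))\<^sup>2"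
        using zero_le_power2[of "norm (u x) - norm (v x)"] by (simp add: power2_eq_square algebra_simps)
      finally show "norm ((norm (u x + v x))\<^sup>2) \<le> norm (2 * (norm (u x))\<^sup>2 + 2 * (norm (v x))\<^sup>2)" by simp
    qed
  qed (use s in auto)
qed

lemma L2_class_cmult:
  fixes u :: "real^'n::finite \<Rightarrow> real"
  shows "L2_class u \<Longrightarrow> L2_class (\<lambda>x. c * u x)"
  by (auto simp: L2_class_def power_mult_distrib abs_mult)

lemma L2_class_0: "L2_class (\<lambda>_. 0)"
  by (simp add: L2_class_def)

lemma L2_class_sum:
  fixes u :: "'i \<Rightarrow> real^'n::finite \<Rightarrow> 'b::euclidean_space"
  assumes "finite I" "\<And>i. i \<in> I \<Longrightarrow> L2_class (u i)"
  shows "L2_class (\<lambda>x. \<Sum>i\<in>I. u i x)"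
  using assms by (induction I rule: finite_induct) (auto intro: L2_class_0 L2_class_add)

lemma in_L2_iff_L2_class: "in_L2 u \<longleftrightarrow> periodic u \<and> L2_class u"
  by (auto simp: in_L2_def L2_class_def)

lemma L2_class_scaleR_const:
  fixes u :: "real^'n::finite \<Rightarrow> real" and b :: "'b::euclidean_space"
  assumes "L2_class u"
  shows "L2_class (\<lambda>x. u x *\<^sub>R b)"
  using assms by (auto simp: L2_class_def power_mult_distrib)

lemma L2_class_component:
  fixes u :: "real^'n::finite \<Rightarrow> 'b::euclidean_space"
  assumes "L2_class u"
  shows "L2_class (\<lambda>x. u x \<bullet> b)"
  unfolding L2_class_def
proof
  show m: "(\<lambda>x. u x \<bullet> b) \<in> borel_measurable torus_measure"
    using assms unfolding L2_class_def by (intro borel_measurable_inner) auto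
  have "integrable torus_measure (\<lambda>x. (norm b)\<^sup>2 * (norm (u x))\<^sup>2)"
    using assms by (simp add: L2_class_def)
  thus "integrable torus_measure (\<lambda>x. (norm (u x \<bullet> b))\<^sup>2)"
  proof (rule Bochner_Integration.integrable_bound)
    show "AE x in torus_measure. norm ((norm (u x \<bullet> b))\<^sup>2) \<le> norm ((norm b)\<^sup>2 * (norm (u x))\<^sup>2)"
    proof (rule AE_I2)
      fix x
      have "\<bar>u x \<bullet> b\<bar>\<^sup>2 \<le> (norm (u x) * norm b)\<^sup>2"
        by (intro power_mono Cauchy_Schwarz_ineq2) simp
      thus "norm ((norm (u x \<bullet> b))\<^sup>2) \<le> norm ((norm b)\<^sup>2 * (norm (u x))\<^sup>2)"
        by (simp add: power_mult_distrib mult.commute)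
    qed
  qed (use m in simp)
qed

lemma L2_class_diff:
  fixes u v :: "real^'n::finite \<Rightarrow> real"
  assumes "L2_class u" "L2_class v"
  shows "L2_class (\<lambda>x. u x - v x)"
  using L2_class_add[OF assms(1) L2_class_cmult[OF assms(2), of "- 1"]] by simp

lemma in_L2_component:
  fixes u :: "real^'n::finite \<Rightarrow> 'b::euclidean_space"
  assumes "in_L2 u"
  shows "in_L2 (\<lambda>x. u x \<bullet> b)"
  using assms L2_class_component[of u b] by (auto simp: in_L2_iff_L2_class periodic_def)

text \<open>On the two-dimensional torus the third tensor index has the direction \<open>0\<close>, in which every
  derivative is \<open>0\<close>.\<close>

lemma has_weak_deriv_zero_dir:
  fixes u :: "real^'n::finite \<Rightarrow> 'b::euclidean_space"
  assumes "periodic u" "integrable torus_measure u"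
  shows "has_weak_deriv 0 u (\<lambda>_. 0)"
proof -
  have "dir_deriv 0 \<phi> x = 0" if "\<phi> \<in> torus_test" for \<phi> :: "real^'n \<Rightarrow> real" and x
  proof -
    have "linear (frechet_derivative \<phi> (at x))" by (rule linear_frechet_derivative[OF torus_test_differentiable[OF that]])
    thus ?thesis by (simp add: dir_deriv_def linear_0)
  qed
  thus ?thesis using assms by (simp add: has_weak_deriv_def periodic_def)
qed

lemma in_L2_0: "in_L2 (\<lambda>_. 0)"
  by (simp add: in_L2_def periodic_def)

lemma coord_dir_cases:
  assumes "inj lab"
  obtains i where "coord_dir lab k = axis i 1" | "coord_dir lab k = 0"
proof (cases "\<exists>i. lab i = k")
  case True
  then obtain i where "lab i = k" by blast
  hence "coord_dir lab k = axis i 1"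
    using assms by (auto simp: coord_dir_def axis_def vec_eq_iff dest: injD)
  thus ?thesis by (rule that(1))
next
  case False
  hence "coord_dir lab k = 0" by (simp add: coord_dir_def vec_eq_iff)
  thus ?thesis by (rule that(2))
qed

lemma H1_component_weak_deriv:
  fixes u :: "real^'n::finite \<Rightarrow> 'b::euclidean_space"
  assumes u: "in_H1 u" and lab: "inj lab" and f: "periodic f" "integrable torus_measure f"
    and ae: "AE x in torus_measure. u x \<bullet> b = f x"
  shows "has_weak_deriv (coord_dir lab k) f (weak_deriv (coord_dir lab k) f)"
    and "L2_class (weak_deriv (coord_dir lab k) f)"
    and "coord_dir lab k = axis i 1 \<Longrightarrow> AE x in torus_measure. weak_deriv (axis i 1) u x \<bullet> b = weak_deriv (coord_dir lab k) f x"
proof -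
  let ?w = "coord_dir lab k"
  have "\<exists>v. in_L2 v \<and> has_weak_deriv ?w f v"
  proof (rule coord_dir_cases[OF lab, of k])
    fix i assume w: "?w = axis i 1"
    obtain v where v: "in_L2 v" "has_weak_deriv (axis i 1) u v" using u unfolding in_H1_def by blast
    have "has_weak_deriv (axis i 1) f (\<lambda>x. v x \<bullet> b)"
      by (rule has_weak_deriv_cong_AE[OF has_weak_deriv_component[OF v(2)] f ae])
    with in_L2_component[OF v(1), of b] show ?thesis unfolding w by blast
  next
    assume "?w = 0"
    hence "has_weak_deriv ?w f (\<lambda>_. 0)" using has_weak_deriv_zero_dir[OF f] by simp
    with in_L2_0 show ?thesis by blast
  qed
  then obtain v where v: "in_L2 v" "has_weak_deriv ?w f v" by blast
  show hw: "has_weak_deriv ?w f (weak_deriv ?w f)" by (rule has_weak_deriv_weak_deriv[OF v(2)])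
  have "weak_deriv ?w f \<in> borel_measurable torus_measure"
    using has_weak_derivD(4)[OF hw] by (rule borel_measurable_integrable)
  moreover have "L2_class v" using v(1) by (simp add: in_L2_iff_L2_class)
  ultimately show "L2_class (weak_deriv ?w f)"
    using L2_class_cong_AE weak_deriv_AE_eq[OF v(2)] by blast
  assume w: "?w = axis i 1"
  obtain z where z: "has_weak_deriv (axis i 1) u z" using u unfolding in_H1_def by blast
  have "has_weak_deriv (axis i 1) (\<lambda>x. u x \<bullet> b) (\<lambda>x. weak_deriv (axis i 1) u x \<bullet> b)"
    by (rule has_weak_deriv_component[OF has_weak_deriv_weak_deriv[OF z]])
  thus "AE x in torus_measure. weak_deriv (axis i 1) u x \<bullet> b = weak_deriv ?w f x"
    unfolding w by (rule weak_deriv_unique[OF _ hw[unfolded w] ae])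
qed

lemma component_eq_inner: "(M :: real^3^3) $ i $ j = M \<bullet> axis i (axis j 1)"
  by (simp add: inner_axis)

text \<open>The second derivatives in the equation are chosen separately for every matrix component, whereas
  membership in \<open>H\<^sup>2\<close> speaks of derivatives of the matrix-valued map. By uniqueness the two agree
  almost everywhere.\<close>

lemma d2_L2_class:
  fixes u :: "real^'n::finite \<Rightarrow> real^3^3"
  assumes u: "in_H2 u" and lab: "inj lab"
  shows "L2_class (d2 lab u k l i j)"
proof -
  let ?b = "axis i (axis j 1) :: real^3^3"
  define f where "f x = u x $ i $ j" for x
  have H1: "in_H1 u" using u by (simp add: in_H2_def)
  have L2: "in_L2 u" using H1 by (simp add: in_H1_def)
  have f: "periodic f" "integrable torus_measure f"
    using in_L2_integrable[OF in_L2_component[OF L2, of ?b]] by (auto simp: f_def[abs_def] component_eq_inner)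
  have ae: "AE x in torus_measure. u x \<bullet> ?b = f x" by (simp add: f_def component_eq_inner)
  note D = H1_component_weak_deriv[OF H1 lab f ae, of l]
  define f' where "f' = weak_deriv (coord_dir lab l) f"
  have f': "periodic f'" "integrable torus_measure f'" 
    using has_weak_derivD(3,4)[OF D(1)] by (simp_all add: f'_def)
  have "L2_class (weak_deriv (coord_dir lab k) f')"
  proof (rule coord_dir_cases[OF lab, of l])
    fix m assume m: "coord_dir lab l = axis m 1"
    have "in_H1 (weak_deriv (axis m 1) u)" using u by (simp add: in_H2_def)
    from H1_component_weak_deriv(2)[OF this lab f'] D(3)[OF m] show ?thesis by (simp add: f'_def)
  next
    assume m: "coord_dir lab l = 0"
    have "AE x in torus_measure. f' x = 0"
      using weak_deriv_AE_eq[OF has_weak_deriv_zero_dir[OF f]] by (simp add: f'_def m)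
    hence "AE x in torus_measure. u x \<bullet> 0 = f' x" by eventually_elim simp
    from H1_component_weak_deriv(2)[OF H1 lab f' this] show ?thesis .
  qed
  thus ?thesis by (simp add: d2_def f'_def f_def[abs_def])
qed

lemma H2_weak_laplacian:
  fixes u :: "real^'n::finite \<Rightarrow> 'b::euclidean_space"
  assumes u: "in_H2 u"
  obtains h where "in_L2 h" "weak_laplacian u h"
proof -
  have "\<exists>v. in_L2 v \<and> has_weak_deriv (axis i 1) (weak_deriv (axis i 1) u) v" for i
    using u unfolding in_H2_def in_H1_def by blast
  then obtain v where v: "\<And>i. in_L2 (v i)" "\<And>i. has_weak_deriv (axis i 1) (weak_deriv (axis i 1) u) (v i)"
    by metis
  have u1: "has_weak_deriv (axis i 1) u (weak_deriv (axis i 1) u)" for i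
  proof -
    obtain z where "has_weak_deriv (axis i 1) u z" using u unfolding in_H2_def in_H1_def by blast
    thus ?thesis by (rule has_weak_deriv_weak_deriv)
  qed
  have iu: "integrable torus_measure u" by (rule has_weak_derivD(2)[OF u1])
  define h where "h x = (\<Sum>i\<in>UNIV. v i x)" for x
  have "in_L2 h"
    using v(1) unfolding in_L2_iff_L2_class h_def by (auto intro!: L2_class_sum simp: periodic_def)
  moreover have "weak_laplacian u h"
    unfolding weak_laplacian_def
  proof
    fix \<phi> :: "real^'n \<Rightarrow> real" assume \<phi>: "\<phi> \<in> torus_test"
    have d1: "dir_deriv w \<phi> \<in> torus_test" for w by (rule torus_test_dir_deriv[OF \<phi>])
    have "(\<integral>x. (\<Sum>i\<in>UNIV. dir_deriv (axis i 1) (dir_deriv (axis i 1) \<phi>) x) *\<^sub>R u x \<partial>torus_measure)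
       = (\<Sum>i\<in>UNIV. \<integral>x. dir_deriv (axis i 1) (dir_deriv (axis i 1) \<phi>) x *\<^sub>R u x \<partial>torus_measure)"
      unfolding scaleR_sum_left
      by (rule Bochner_Integration.integral_sum) (intro integrable_test_scaleR torus_test_dir_deriv \<phi> iu)
    also have "\<dots> = (\<Sum>i\<in>UNIV. \<integral>x. \<phi> x *\<^sub>R v i x \<partial>torus_measure)"
    proof (rule sum.cong[OF refl])
      fix i
      have "(\<integral>x. dir_deriv (axis i 1) (dir_deriv (axis i 1) \<phi>) x *\<^sub>R u x \<partial>torus_measure)
         = - (\<integral>x. dir_deriv (axis i 1) \<phi> x *\<^sub>R weak_deriv (axis i 1) u x \<partial>torus_measure)"
        by (rule has_weak_derivD(5)[OF u1 d1])
      also have "\<dots> = (\<integral>x. \<phi> x *\<^sub>R v i x \<partial>torus_measure)"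
        using has_weak_derivD(5)[OF v(2) \<phi>, of i] by simp
      finally show "(\<integral>x. dir_deriv (axis i 1) (dir_deriv (axis i 1) \<phi>) x *\<^sub>R u x \<partial>torus_measure) = (\<integral>x. \<phi> x *\<^sub>R v i x \<partial>torus_measure)" .
    qed
    also have "\<dots> = (\<integral>x. \<phi> x *\<^sub>R h x \<partial>torus_measure)"
      unfolding h_def scaleR_sum_right
      by (rule Bochner_Integration.integral_sum[symmetric])
         (intro integrable_test_scaleR \<phi> in_L2_integrable(1) v(1))
    finally show "(\<integral>x. (\<Sum>i\<in>UNIV. dir_deriv (axis i 1) (dir_deriv (axis i 1) \<phi>) x) *\<^sub>R u x \<partial>torus_measure)
       = (\<integral>x. \<phi> x *\<^sub>R h x \<partial>torus_measure)" .
  qed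
  ultimately show ?thesis by (rule that)
qed

section \<open>Time slices\<close>

lemma AE_lebesgue_on_slices:
  fixes R :: "real \<times> (real^'n::finite) \<Rightarrow> bool"
  assumes R: "AE z in lebesgue_on (I \<times> C). R z" and I: "I \<in> sets borel" and C: "C \<in> sets borel"
  shows "AE t in lebesgue_on I. AE x in lebesgue_on C. R (t, x)"
proof -
  have IC: "I \<times> C \<in> sets (lebesgue :: (real \<times> (real^'n)) measure)"
    using I C by (intro sets_completionI_sets) (simp add: borel_Times)
  have "AE z in lebesgue. z \<in> I \<times> C \<longrightarrow> R z"
    using R IC by (subst (asm) AE_restrict_space_iff) auto
  hence "AE z in lborel. z \<in> I \<times> C \<longrightarrow> R z" by (simp add: AE_completion_iff)
  hence "AE z in lborel \<Otimes>\<^sub>M lborel. z \<in> I \<times> C \<longrightarrow> R z" unfolding lborel_prod .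
  from lborel_pair.AE_pair[OF this] have "AE t in lborel. AE x in lborel. (t, x) \<in> I \<times> C \<longrightarrow> R (t, x)" .
  hence "AE t in lborel. t \<in> I \<longrightarrow> (AE x in lebesgue_on C. R (t, x))"
  proof eventually_elim
    case (elim t)
    show ?case
    proof
      assume t: "t \<in> I"
      have "AE x in lebesgue. x \<in> C \<longrightarrow> R (t, x)"
        using elim t by (intro AE_completion) (auto elim: eventually_mono)
      thus "AE x in lebesgue_on C. R (t, x)"
        using C by (subst AE_restrict_space_iff) (auto simp: sets_completionI_sets)
    qed
  qed
  hence "AE t in lebesgue. t \<in> I \<longrightarrow> (AE x in lebesgue_on C. R (t, x))" by (rule AE_completion)
  thus ?thesis using I by (subst AE_restrict_space_iff) (auto simp: sets_completionI_sets)
qed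

lemma lebesgue_measurable_borel_version:
  fixes f :: "'a::euclidean_space \<Rightarrow> 'b::euclidean_space"
  assumes f: "f \<in> borel_measurable lebesgue"
  obtains g where "g \<in> borel_measurable borel" "AE x in lebesgue. f x = g x"
proof -
  have "\<exists>h\<in>borel_measurable lborel. AE x in lborel. f x \<bullet> b = h x" for b
    using f by (intro completion_ex_borel_measurable_real) simp
  then obtain h where h: "\<And>b. h b \<in> borel_measurable lborel" "\<And>b. AE x in lborel. f x \<bullet> b = h b x"
    by metis
  define g where "g x = (\<Sum>b\<in>Basis. h b x *\<^sub>R b)" for x
  have "g \<in> borel_measurable lborel" unfolding g_def using h(1) by (intro borel_measurable_sum borel_measurable_scaleR) auto
  hence "g \<in> borel_measurable borel" by simp
  moreover have "AE x in lborel. \<forall>b\<in>Basis. f x \<bullet> b = h b x"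
    using h(2) by (intro AE_finite_allI) auto
  hence "AE x in lborel. f x = g x"
  proof eventually_elim
    case (elim x)
    have "f x = (\<Sum>b\<in>Basis. (f x \<bullet> b) *\<^sub>R b)" by (rule euclidean_representation[symmetric])
    also have "\<dots> = g x" unfolding g_def using elim by (intro sum.cong) auto
    finally show ?case .
  qed
  hence "AE x in lebesgue. f x = g x" by (rule AE_completion)
  ultimately show ?thesis by (rule that)
qed

text \<open>Tonelli's theorem applies to Borel measurable functions, whereas \<open>P\<close> is only Lebesgue measurable on
  space-time; hence the slices are square integrable up to null sets, which may depend on the time.\<close>

lemma AE_slice_L2_class:
  fixes P :: "real \<Rightarrow> real^'n::finite \<Rightarrow> 'b::euclidean_space"
  assumes m: "(\<lambda>(t, x). P t x) \<in> borel_measurable (space_time T)"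
    and i: "integrable (space_time T) (\<lambda>(t, x). (norm (P t x))\<^sup>2)"
  shows "AE t in lebesgue_on {0<..<T}. \<exists>p. L2_class p \<and> (AE x in torus_measure. P t x = p x)"
proof -
  let ?S = "{0<..<T} \<times> (unit_cell :: (real^'n) set)"
  define f where "f z = indicator ?S z *\<^sub>R (case z of (t, x) \<Rightarrow> P t x)" for z
  have S: "?S \<in> sets lebesgue" by (intro sets_completionI_sets) (simp add: borel_Times)
  have fm: "f \<in> borel_measurable lebesgue"
    using m S unfolding space_time_def f_def by (subst (asm) borel_measurable_restrict_space_iff) auto
  obtain g where g: "g \<in> borel_measurable borel" "AE z in lebesgue. f z = g z"
    using lebesgue_measurable_borel_version[OF fm] by blast
  have "AE z in lebesgue. z \<in> ?S \<longrightarrow> (case z of (t, x) \<Rightarrow> P t x) = g z"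
    using g(2) by eventually_elim (auto simp: f_def)
  hence "AE z in lebesgue_on ?S. (case z of (t, x) \<Rightarrow> P t x) = g z"
    using S by (subst AE_restrict_space_iff) auto
  hence slices: "AE t in lebesgue_on {0<..<T}. AE x in torus_measure. P t x = g (t, x)"
    using AE_lebesgue_on_slices by fastforce
  have "(\<integral>\<^sup>+z. ennreal ((norm (g z))\<^sup>2) \<partial>lborel) = (\<integral>\<^sup>+z. ennreal ((norm (g z))\<^sup>2) \<partial>lebesgue)"
    by (simp add: nn_integral_completion)
  also have "\<dots> = (\<integral>\<^sup>+z. ennreal (case z of (t, x) \<Rightarrow> (norm (P t x))\<^sup>2) * indicator ?S z \<partial>lebesgue)"
  proof (rule nn_integral_cong_AE)
    show "AE z in lebesgue. ennreal ((norm (g z))\<^sup>2)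
        = ennreal (case z of (t, x) \<Rightarrow> (norm (P t x))\<^sup>2) * indicator ?S z"
      using g(2)
    proof eventually_elim
      case (elim z)
      show ?case unfolding elim[symmetric] f_def by (cases z; cases "z \<in> ?S") simp_all
    qed
  qed
  also have "\<dots> = (\<integral>\<^sup>+z. ennreal (case z of (t, x) \<Rightarrow> (norm (P t x))\<^sup>2) \<partial>space_time T)"
    unfolding space_time_def using S by (subst nn_integral_restrict_space) auto
  also have "\<dots> < \<infinity>"
  proof -
    have "(\<integral>\<^sup>+z. ennreal (norm (case z of (t, x) \<Rightarrow> (norm (P t x))\<^sup>2)) \<partial>space_time T) < \<infinity>"
      using i unfolding integrable_iff_bounded by blast
    moreover have "norm (case z of (t, x) \<Rightarrow> (norm (P t x))\<^sup>2) = (case z of (t, x) \<Rightarrow> (norm (P t x))\<^sup>2)" for z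
      by (simp add: case_prod_beta)
    ultimately show ?thesis by simp
  qed
  finally have fin: "(\<integral>\<^sup>+z. ennreal ((norm (g z))\<^sup>2) \<partial>(lborel \<Otimes>\<^sub>M lborel)) < \<infinity>" by (simp add: lborel_prod)
  have mg: "(\<lambda>z. ennreal ((norm (g z))\<^sup>2)) \<in> borel_measurable (lborel \<Otimes>\<^sub>M lborel)"
    using g(1) by (simp add: lborel_prod)
  have "(\<integral>\<^sup>+t. \<integral>\<^sup>+x. ennreal ((norm (g (t, x)))\<^sup>2) \<partial>lborel \<partial>lborel) < \<infinity>"
    using fin lborel.nn_integral_fst[OF mg] by simp
  hence "AE t in lborel. (\<integral>\<^sup>+x. ennreal ((norm (g (t, x)))\<^sup>2) \<partial>lborel) \<noteq> \<infinity>"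
    using lborel.borel_measurable_nn_integral_fst[OF mg] by (intro nn_integral_PInf_AE) auto
  hence "AE t in lebesgue. t \<in> {0<..<T} \<longrightarrow> (\<integral>\<^sup>+x. ennreal ((norm (g (t, x)))\<^sup>2) \<partial>lborel) \<noteq> \<infinity>"
    by (intro AE_completion) (auto elim: eventually_mono)
  hence "AE t in lebesgue_on {0<..<T}. (\<integral>\<^sup>+x. ennreal ((norm (g (t, x)))\<^sup>2) \<partial>lborel) \<noteq> \<infinity>"
    by (subst AE_restrict_space_iff) auto
  with slices show ?thesis
  proof eventually_elim
    case (elim t)
    have gt: "(\<lambda>x. g (t, x)) \<in> borel_measurable borel"
    proof -
      have "g \<in> borel_measurable (borel \<Otimes>\<^sub>M borel)" using g(1) by (simp add: borel_prod)
      thus ?thesis by (rule measurable_compose[OF measurable_Pair1', rotated]) simp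
    qed
    have mt: "(\<lambda>x. g (t, x)) \<in> borel_measurable torus_measure" by (rule borel_measurable_torus[OF gt])
    have "(\<integral>\<^sup>+x. ennreal ((norm (g (t, x)))\<^sup>2) \<partial>torus_measure) \<le> (\<integral>\<^sup>+x. ennreal ((norm (g (t, x)))\<^sup>2) \<partial>lborel)"
      unfolding nn_integral_torus by (intro nn_integral_mono) (auto simp: indicator_def)
    also have "\<dots> < \<infinity>" using elim(2) by (simp add: top.not_eq_extremum)
    finally have "L2_class (\<lambda>x. g (t, x))"
      unfolding L2_class_def using mt by (auto intro!: integrableI_bounded)
    thus ?case using elim(1) by blast
  qed
qed

section \<open>Packings and Hausdorff dimension on the torus\<close>

text \<open>This makes \<open>torus_dist\<close> a pseudometric and identifies its balls with the supports of the
  averaging kernels.\<close>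

lemma torus_dist_eq: "torus_dist x y = norm (wrap (x - y))"
proof (rule antisym)
  let ?K = "{k :: real^'a. \<forall>i. k $ i \<in> \<int>}"
  have "torus_dist x y \<le> dist x (y + ((x - y) - wrap (x - y)))"
    unfolding torus_dist_def
    using wrap_diff_integer[of "x - y"] by (intro cINF_lower) (auto intro!: bdd_belowI[of _ 0])
  thus "torus_dist x y \<le> norm (wrap (x - y))" by (simp add: dist_norm)
  show "norm (wrap (x - y)) \<le> torus_dist x y"
    unfolding torus_dist_def
  proof (rule cINF_greatest)
    have "0 \<in> ?K" by simp
    thus "?K \<noteq> {}" by blast
    fix k assume "k \<in> ?K"
    thus "norm (wrap (x - y)) \<le> dist x (y + k)"
      using norm_wrap_le[of k "x - y"] by (simp add: dist_norm algebra_simps)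
  qed
qed

lemma torus_dist_sym: "torus_dist x y = torus_dist y x"
  by (simp add: torus_dist_eq norm_wrap_sym)

lemma torus_dist_triangle: "torus_dist x z \<le> torus_dist x y + torus_dist y z"
proof -
  define k where "k = (x - z) - (wrap (x - y) + wrap (y - z))"
  have "k = ((x - y) - wrap (x - y)) + ((y - z) - wrap (y - z))" by (simp add: k_def)
  hence "k $ i \<in> \<int>" for i
    using wrap_diff_integer[of "x - y" i] wrap_diff_integer[of "y - z" i] by (simp only: vector_add_component Ints_add)
  hence "norm (wrap (x - z)) \<le> norm ((x - z) - k)" by (rule norm_wrap_le)
  also have "\<dots> \<le> norm (wrap (x - y)) + norm (wrap (y - z))"
    unfolding k_def by (simp add: norm_triangle_ineq)
  finally show ?thesis by (simp add: torus_dist_eq)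
qed

lemma torus_dist_self: "torus_dist x x = 0"
proof -
  have "wrap 0 = (0 :: real^'a)" by (simp add: wrap_def vec_eq_iff)
  thus ?thesis by (simp add: torus_dist_eq)
qed

text \<open>A cover by \<open>W / r\<close> balls of radius \<open>2 r\<close> bounds the \<open>s\<close>-dimensional premeasure by
  \<open>W 4\<^sup>s r powr (s - 1)\<close>, which tends to \<open>0\<close> for \<open>s > 1\<close>.\<close>

lemma hausdorff_dim_le_1:
  fixes A :: "(real^'n::finite) set"
  assumes W: "W \<ge> 0"
    and cover: "\<And>r. 0 < r \<Longrightarrow> r < 1/2 \<Longrightarrow>
      \<exists>B. finite B \<and> real (card B) * r \<le> W \<and> (\<forall>y\<in>A. \<exists>x\<in>B. torus_dist y x < 2 * r)"
  shows "hausdorff_dim torus_dist A \<le> 1"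
proof -
  have zero: "hausdorff_measure torus_dist s A = 0" if s: "s > 1" for s
  proof -
    have "(INF U\<in>{U :: nat \<Rightarrow> (real^'n) set. A \<subseteq> (\<Union>m. U m) \<and> (\<forall>m. \<forall>x\<in>U m. \<forall>y\<in>U m. torus_dist x y \<le> \<delta>)}.
       (\<Sum>m. ennreal (diam torus_dist (U m) powr s))) \<le> 0" (is "?I \<le> 0") if \<delta>: "\<delta> > 0" for \<delta>
    proof (rule ennreal_le_epsilon)
      fix \<epsilon> :: real assume \<epsilon>: "\<epsilon> > 0"
      have "((\<lambda>r. W * (4 powr s * r powr (s - 1))) \<longlongrightarrow> W * (4 powr s * 0)) (at_right 0)"
        using s by (intro tendsto_intros tendsto_zero_powrI[OF tendsto_ident_at tendsto_const]) (auto simp: eventually_at_filter)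
      hence "\<forall>\<^sub>F r in at_right 0. W * (4 powr s * r powr (s - 1)) < \<epsilon>"
        using \<epsilon> by (intro order_tendstoD(2)) auto
      moreover have "\<forall>\<^sub>F r in at_right 0. r \<in> {0<..<min (1/2) (\<delta> / 4)}"
        using \<delta> by (intro eventually_at_right_real) auto
      ultimately have "\<forall>\<^sub>F r in at_right 0. W * (4 powr s * r powr (s - 1)) < \<epsilon> \<and> r \<in> {0<..<min (1/2) (\<delta> / 4)}"
        by (rule eventually_conj)
      then obtain r where r: "W * (4 powr s * r powr (s - 1)) < \<epsilon>" "0 < r" "r < 1/2" "4 * r < \<delta>"
        using eventually_happens'[of "at_right (0::real)"] by (auto simp: field_simps)
      obtain B where B: "finite B" "real (card B) * r \<le> W" "\<forall>y\<in>A. \<exists>x\<in>B. torus_dist y x < 2 * r"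
        using cover[OF r(2,3)] by blast
      obtain e where e: "bij_betw e {0..<card B} B" using ex_bij_betw_nat_finite[OF B(1)] by blast
      \<comment> \<open>Covers are sequences of sets; the empty sets have diameter \<open>0\<close> and contribute \<open>0 powr s = 0\<close>.\<close>
      define U where "U m = (if m < card B then {y \<in> A. torus_dist y (e m) < 2 * r} else {})" for m
      have small: "torus_dist x y \<le> 4 * r" if "x \<in> U m" "y \<in> U m" for x y m
        using torus_dist_triangle[of x y "e m"] torus_dist_sym[of y "e m"] that
        by (auto simp: U_def split: if_splits)
      have cov: "A \<subseteq> (\<Union>m. U m)"
      proof
        fix y assume y: "y \<in> A"
        then obtain x where x: "x \<in> B" "torus_dist y x < 2 * r" using B(3) by blast
        have "x \<in> e ` {0..<card B}" using x(1) e by (simp add: bij_betw_def)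
        then obtain m where "m < card B" "x = e m" by auto
        thus "y \<in> (\<Union>m. U m)" using x y by (auto simp: U_def)
      qed
      have diam: "diam torus_dist (U m) powr s \<le> (4 * r) powr s" for m
      proof (cases "U m = {}")
        case True
        thus ?thesis using s by (simp add: diam_def)
      next
        case False
        then obtain x where x: "x \<in> U m" by blast
        have bdd: "bdd_above ((\<lambda>(x, y). torus_dist x y) ` (U m \<times> U m))"
          using small by (intro bdd_aboveI[of _ "4 * r"]) auto
        have "torus_dist x x \<le> (SUP (x, y)\<in>U m \<times> U m. torus_dist x y)"
          using cSUP_upper[OF _ bdd, of "(x, x)"] x by simp
        hence "0 \<le> diam torus_dist (U m)" using False by (simp add: diam_def torus_dist_self)
        moreover have "(SUP (x, y)\<in>U m \<times> U m. torus_dist x y) \<le> 4 * r"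
          using False small by (intro cSUP_least) auto
        hence "diam torus_dist (U m) \<le> 4 * r" using False by (simp add: diam_def)
        ultimately show ?thesis using s by (intro powr_mono2) auto
      qed
      have "?I \<le> (\<Sum>m. ennreal (diam torus_dist (U m) powr s))"
        using cov small r(4) by (intro INF_lower) (force intro: order_trans less_imp_le)
      also have "\<dots> = (\<Sum>m<card B. ennreal (diam torus_dist (U m) powr s))"
        using s by (intro suminf_finite) (auto simp: U_def diam_def)
      also have "\<dots> \<le> (\<Sum>m<card B. ennreal ((4 * r) powr s))"
        by (intro sum_mono ennreal_leI diam)
      also have "\<dots> = ennreal (real (card B) * (4 * r) powr s)"
        by (simp add: ennreal_mult ennreal_of_nat_eq_real_of_nat)
      also have "real (card B) * (4 * r) powr s = (real (card B) * r) * (4 powr s * r powr (s - 1))"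
      proof -
        have "r powr s = r powr 1 * r powr (s - 1)" by (subst powr_add[symmetric]) simp
        thus ?thesis using r(2) by (simp add: powr_mult)
      qed
      also have "ennreal \<dots> \<le> ennreal (W * (4 powr s * r powr (s - 1)))"
        using B(2) by (intro ennreal_leI mult_right_mono) auto
      also have "\<dots> \<le> 0 + ennreal \<epsilon>" using r(1) by (simp add: ennreal_leI)
      finally show "?I \<le> 0 + ennreal \<epsilon>" .
    qed
    thus ?thesis
      unfolding hausdorff_measure_def
      by (intro antisym SUP_least) (auto simp only: zero_le greaterThan_iff)
  qed
  show ?thesis
  proof (rule ereal_le_epsilon2)
    fix \<epsilon> :: real assume "\<epsilon> > 0"
    hence "ereal (1 + \<epsilon>) \<in> {ereal s |s. s > 0 \<and> hausdorff_measure torus_dist s A = 0}"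
      using zero[of "1 + \<epsilon>"] by auto
    hence "hausdorff_dim torus_dist A \<le> ereal (1 + \<epsilon>)"
      unfolding hausdorff_dim_def by (rule Inf_lower)
    thus "hausdorff_dim torus_dist A \<le> 1 + ereal \<epsilon>" by (simp add: one_ereal_def)
  qed
qed

text \<open>The balls of radius \<open>r\<close> around a \<open>2 r\<close>-separated set are disjoint and each carries mass at least \<open>b\<close>; so
  there is a largest such set, and by maximality the balls of twice the radius cover.\<close>

lemma packing_cover:
  fixes A :: "(real^'n::finite) set"
  assumes w: "integrable torus_measure \<omega>" "\<And>y. 0 \<le> \<omega> y" and r: "r > 0" and b: "b > 0"
    and lower: "\<And>x. x \<in> A \<Longrightarrow> b \<le> (\<integral>y. indicator (torus_ball x r) y * \<omega> y \<partial>torus_measure)"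
  obtains B where "finite B" "real (card B) * b \<le> (\<integral>y. \<omega> y \<partial>torus_measure)"
    "\<forall>y\<in>A. \<exists>x\<in>B. torus_dist y x < 2 * r"
proof -
  let ?W = "\<integral>y. \<omega> y \<partial>torus_measure"
  define sep where "sep B \<longleftrightarrow> finite B \<and> B \<subseteq> A \<and> (\<forall>x\<in>B. \<forall>y\<in>B. x \<noteq> y \<longrightarrow> 2 * r \<le> torus_dist x y)" for B
  have card: "real (card B) * b \<le> ?W" if "sep B" for B
  proof -
    have fin: "finite B" and BA: "B \<subseteq> A" and dis: "\<And>x y. x \<in> B \<Longrightarrow> y \<in> B \<Longrightarrow> x \<noteq> y \<Longrightarrow> 2 * r \<le> torus_dist x y"
      using that by (auto simp: sep_def)
    have "real (card B) * b = (\<Sum>x\<in>B. b)" by simp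
    also have "\<dots> \<le> (\<Sum>x\<in>B. \<integral>y. indicator (torus_ball x r) y * \<omega> y \<partial>torus_measure)"
      using BA by (intro sum_mono lower) auto
    also have "\<dots> = (\<integral>y. (\<Sum>x\<in>B. indicator (torus_ball x r) y * \<omega> y) \<partial>torus_measure)"
      by (rule Bochner_Integration.integral_sum[symmetric]) (rule integral_torus_ball_le(2)[OF w])
    also have "\<dots> \<le> ?W"
    proof (rule integral_mono)
      show "integrable torus_measure (\<lambda>y. \<Sum>x\<in>B. indicator (torus_ball x r) y * \<omega> y)"
        by (intro Bochner_Integration.integrable_sum integral_torus_ball_le(2)[OF w])
      fix y :: "real^'n"
      have "(\<Sum>x\<in>B. indicator (torus_ball x r) y :: real) \<le> 1"
      proof (cases "\<exists>x\<in>B. y \<in> torus_ball x r")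
        case True
        then obtain x where x: "x \<in> B" "y \<in> torus_ball x r" by blast
        have "y \<notin> torus_ball x' r" if "x' \<in> B" "x' \<noteq> x" for x'
        proof
          assume "y \<in> torus_ball x' r"
          hence "torus_dist y x' < r" "torus_dist y x < r" using x by (auto simp: torus_ball_def torus_dist_eq)
          hence "torus_dist x x' < 2 * r" using torus_dist_triangle[of x x' y] torus_dist_sym[of x y] by linarith
          thus False using dis[OF x(1) that(1)] that(2) by simp
        qed
        hence "(\<Sum>x'\<in>B. indicator (torus_ball x' r) y :: real) = (\<Sum>x'\<in>B. if x' = x then 1 else 0)"
          using x by (intro sum.cong) (auto simp: indicator_def)
        thus ?thesis using fin x(1) by simp
      next
        case False
        hence "(\<Sum>x\<in>B. indicator (torus_ball x r) y :: real) = 0" by (intro sum.neutral) auto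
        thus ?thesis by simp
      qed
      hence "(\<Sum>x\<in>B. indicator (torus_ball x r) y :: real) * \<omega> y \<le> 1 * \<omega> y"
        using w(2) by (rule mult_right_mono)
      thus "(\<Sum>x\<in>B. indicator (torus_ball x r) y * \<omega> y) \<le> \<omega> y" by (simp add: sum_distrib_right)
    qed (rule w(1))
    finally show ?thesis .
  qed
  have "card B \<le> nat \<lfloor>?W / b\<rfloor>" if "sep B" for B
    using card[OF that] b by (simp add: le_nat_floor field_simps)
  moreover have "sep {}" by (simp add: sep_def)
  ultimately obtain B where B: "sep B" "\<And>B'. sep B' \<Longrightarrow> card B' \<le> card B"
    using ex_has_greatest_nat[of sep "{}" card] by (metis less_Suc_eq_le)
  have "\<exists>x\<in>B. torus_dist y x < 2 * r" if y: "y \<in> A" for y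
  proof (rule ccontr)
    assume "\<not> (\<exists>x\<in>B. torus_dist y x < 2 * r)"
    hence far: "\<And>x. x \<in> B \<Longrightarrow> 2 * r \<le> torus_dist y x" by (auto simp: not_less)
    hence "y \<notin> B" using r torus_dist_self[of y] by force
    moreover have "sep (insert y B)"
    proof -
      have "2 * r \<le> torus_dist x y" if "x \<in> B" for x
        using far[OF that] torus_dist_sym[of y x] by simp
      thus ?thesis using B(1) y far by (auto simp: sep_def)
    qed
    ultimately show False using B(2)[of "insert y B"] B(1) by (simp add: sep_def)
  qed
  thus ?thesis using that[of B] B(1) card[OF B(1)] by (auto simp: sep_def)
qed

section \<open>The surface measure of the sphere\<close>

definition punctured_ball :: "(real^3) set" where
  "punctured_ball = ball 0 1 - {0}"

lemma punctured_ball_sets [measurable, simp]: "punctured_ball \<in> sets borel"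
  by (simp add: punctured_ball_def)

lemma normalize_measurable:
  "(\<lambda>x. x /\<^sub>R norm x) \<in> restrict_space lborel punctured_ball \<rightarrow>\<^sub>M restrict_space borel (sphere (0::real^3) 1)"
  by (rule measurable_restrict_space2)
     (auto simp: space_restrict_space punctured_ball_def intro!: measurable_restrict_space1)

lemma space_S2: "space S2 = sphere 0 1"
  by (simp add: S2_def space_scale_measure space_restrict_space)

lemma sets_S2 [measurable_cong]: "sets S2 = sets (restrict_space borel (sphere 0 1))"
  by (simp add: S2_def)

lemma emeasure_S2:
  assumes "A \<in> sets S2"
  shows "emeasure S2 A = 3 * emeasure lborel {x \<in> punctured_ball. x /\<^sub>R norm x \<in> A}"
proof -
  have A: "A \<in> sets (restrict_space borel (sphere 0 1))"
    using assms by (simp add: sets_S2)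
  have "emeasure S2 A = 3 * emeasure (restrict_space lborel punctured_ball)
     ((\<lambda>x. x /\<^sub>R norm x) -` A \<inter> space (restrict_space lborel punctured_ball))"
    unfolding S2_def punctured_ball_def[symmetric]
    using emeasure_distr[OF normalize_measurable A]
    by simp
  also have "\<dots> = 3 * emeasure lborel ((\<lambda>x. x /\<^sub>R norm x) -` A \<inter> space (restrict_space lborel punctured_ball))"
    by (subst emeasure_restrict_space) (auto simp: space_restrict_space)
  also have "(\<lambda>x. x /\<^sub>R norm x) -` A \<inter> space (restrict_space lborel punctured_ball)
     = {x \<in> punctured_ball. x /\<^sub>R norm x \<in> A}"
    by (auto simp: space_restrict_space)
  finally show ?thesis .
qed

lemma cone_sets:
  assumes "A \<in> sets S2"
  shows "{x \<in> punctured_ball. x /\<^sub>R norm x \<in> A} \<in> sets borel"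
proof -
  have "(\<lambda>x. x /\<^sub>R norm x) -` A \<inter> space (restrict_space lborel punctured_ball)
      \<in> sets (restrict_space lborel punctured_ball)"
    using assms by (intro measurable_sets[OF normalize_measurable]) (simp add: sets_S2)
  moreover have "(\<lambda>x. x /\<^sub>R norm x) -` A \<inter> space (restrict_space lborel punctured_ball)
     = {x \<in> punctured_ball. x /\<^sub>R norm x \<in> A}"
    by (auto simp: space_restrict_space)
  ultimately show ?thesis
    by (auto simp: sets_restrict_space)
qed

lemma finite_measure_S2: "finite_measure S2"
proof
  have "emeasure S2 (space S2) \<le> 3 * emeasure lborel (ball (0::real^3) 1)"
    by (subst emeasure_S2) (auto simp: punctured_ball_def intro!: mult_left_mono emeasure_mono)
  also have "\<dots> < \<infinity>"
    using emeasure_lborel_ball_finite[of "0::real^3" 1] by (simp add: ennreal_mult_less_top)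
  finally show "emeasure S2 (space S2) \<noteq> \<infinity>" by simp
qed

interpretation S2: finite_measure S2 by (rule finite_measure_S2)

lemma continuous_borel_measurable_S2 [measurable]:
  fixes g :: "real^3 \<Rightarrow> 'b::topological_space"
  shows "continuous_on (sphere 0 1) g \<Longrightarrow> g \<in> borel_measurable S2"
  using borel_measurable_continuous_on_restrict measurable_cong_sets[OF sets_S2 refl] by blast

lemma continuous_integrable_S2 [intro]:
  fixes g :: "real^3 \<Rightarrow> 'b::{banach,second_countable_topology}"
  assumes "continuous_on (sphere 0 1) g"
  shows "integrable S2 g"
proof -
  have "bounded (g ` sphere 0 1)"
    by (intro compact_imp_bounded compact_continuous_image assms compact_sphere)
  then obtain C where "\<forall>x\<in>sphere 0 1. norm (g x) \<le> C"
    unfolding bounded_iff by blast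
  thus ?thesis
    by (intro S2.integrable_const_bound[where B=C] AE_I2 continuous_borel_measurable_S2 assms)
       (auto simp: space_S2)
qed

text \<open>Orthogonal maps preserve the volume of cones, hence the surface measure.\<close>

lemma distr_S2_orthogonal:
  fixes T :: "real^3 \<Rightarrow> real^3"
  assumes T: "orthogonal_transformation T"
  shows "T \<in> S2 \<rightarrow>\<^sub>M S2" and "distr S2 S2 T = S2"
proof -
  have lin: "linear T" and nT: "\<And>x. norm (T x) = norm x"
    using T by (auto simp: orthogonal_transformation)
  have contT: "continuous_on X T" for X
    using lin by (simp add: linear_continuous_on linear_linear)
  have T_id: "T \<in> restrict_space borel (sphere 0 1) \<rightarrow>\<^sub>M restrict_space borel (sphere 0 1)"
    by (intro measurable_restrict_space2 borel_measurable_continuous_on_restrict contT)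
       (auto simp: space_restrict_space nT)
  show TM: "T \<in> S2 \<rightarrow>\<^sub>M S2"
    using T_id measurable_cong_sets[OF sets_S2 sets_S2] by blast
  show "distr S2 S2 T = S2"
  proof (rule measure_eqI)
    fix A assume "A \<in> sets (distr S2 S2 T)"
    hence A: "A \<in> sets S2" by simp
    define X where "X = {x \<in> punctured_ball. x /\<^sub>R norm x \<in> A}"
    define Y where "Y = {x \<in> punctured_ball. x /\<^sub>R norm x \<in> T -` A \<inter> space S2}"
    have TA: "T -` A \<inter> space S2 \<in> sets S2"
      using A TM by (rule measurable_sets[rotated])
    have X: "X \<in> sets borel" and Y: "Y \<in> sets borel"
      unfolding X_def Y_def using cone_sets[OF A] cone_sets[OF TA] by auto
    have bX: "bounded X" and bY: "bounded Y"
      by (auto simp: X_def Y_def punctured_ball_def intro: bounded_subset[OF bounded_ball[of 0 1]])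
    have mX: "X \<in> lmeasurable" and mY: "Y \<in> lmeasurable"
      using X Y bX bY by (auto intro!: bounded_set_imp_lmeasurable)
    have TY: "T ` Y = X"
    proof -
      have sp: "x /\<^sub>R norm x \<in> space S2" if "x \<in> punctured_ball" for x
        using that by (auto simp: space_S2 punctured_ball_def)
      have pb: "T x \<in> punctured_ball \<longleftrightarrow> x \<in> punctured_ball" for x
        using nT[of x] by (auto simp: punctured_ball_def)
      have sc: "T (x /\<^sub>R norm x) = T x /\<^sub>R norm (T x)" for x
        using lin by (simp add: linear_scale nT)
      have "x \<in> Y \<longleftrightarrow> T x \<in> X" for x
        unfolding X_def Y_def using sp[of x] pb[of x] sc[of x] by auto
      moreover have "surj T"
        using T orthogonal_transformation_surj by blast
      ultimately show ?thesis
        by (auto simp: image_iff) (metis surjD)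
    qed
    have "measure lebesgue X = measure lebesgue Y"
      using measure_orthogonal_image[OF T mY] TY by simp
    hence "emeasure lborel X = emeasure lborel Y"
      using X Y emeasure_eq_measure2[OF mX] emeasure_eq_measure2[OF mY] by simp
    thus "emeasure (distr S2 S2 T) A = emeasure S2 A"
      using TM A TA by (simp add: emeasure_distr emeasure_S2 X_def Y_def)
  qed simp
qed

lemma integral_S2_orthogonal:
  fixes g :: "real^3 \<Rightarrow> real"
  assumes "orthogonal_transformation T" "g \<in> borel_measurable S2"
  shows "(\<integral>v. g (T v) \<partial>S2) = (\<integral>v. g v \<partial>S2)"
  using integral_distr[OF distr_S2_orthogonal(1)[OF assms(1)] assms(2)]
    distr_S2_orthogonal(2)[OF assms(1)] by simp

text \<open>The surface measure has full support, because cones over open sets are open.\<close>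

lemma integral_S2_eq_0_imp:
  fixes g :: "real^3 \<Rightarrow> real"
  assumes cont: "continuous_on (sphere 0 1) g" and nonneg: "\<And>v. norm v = 1 \<Longrightarrow> 0 \<le> g v"
    and int: "(\<integral>v. g v \<partial>S2) = 0" and v: "norm v = 1"
  shows "g v = 0"
proof (rule ccontr)
  assume "g v \<noteq> 0"
  hence gv: "g v > 0" using nonneg[OF v] by simp
  have "AE v in S2. g v = 0"
    using cont nonneg int
    by (subst integral_nonneg_eq_0_iff_AE[symmetric]) (auto simp: space_S2 intro!: AE_I2)
  then obtain N where N: "{v \<in> space S2. g v \<noteq> 0} \<subseteq> N" "emeasure S2 N = 0" "N \<in> sets S2"
    by (rule AE_E) (use that in blast)
  define X where "X = {x \<in> punctured_ball. x /\<^sub>R norm x \<in> N}"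
  have X0: "emeasure lborel X = 0"
    using N by (auto simp: emeasure_S2 X_def)
  define U where "U = {x \<in> punctured_ball. g (x /\<^sub>R norm x) \<in> {0<..}}"
  have opb: "open punctured_ball" by (auto simp: punctured_ball_def)
  have c: "continuous_on punctured_ball (\<lambda>x. g (x /\<^sub>R norm x))"
  proof (rule continuous_on_compose2[OF cont])
    show "continuous_on punctured_ball (\<lambda>x. x /\<^sub>R norm x)"
      by (intro continuous_intros) (auto simp: punctured_ball_def)
    show "(\<lambda>x. x /\<^sub>R norm x) ` punctured_ball \<subseteq> sphere 0 1"
      by (auto simp: punctured_ball_def) (metis left_inverse norm_eq_zero)
  qed
  have oU: "open U"
    unfolding U_def using continuous_open_preimage[OF c opb open_greaterThan[of 0]]
    by (simp add: vimage_def Int_def)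
  have "(1/2) *\<^sub>R v \<in> U"
    using v gv by (auto simp: U_def punctured_ball_def)
  hence neU: "U \<noteq> {}" by auto
  have "U \<subseteq> X"
  proof
    fix x assume x: "x \<in> U"
    hence "x /\<^sub>R norm x \<in> space S2"
      by (auto simp: U_def space_S2 punctured_ball_def simp del: norm_inverse)
    thus "x \<in> X" using x N(1) by (auto simp: U_def X_def)
  qed
  hence "U \<in> null_sets lborel"
    using null_sets_subset[of X lborel U] X0 cone_sets[OF N(3)] oU
    by (simp add: null_sets_def X_def)
  hence "negligible U"
    by (simp add: negligible_iff_null_sets null_sets_completionI)
  thus False
    using oU neU open_not_negligible by blast
qed

section \<open>Q-tensors as quadratic forms\<close>

text \<open>The dyad \<open>v v\<^sup>T\<close>. Its inner product with a matrix is the value of the quadratic form at \<open>v\<close>.\<close>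

definition tsq :: "real^3 \<Rightarrow> real^3^3" where
  "tsq v = (\<chi> i j. v $ i * v $ j)"

lemma inner_tsq: "M \<bullet> tsq v = v \<bullet> (M *v v)"
  by (simp add: inner_vec_def tsq_def matrix_vector_mult_def sum_distrib_left mult_ac)

lemma inner_mat_1: "M \<bullet> (mat 1 :: real^3^3) = trace M" "(mat 1 :: real^3^3) \<bullet> M = trace M"
  by (simp_all add: inner_vec_def mat_def trace_def sum_3)

lemma trace_tsq: "trace (tsq v) = (norm v)\<^sup>2"
  by (simp add: trace_def tsq_def power2_norm_eq_inner inner_vec_def)

lemma norm_tsq: "norm (tsq v) = (norm v)\<^sup>2"
proof -
  have "tsq v *v v = (v \<bullet> v) *\<^sub>R v"
    by (simp add: vec_eq_iff tsq_def matrix_vector_mult_def inner_vec_def sum_3 algebra_simps)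
  hence "tsq v \<bullet> tsq v = (v \<bullet> v) * (v \<bullet> v)"
    by (simp add: inner_tsq)
  hence "(norm (tsq v))\<^sup>2 = ((norm v)\<^sup>2)\<^sup>2"
    by (simp add: power2_norm_eq_inner) (simp add: power2_eq_square)
  thus ?thesis
    by (metis norm_ge_zero power2_eq_imp_eq zero_le_power2)
qed

lemma quadratic_form_le: "\<bar>v \<bullet> (M *v v)\<bar> \<le> norm M * (norm (v::real^3))\<^sup>2"
  using Cauchy_Schwarz_ineq2[of M "tsq v"] by (simp add: inner_tsq norm_tsq)

lemma continuous_on_tsq [continuous_intros]:
  "continuous_on S f \<Longrightarrow> continuous_on S (\<lambda>x. tsq (f x))"
  unfolding tsq_def by (intro continuous_intros)

lemma subspace_Qsp: "subspace Qsp"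
  by (auto simp: subspace_def Qsp_def trace_def transpose_def vec_eq_iff sum.distrib
      simp flip: sum_distrib_left)

lemma Qsp_0 [simp]: "0 \<in> Qsp" by (rule subspace_0[OF subspace_Qsp])

lemma tsq_Qsp: "norm v = 1 \<Longrightarrow> tsq v - (1/3) *\<^sub>R mat 1 \<in> Qsp"
  by (auto simp: Qsp_def trace_def vec_eq_iff transpose_def mat_def tsq_def sum_subtractf
      sum_3 power2_eq_square norm_vec_def L2_set_def)

lemma Qsp_inner_mat_1: "M \<in> Qsp \<Longrightarrow> M \<bullet> mat 1 = 0" "M \<in> Qsp \<Longrightarrow> mat 1 \<bullet> M = 0"
  by (simp_all add: inner_mat_1 Qsp_def)

lemma Qsp_symmetric: "M \<in> Qsp \<Longrightarrow> x \<bullet> (M *v y) = (M *v x) \<bullet> y"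
  by (metis (mono_tags, lifting) Qsp_def dot_lmul_matrix mem_Collect_eq matrix_transpose_mul
      transpose_matrix_vector)

text \<open>An orthonormal frame resolves the identity; the trace is therefore the sum of the values of the
  quadratic form along any frame.\<close>

lemma sum_tsq_frame:
  assumes "orthogonal_transformation (T :: real^3 \<Rightarrow> real^3)"
  shows "(\<Sum>i\<in>UNIV. tsq (T (axis i 1))) = mat 1"
proof -
  have "orthogonal_matrix (matrix T)"
    using assms orthogonal_transformation_matrix by blast
  hence "matrix T ** transpose (matrix T) = mat 1"
    by (simp add: orthogonal_matrix_def)
  hence "(\<Sum>i\<in>UNIV. T (axis i 1) $ k * T (axis i 1) $ l) = (mat 1 :: real^3^3) $ k $ l" for k l
    by (simp add: vec_eq_iff matrix_matrix_mult_def transpose_def matrix_def)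
  thus ?thesis by (simp add: vec_eq_iff tsq_def)
qed

lemma trace_frame:
  assumes "orthogonal_transformation (T :: real^3 \<Rightarrow> real^3)"
  shows "(\<Sum>i\<in>UNIV. T (axis i 1) \<bullet> (M *v T (axis i 1))) = trace M"
  using arg_cong[OF sum_tsq_frame[OF assms], of "\<lambda>X. M \<bullet> X"]
  by (simp add: inner_sum_right inner_tsq inner_mat_1)

lemma frame_through:
  assumes "norm (e :: real^3) = 1"
  obtains T :: "real^3 \<Rightarrow> real^3" where "orthogonal_transformation T" "T (axis 1 1) = e"
proof -
  have "norm (axis 1 1 :: real^3) = norm e"
    using assms by simp
  from orthogonal_transformation_exists[OF this] show ?thesis using that by blast
qed

lemma norm_frame:
  assumes "orthogonal_transformation (T :: real^3 \<Rightarrow> real^3)"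
  shows "norm (T (axis i 1)) = 1"
  using assms by (simp add: orthogonal_transformation_norm)

lemma eigenvalue_unit_vector:
  assumes "l \<in> eigenvalues M"
  obtains e where "norm e = 1" "e \<bullet> (M *v e) = l"
proof -
  obtain v where v: "v \<noteq> 0" "M *v v = l *\<^sub>R v" using assms by (auto simp: eigenvalues_def)
  have "norm (v /\<^sub>R norm v) = 1" using v by simp
  moreover have "(v /\<^sub>R norm v) \<bullet> (M *v (v /\<^sub>R norm v)) = l"
    using v by (simp add: matrix_vector_mult_scaleR power2_norm_eq_inner[symmetric] power2_eq_square field_simps)
  ultimately show ?thesis using that by blast
qed

text \<open>The quadratic form attains its minimum on the unit sphere, and the first variation at a minimiser
  is the eigenvalue equation.\<close>

lemma quadratic_form_min_eigenvalue:
  assumes M: "M \<in> Qsp"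
  obtains l where "l \<in> eigenvalues M" "\<And>e. norm e = 1 \<Longrightarrow> l \<le> e \<bullet> (M *v e)"
proof -
  have cont: "continuous_on (sphere 0 1) (\<lambda>e::real^3. e \<bullet> (M *v e))"
    by (intro continuous_intros linear_continuous_on) (auto simp: linear_linear)
  obtain e where e: "norm e = 1" "\<And>y. norm y = 1 \<Longrightarrow> e \<bullet> (M *v e) \<le> y \<bullet> (M *v y)"
    using continuous_attains_inf[OF compact_sphere _ cont] by (auto simp: dist_norm)
  define l where "l = e \<bullet> (M *v e)"
  have min: "l * (norm y)\<^sup>2 \<le> y \<bullet> (M *v y)" for y
  proof (cases "y = 0")
    case False
    hence "l \<le> (y /\<^sub>R norm y) \<bullet> (M *v (y /\<^sub>R norm y))"
      unfolding l_def by (intro e) simp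
    thus ?thesis using False
      by (simp add: matrix_vector_mult_scaleR power2_eq_square field_simps)
  qed simp
  define v where "v = M *v e - l *\<^sub>R e"
  have ineq: "0 \<le> 2 * t * (v \<bullet> v) + t\<^sup>2 * (v \<bullet> (M *v v) - l * (v \<bullet> v))" for t
  proof -
    have ee: "e \<bullet> e = 1" using e(1) by (simp add: norm_eq_1)
    have ev: "v \<bullet> (M *v e) - l * (e \<bullet> v) = v \<bullet> v"
      unfolding v_def by (simp add: inner_simps inner_commute algebra_simps)
    have sym: "e \<bullet> (M *v v) = v \<bullet> (M *v e)"
      using Qsp_symmetric[OF M, of e v] by (simp add: inner_commute)
    have "l * ((e + t *\<^sub>R v) \<bullet> (e + t *\<^sub>R v)) \<le> (e + t *\<^sub>R v) \<bullet> (M *v (e + t *\<^sub>R v))"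
      using min[of "e + t *\<^sub>R v"] by (simp add: power2_norm_eq_inner)
    also have "\<dots> = l + 2 * t * (v \<bullet> (M *v e)) + t\<^sup>2 * (v \<bullet> (M *v v))"
      by (simp add: matrix_vector_right_distrib matrix_vector_mult_scaleR inner_simps sym l_def
          power2_eq_square algebra_simps)
    also have "(e + t *\<^sub>R v) \<bullet> (e + t *\<^sub>R v) = 1 + 2 * t * (e \<bullet> v) + t\<^sup>2 * (v \<bullet> v)"
      using ee by (simp add: inner_simps inner_commute power2_eq_square algebra_simps)
    finally show ?thesis
      using arg_cong[OF ev, of "\<lambda>a. 2 * t * a"] by (simp add: algebra_simps)
  qed
  have "v = 0"
  proof (rule ccontr)
    assume "v \<noteq> 0"
    hence p: "v \<bullet> v > 0" by simp
    define c where "c = \<bar>v \<bullet> (M *v v) - l * (v \<bullet> v)\<bar> + 1"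
    \<comment> \<open>The step along the residual \<open>v\<close> for which the first-order decrease beats the second-order term.\<close>
    define t where "t = - (v \<bullet> v) / c"
    have c: "c > 0" by (simp add: c_def)
    have "0 \<le> 2 * t * (v \<bullet> v) + t\<^sup>2 * (v \<bullet> (M *v v) - l * (v \<bullet> v))" by (rule ineq)
    also have "\<dots> \<le> 2 * t * (v \<bullet> v) + t\<^sup>2 * c"
      by (intro add_left_mono mult_left_mono) (auto simp: c_def)
    also have "\<dots> = - ((v \<bullet> v)\<^sup>2 / c)"
      using c by (simp add: t_def power2_eq_square field_simps)
    finally show False using p c by (simp add: divide_le_0_iff zero_le_divide_iff) 
  qed
  hence "M *v e = l *\<^sub>R e" by (simp add: v_def)
  hence "l \<in> eigenvalues M" using e(1) by (auto simp: eigenvalues_def intro!: exI[of _ e])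
  thus ?thesis using that e l_def by blast
qed

text \<open>For a trace-free matrix the lower bound on the eigenvalues implies the upper one, since the two
  other diagonal entries in a frame containing the eigenvector are larger than \<open>- 1/3\<close>.\<close>

lemma Qphy_iff: "M \<in> Qphy \<longleftrightarrow> M \<in> Qsp \<and> (\<forall>e. norm e = 1 \<longrightarrow> - 1/3 < e \<bullet> (M *v e))"
proof (intro iffI conjI allI impI)
  fix e :: "real^3" assume M: "M \<in> Qphy" and e: "norm e = 1"
  obtain l where "l \<in> eigenvalues M" "\<And>e. norm e = 1 \<Longrightarrow> l \<le> e \<bullet> (M *v e)"
    using quadratic_form_min_eigenvalue M by (auto simp: Qphy_def)
  thus "- 1/3 < e \<bullet> (M *v e)" using M e by (force simp: Qphy_def)
next
  assume M: "M \<in> Qsp \<and> (\<forall>e. norm e = 1 \<longrightarrow> - 1/3 < e \<bullet> (M *v e))"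
  show "M \<in> Qphy"
    unfolding Qphy_def
  proof (intro CollectI conjI ballI)
    show "M \<in> Qsp" using M by simp
    fix l assume l: "l \<in> eigenvalues M"
    obtain e where e: "norm e = 1" "e \<bullet> (M *v e) = l"
      by (rule eigenvalue_unit_vector[OF l])
    show "- 1/3 < l" using M e by auto
    obtain T :: "real^3 \<Rightarrow> real^3" where T: "orthogonal_transformation T" "T (axis 1 1) = e"
      by (rule frame_through[OF e(1)])
    have "(\<Sum>i\<in>UNIV. T (axis i 1) \<bullet> (M *v T (axis i 1))) = 0"
      using trace_frame[OF T(1)] M by (simp add: Qsp_def)
    moreover have "- 1/3 < T (axis i 1) \<bullet> (M *v T (axis i 1))" for i
      using M norm_frame[OF T(1)] by blast
    from this[of 2] this[of 3] calculation show "l < 2/3"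
      using e T by (simp add: sum_3)
  qed
qed (auto simp: Qphy_def)

text \<open>For limits of tensors in \<open>Qphy\<close>. The case of an eigenvalue \<open>2/3\<close> is included: then the quadratic form
  takes the value \<open>- 1/3\<close> on the orthogonal complement of the eigenvector.\<close>

lemma not_Qphy_direction:
  assumes "M \<in> Qsp" "\<And>e. norm e = 1 \<Longrightarrow> - 1/3 \<le> e \<bullet> (M *v e)" "M \<notin> Qphy"
  obtains e where "norm e = 1" "e \<bullet> (M *v e) = - 1/3"
  using assms unfolding Qphy_iff by fastforce

section \<open>Physical tensors are moments of Gibbs densities\<close>

definition psd :: "real^3^3 \<Rightarrow> bool" where
  "psd S \<longleftrightarrow> transpose S = S \<and> (\<forall>x. 0 \<le> x \<bullet> (S *v x))"

lemma psd_symmetric: "psd S \<Longrightarrow> x \<bullet> (S *v y) = y \<bullet> (S *v x)"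
  by (metis dot_lmul_matrix inner_commute psd_def transpose_matrix_vector)

lemma psd_Cauchy_Schwarz:
  assumes S: "psd S"
  shows "(x \<bullet> (S *v v))\<^sup>2 \<le> (x \<bullet> (S *v x)) * (v \<bullet> (S *v v))"
proof -
  define a b c where "a = x \<bullet> (S *v x)" and "b = x \<bullet> (S *v v)" and "c = v \<bullet> (S *v v)"
  have nn: "0 \<le> a" "0 \<le> c" using S by (auto simp: psd_def a_def c_def)
  have "0 \<le> (x + t *\<^sub>R v) \<bullet> (S *v (x + t *\<^sub>R v))" for t
    using S by (simp add: psd_def)
  hence ineq: "0 \<le> a + 2 * t * b + t\<^sup>2 * c" for t
    using psd_symmetric[OF S, of v x]
    by (simp add: a_def b_def c_def matrix_vector_right_distrib matrix_vector_mult_scaleR inner_simps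
        power2_eq_square algebra_simps)
  have "b\<^sup>2 \<le> a * c"
  proof (cases "c = 0")
    case True
    have "b = 0"
    proof (rule ccontr)
      assume "b \<noteq> 0"
      thus False using ineq[of "- (a + 1) / (2 * b)"] True by (simp add: field_simps)
    qed
    thus ?thesis using True by simp
  next
    case False
    hence "0 \<le> (a + 2 * (- b / c) * b + (- b / c)\<^sup>2 * c) * c"
      using ineq[of "- b / c"] nn by simp
    also have "\<dots> = a * c - b\<^sup>2"
      using False by (simp add: field_simps power2_eq_square)
    finally show ?thesis by simp
  qed
  thus ?thesis by (simp add: a_def b_def c_def)
qed

lemma tsq_mult_vec: "tsq w *v x = (w \<bullet> x) *\<^sub>R w"
  by (simp add: vec_eq_iff tsq_def matrix_vector_mult_def inner_vec_def sum_3 algebra_simps)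

text \<open>One step of a Cholesky decomposition: \<open>w = S v / sqrt (v \<bullet> S v)\<close>. The remainder is positive
  semidefinite by the Cauchy-Schwarz inequality for \<open>S\<close>.\<close>

lemma psd_split_rank_one:
  assumes S: "psd S"
  obtains w S' where "psd S'" "S = tsq w + S'" "S' *v v = 0" "\<And>u. S *v u = 0 \<Longrightarrow> S' *v u = 0"
proof -
  define c where "c = v \<bullet> (S *v v)"
  define w where "w = (1 / sqrt c) *\<^sub>R (S *v v)"
  define S' where "S' = S - tsq w"
  have c: "c \<ge> 0" using S by (simp add: c_def psd_def)
  have ww: "(w \<bullet> x) * (w \<bullet> y) = (x \<bullet> (S *v v)) * (y \<bullet> (S *v v)) / c" for x y
    using c by (simp add: w_def inner_commute)
  have "transpose (tsq w) = tsq w"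
    by (simp add: transpose_def tsq_def vec_eq_iff)
  hence sym: "transpose S' = S'"
    using S by (simp add: psd_def S'_def transpose_def vec_eq_iff)
  have pos: "0 \<le> x \<bullet> (S' *v x)" for x
  proof (cases "c = 0")
    case True
    thus ?thesis using S
      by (simp add: S'_def psd_def w_def matrix_vector_mult_diff_rdistrib tsq_mult_vec)
  next
    case False
    thus ?thesis
      using psd_Cauchy_Schwarz[OF S, of x v] c ww[of x x]
      by (simp add: S'_def matrix_vector_mult_diff_rdistrib tsq_mult_vec inner_diff_right c_def[symmetric]
          inner_commute[of x w] power2_eq_square divide_le_eq)
  qed
  have kv: "S' *v v = 0"
  proof (cases "c = 0")
    case True
    have "norm (S *v v) = 0"
      using psd_Cauchy_Schwarz[OF S, of "S *v v" v] True by (simp add: c_def)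
    thus ?thesis by (simp add: S'_def w_def matrix_vector_mult_diff_rdistrib tsq_mult_vec)
  next
    case False
    thus ?thesis using c
      by (simp add: S'_def matrix_vector_mult_diff_rdistrib tsq_mult_vec w_def inner_commute
          flip: c_def)
  qed
  have "S' *v u = 0" if "S *v u = 0" for u
    using that psd_symmetric[OF S, of v u]
    by (simp add: S'_def matrix_vector_mult_diff_rdistrib tsq_mult_vec w_def inner_commute)
  with sym pos kv show ?thesis
    by (intro that[of S' w]) (auto simp: psd_def S'_def)
qed

text \<open>Splitting along the three coordinate axes leaves a matrix that annihilates all of them. The
  decomposition serves to show that a positive semidefinite matrix with vanishing inner product
  with a positive definite one is zero.\<close>

lemma psd_sum_rank_one:
  assumes "psd S"
  obtains w1 w2 w3 where "S = tsq w1 + tsq w2 + tsq w3"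
proof -
  obtain w1 S1 where 1: "psd S1" "S = tsq w1 + S1" "S1 *v axis 1 1 = 0"
    using psd_split_rank_one[OF assms, of "axis 1 1"] by metis
  obtain w2 S2 where 2: "psd S2" "S1 = tsq w2 + S2" "S2 *v axis 2 1 = 0" "\<And>u. S1 *v u = 0 \<Longrightarrow> S2 *v u = 0"
    using psd_split_rank_one[OF 1(1), of "axis 2 1"] by metis
  obtain w3 S3 where 3: "S2 = tsq w3 + S3" "S3 *v axis 3 1 = 0" "\<And>u. S2 *v u = 0 \<Longrightarrow> S3 *v u = 0"
    using psd_split_rank_one[OF 2(1), of "axis 3 1"] by metis
  have "S3 *v axis 1 1 = 0" "S3 *v axis 2 1 = 0"
    using 1 2 3 by auto
  hence "S3 = 0" using 3(2)
    by (auto simp: vec_eq_iff matrix_vector_mult_def axis_def sum_3 forall_3)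
  thus ?thesis using 1 2 3 by (intro that[of w1 w2 w3]) (simp add: add.assoc)
qed

text \<open>Otherwise \<open>S = (B : Q) I - B\<close> would be positive semidefinite, while its inner product with the positive
  definite matrix \<open>Q + I/3\<close> of trace \<open>1\<close> is \<open>0\<close>; so \<open>S = 0\<close>, and a trace-free multiple of \<open>I\<close> is \<open>0\<close>.\<close>

lemma Qphy_strict_direction:
  assumes Q: "Q \<in> Qphy" and B: "B \<in> Qsp" "B \<noteq> 0"
  obtains v where "norm v = 1" "B \<bullet> (tsq v - Q) > 0"
proof (rule ccontr)
  assume "\<not> thesis"
  with that have le: "\<And>v. norm v = 1 \<Longrightarrow> B \<bullet> tsq v \<le> B \<bullet> Q"
    by (metis inner_diff_right diff_gt_0_iff_gt not_less)
  \<comment> \<open>By assumption the quadratic form of \<open>B\<close> is at most \<open>B \<bullet> Q\<close> on the unit sphere.\<close>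
  define S where "S = (B \<bullet> Q) *\<^sub>R mat 1 - B"
  have Q': "Q \<in> Qsp" "\<And>e. norm e = 1 \<Longrightarrow> - 1/3 < e \<bullet> (Q *v e)" using Q by (auto simp: Qphy_iff)
  have S_form: "x \<bullet> (S *v x) = (B \<bullet> Q) * (norm x)\<^sup>2 - x \<bullet> (B *v x)" for x
    by (simp add: S_def matrix_vector_mult_diff_rdistrib scaleR_matrix_vector_assoc[symmetric]
        inner_diff_right power2_norm_eq_inner)
  have "psd S"
    unfolding psd_def
  proof (intro conjI allI)
    show "transpose S = S" using B by (simp add: S_def Qsp_def transpose_def vec_eq_iff mat_def)
    fix x
    show "0 \<le> x \<bullet> (S *v x)"
    proof (cases "x = 0")
      case False
      hence "B \<bullet> tsq (x /\<^sub>R norm x) \<le> B \<bullet> Q" by (intro le) simp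
      thus ?thesis using False
        by (simp add: S_form inner_tsq matrix_vector_mult_scaleR power2_eq_square field_simps)
    qed simp
  qed
  then obtain w1 w2 w3 where w: "S = tsq w1 + tsq w2 + tsq w3"
    by (rule psd_sum_rank_one)
  define P where "P = Q + (1/3) *\<^sub>R mat 1"
  have P_form: "P \<bullet> tsq x \<ge> 0" "P \<bullet> tsq x = 0 \<Longrightarrow> x = 0" for x
  proof -
    have "P \<bullet> tsq x > 0" if "x \<noteq> 0"
    proof -
      have "P \<bullet> tsq x = x \<bullet> (Q *v x) + (norm x)\<^sup>2 / 3"
        by (simp add: P_def inner_add_left inner_mat_1 trace_tsq) (simp add: inner_tsq)
      thus ?thesis using that Q'(2)[of "x /\<^sub>R norm x"]
        by (simp add: matrix_vector_mult_scaleR power2_eq_square field_simps)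
    qed
    moreover have "P \<bullet> tsq 0 = 0" by (simp add: inner_tsq)
    ultimately show "P \<bullet> tsq x \<ge> 0" "P \<bullet> tsq x = 0 \<Longrightarrow> x = 0" by (cases "x = 0"; force)+
  qed
  have "P \<bullet> S = 0"
  proof -
    have "mat 1 \<bullet> (mat 1 :: real^3^3) = 3" by (simp add: inner_mat_1 trace_I)
    thus ?thesis using Qsp_inner_mat_1[OF Q'(1)] Qsp_inner_mat_1[OF B(1)]
      by (simp add: P_def S_def inner_simps inner_commute[of Q B])
  qed
  hence "P \<bullet> tsq w1 + P \<bullet> tsq w2 + P \<bullet> tsq w3 = 0"
    by (simp add: w inner_add_right)
  hence "P \<bullet> tsq w1 = 0" "P \<bullet> tsq w2 = 0" "P \<bullet> tsq w3 = 0"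
    using P_form(1)[of w1] P_form(1)[of w2] P_form(1)[of w3] by auto
  hence "w1 = 0" "w2 = 0" "w3 = 0" using P_form(2) by auto
  hence "S = 0" by (simp add: w tsq_def vec_eq_iff)
  hence "B = (B \<bullet> Q) *\<^sub>R mat 1" by (simp add: S_def)
  moreover have "B \<bullet> Q = 0"
    using B(1) calculation by (metis Qsp_inner_mat_1(2) Q'(1) inner_scaleR_left mult_zero_right)
  ultimately show False using B(2) by simp
qed

lemma continuous_on_integral_S2:
  fixes f :: "'a::euclidean_space \<Rightarrow> real^3 \<Rightarrow> real"
  assumes X: "compact X" and f: "continuous_on (X \<times> sphere 0 1) (\<lambda>(x, v). f x v)"
  shows "continuous_on X (\<lambda>x. \<integral>v. f x v \<partial>S2)"
  unfolding continuous_on_sequentially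
proof (intro ballI allI impI, elim conjE)
  fix x a assume a: "a \<in> X" and x: "\<forall>n. x n \<in> X" "x \<longlonglongrightarrow> a"
  have "bounded ((\<lambda>(x, v). f x v) ` (X \<times> sphere 0 1))"
    by (intro compact_imp_bounded compact_continuous_image f compact_Times X compact_sphere)
  then obtain C where C: "\<And>x v. x \<in> X \<Longrightarrow> norm v = 1 \<Longrightarrow> norm (f x v) \<le> C"
    unfolding bounded_iff by fastforce
  have cont: "continuous_on (sphere 0 1) (f x)" if "x \<in> X" for x
  proof -
    have "continuous_on (sphere 0 1) (\<lambda>v::real^3. (x, v))" by (intro continuous_intros)
    from continuous_on_compose2[OF f this] show ?thesis using that by auto
  qed
  have "(\<lambda>n. \<integral>v. f (x n) v \<partial>S2) \<longlonglongrightarrow> (\<integral>v. f a v \<partial>S2)"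
  proof (rule integral_dominated_convergence[where w="\<lambda>_. C"])
    show "AE v in S2. (\<lambda>n. f (x n) v) \<longlonglongrightarrow> f a v"
    proof (rule AE_I2)
      fix v assume v: "v \<in> space S2"
      have "continuous_on X (\<lambda>x. (x, v))" by (intro continuous_intros)
      moreover have "(\<lambda>x. (x, v)) ` X \<subseteq> X \<times> sphere 0 1"
        using v by (auto simp: space_S2)
      ultimately have "continuous_on X (\<lambda>x. f x v)"
        using continuous_on_compose2[OF f] by force
      thus "(\<lambda>n. f (x n) v) \<longlonglongrightarrow> f a v"
        using a x by (auto simp: continuous_on_sequentially comp_def)
    qed
    show "AE v in S2. norm (f (x n) v) \<le> C" for n
      using C x by (auto intro!: AE_I2 simp: space_S2)
  qed (use cont a x in auto)
  thus "((\<lambda>x. \<integral>v. f x v \<partial>S2) \<circ> x) \<longlonglongrightarrow> (\<integral>v. f a v \<partial>S2)"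
    by (simp add: comp_def)
qed

lemma closed_Qsp: "closed Qsp"
  by (rule closed_subspace[OF subspace_Qsp])

text \<open>The integral is positively homogeneous in \<open>B\<close> and positive for \<open>B \<noteq> 0\<close>; compactness of the unit sphere
  of \<open>Qsp\<close> makes it bounded below.\<close>

lemma linear_coercive:
  assumes Q: "Q \<in> Qphy"
  obtains m where "m > 0" "\<And>B. B \<in> Qsp \<Longrightarrow> m * norm B \<le> (\<integral>v. max 0 (B \<bullet> (tsq v - Q)) \<partial>S2)"
proof -
  define F where "F B = (\<integral>v. max 0 (B \<bullet> (tsq v - Q)) \<partial>S2)" for B
  define X where "X = Qsp \<inter> sphere 0 1"
  have X: "compact X" unfolding X_def by (intro closed_Int_compact closed_Qsp compact_sphere)
  have cont: "continuous_on X F"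
    unfolding F_def
    by (rule continuous_on_integral_S2[OF X])
       (auto simp: case_prod_beta intro!: continuous_intros)
  have pos: "F B > 0" if "B \<in> X" for B
  proof -
    have c: "continuous_on (sphere 0 1) (\<lambda>v. max 0 (B \<bullet> (tsq v - Q)))" 
      by (intro continuous_intros)
    have "F B \<ge> 0" unfolding F_def by (intro Bochner_Integration.integral_nonneg) auto
    moreover have "F B \<noteq> 0"
    proof
      assume "F B = 0"
      obtain v where "norm v = 1" "B \<bullet> (tsq v - Q) > 0"
        using \<open>B \<in> X\<close> by (auto simp: X_def intro: Qphy_strict_direction[OF Q, of B])
      moreover have "max 0 (B \<bullet> (tsq v - Q)) = 0"
        using integral_S2_eq_0_imp[OF c _ _ \<open>norm v = 1\<close>] \<open>F B = 0\<close> by (auto simp: F_def)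
      ultimately show False by simp
    qed
    ultimately show ?thesis by simp
  qed
  have "\<exists>m>0. \<forall>B\<in>X. m \<le> F B"
  proof (cases "X = {}")
    case False
    then obtain B where "B \<in> X" "\<forall>B'\<in>X. F B \<le> F B'"
      using continuous_attains_inf[OF X _ cont] by blast
    thus ?thesis using pos by blast
  qed (auto intro: exI[of _ 1])
  then obtain m where m: "m > 0" "\<And>B. B \<in> X \<Longrightarrow> m \<le> F B" by blast
  show ?thesis
  proof (rule that[OF m(1)])
    fix B assume B: "B \<in> Qsp"
    have "m * norm B \<le> F B"
    proof (cases "B = 0")
      case False
      have "B /\<^sub>R norm B \<in> X"
        using B False subspace_scale[OF subspace_Qsp] by (auto simp: X_def)
      hence "m \<le> F (B /\<^sub>R norm B)" by (rule m)
      also have "F (B /\<^sub>R norm B) = (\<integral>v. max 0 (B \<bullet> (tsq v - Q)) /\<^sub>R norm B \<partial>S2)"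
        unfolding F_def using False
        by (intro Bochner_Integration.integral_cong) (auto simp: max_def zero_le_mult_iff field_simps)
      also have "\<dots> = F B /\<^sub>R norm B" by (simp add: F_def)
      finally show ?thesis using False by (simp add: field_simps)
    qed (simp add: F_def)
    thus "m * norm B \<le> (\<integral>v. max 0 (B \<bullet> (tsq v - Q)) \<partial>S2)" by (simp add: F_def)
  qed
qed

text \<open>This convex function of \<open>B\<close> is the exponential of the dual functional \<open>ln Z(B) - B : Q\<close>, with \<open>Z\<close> the
  partition function. As \<open>exp y \<ge> max 0 y\<close>, the previous lemma shows that it is coercive.\<close>

lemma exponential_moment_minimiser:
  assumes Q: "Q \<in> Qphy"
  obtains B where "B \<in> Qsp"
    "\<And>B'. B' \<in> Qsp \<Longrightarrow> (\<integral>v. exp (B \<bullet> (tsq v - Q)) \<partial>S2) \<le> (\<integral>v. exp (B' \<bullet> (tsq v - Q)) \<partial>S2)"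
proof -
  define K where "K B = (\<integral>v. exp (B \<bullet> (tsq v - Q)) \<partial>S2)" for B
  obtain m where m: "m > 0" "\<And>B. B \<in> Qsp \<Longrightarrow> m * norm B \<le> (\<integral>v. max 0 (B \<bullet> (tsq v - Q)) \<partial>S2)"
    using linear_coercive[OF Q] by blast
  have K: "m * norm B \<le> K B" if "B \<in> Qsp" for B
    unfolding K_def
  proof (rule order_trans[OF m(2)[OF that]], rule integral_mono)
    fix v :: "real^3"
    show "max 0 (B \<bullet> (tsq v - Q)) \<le> exp (B \<bullet> (tsq v - Q))"
      using exp_ge_add_one_self[of "B \<bullet> (tsq v - Q)"] exp_ge_zero[of "B \<bullet> (tsq v - Q)"]
      unfolding max.bounded_iff by linarith
  qed (auto intro!: continuous_intros)
  \<comment> \<open>Beyond this radius coercivity makes the value larger than at \<open>0\<close>.\<close>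
  define R where "R = K 0 / m"
  have K0: "K 0 \<ge> 0" unfolding K_def by (intro Bochner_Integration.integral_nonneg) auto
  define X where "X = Qsp \<inter> cball 0 R"
  have X: "compact X" unfolding X_def by (intro closed_Int_compact closed_Qsp compact_cball)
  have "0 \<in> X" using K0 m(1) by (simp add: X_def R_def)
  moreover have "continuous_on X K"
    unfolding K_def
    by (rule continuous_on_integral_S2[OF X])
       (auto simp: case_prod_beta intro!: continuous_intros)
  ultimately obtain B where B: "B \<in> X" "\<And>B'. B' \<in> X \<Longrightarrow> K B \<le> K B'"
    using continuous_attains_inf[OF X] by blast
  show ?thesis
  proof (rule that[of B])
    show "B \<in> Qsp" using B by (simp add: X_def)
    fix B' assume B': "B' \<in> Qsp"
    have "K B \<le> K B'"
    proof (cases "B' \<in> X")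
      case False
      hence "R < norm B'" using B' by (simp add: X_def)
      hence "K 0 < m * norm B'" using m(1) by (simp add: R_def field_simps)
      thus ?thesis using K[OF B'] B(2)[OF \<open>0 \<in> X\<close>] by simp
    qed (rule B)
    thus "(\<integral>v. exp (B \<bullet> (tsq v - Q)) \<partial>S2) \<le> (\<integral>v. exp (B' \<bullet> (tsq v - Q)) \<partial>S2)"
      by (simp add: K_def)
  qed
qed

lemma exp_le_quadratic: "\<bar>x\<bar> \<le> 1 \<Longrightarrow> exp x \<le> 1 + x + x\<^sup>2" for x :: real
proof (cases "x \<ge> 0")
  case False
  assume x: "\<bar>x\<bar> \<le> 1"
  have "x ^ 3 \<le> 0" using False by (simp add: power_le_zero_eq)
  moreover have "(1 + x + x\<^sup>2) * (1 - x) = 1 - x ^ 3" by (simp add: power2_eq_square power3_eq_cube algebra_simps)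
  ultimately have "1 \<le> (1 + x + x\<^sup>2) * (1 - x)" by simp
  also have "\<dots> \<le> (1 + x + x\<^sup>2) * exp (- x)"
    using exp_ge_add_one_self[of "-x"] x by (intro mult_left_mono) auto
  finally show ?thesis by (simp add: exp_minus field_simps)
qed (simp add: exp_bound)

lemma first_order_condition:
  fixes a b \<tau> :: real
  assumes "\<tau> > 0" "\<And>t. \<bar>t\<bar> \<le> \<tau> \<Longrightarrow> 0 \<le> t * a + t\<^sup>2 * b"
  shows "a = 0"
proof (rule ccontr)
  assume a: "a \<noteq> 0"
  define c where "c = \<bar>a\<bar> / \<tau> + \<bar>b\<bar> + 1"
  have c: "c > 0" "c \<ge> \<bar>a\<bar> / \<tau>" "b \<le> c - 1" 
  proof -
    have "0 \<le> \<bar>a\<bar> / \<tau>" using assms(1) by simp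
    thus "c > 0" "c \<ge> \<bar>a\<bar> / \<tau>" "b \<le> c - 1" by (auto simp: c_def)
  qed
  have "\<bar>- a / c\<bar> \<le> \<tau>" using c assms(1) by (simp add: abs_divide field_simps)
  hence "0 \<le> (- a / c) * a + (- a / c)\<^sup>2 * b" by (rule assms)
  also have "\<dots> \<le> (- a / c) * a + (- a / c)\<^sup>2 * (c - 1)"
    using c by (intro add_left_mono mult_left_mono) auto
  also have "\<dots> = - (a / c)\<^sup>2"
    using c by (simp add: field_simps power2_eq_square)
  finally show False using a c by (simp add: field_simps)
qed

text \<open>First variation in the direction \<open>H\<close>, with the elementary bound \<open>exp y \<le> 1 + y + y\<^sup>2\<close> in place of a
  derivative of the integral.\<close>

lemma exponential_moment_critical:
  assumes min: "\<And>B'. B' \<in> Qsp \<Longrightarrow> (\<integral>v. exp (B \<bullet> (tsq v - Q)) \<partial>S2) \<le> (\<integral>v. exp (B' \<bullet> (tsq v - Q)) \<partial>S2)"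
    and B: "B \<in> Qsp" and H: "H \<in> Qsp"
  shows "(\<integral>v. exp (B \<bullet> (tsq v - Q)) * (H \<bullet> (tsq v - Q)) \<partial>S2) = 0"
proof -
  define w where "w v = exp (B \<bullet> (tsq v - Q))" for v
  define y where "y v = H \<bullet> (tsq v - Q)" for v
  have cont [continuous_intros]: "continuous_on S w" "continuous_on S y" for S
    unfolding w_def y_def by (intro continuous_intros)+
  define C where "C = norm H * (1 + norm Q) + 1"
  have C: "C > 0" by (auto simp: C_def intro!: add_nonneg_pos mult_nonneg_nonneg)
  have y: "\<bar>y v\<bar> \<le> C" if "norm v = 1" for v
  proof -
    have "\<bar>y v\<bar> \<le> norm H * norm (tsq v - Q)" unfolding y_def by (rule Cauchy_Schwarz_ineq2)
    also have "\<dots> \<le> norm H * (1 + norm Q)"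
      using norm_triangle_ineq4[of "tsq v" Q] that by (intro mult_left_mono) (auto simp: norm_tsq)
    finally show ?thesis by (simp add: C_def)
  qed
  define a b where "a = (\<integral>v. w v * y v \<partial>S2)" and "b = (\<integral>v. w v * (y v)\<^sup>2 \<partial>S2)"
  have "0 \<le> t * a + t\<^sup>2 * b" if t: "\<bar>t\<bar> \<le> 1 / C" for t
  proof -
    have ty: "\<bar>t * y v\<bar> \<le> 1" if "norm v = 1" for v
      using mult_mono[OF t y[OF that]] C by (simp add: abs_mult)
    have "(\<integral>v. w v \<partial>S2) \<le> (\<integral>v. exp ((B + t *\<^sub>R H) \<bullet> (tsq v - Q)) \<partial>S2)"
      unfolding w_def using B H subspace_Qsp by (intro min) (auto simp: subspace_add subspace_scale)
    also have "\<dots> = (\<integral>v. w v * exp (t * y v) \<partial>S2)"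
      by (simp add: w_def y_def inner_add_left exp_add)
    also have "\<dots> \<le> (\<integral>v. w v + (t * (w v * y v) + t\<^sup>2 * (w v * (y v)\<^sup>2)) \<partial>S2)"
    proof (rule integral_mono)
      fix v assume "v \<in> space S2"
      hence "w v * exp (t * y v) \<le> w v * (1 + t * y v + (t * y v)\<^sup>2)"
        using ty by (intro mult_left_mono exp_le_quadratic) (auto simp: space_S2 w_def)
      thus "w v * exp (t * y v) \<le> w v + (t * (w v * y v) + t\<^sup>2 * (w v * (y v)\<^sup>2))"
        by (simp add: power_mult_distrib algebra_simps)
    qed (auto intro!: continuous_intros)
    also have "\<dots> = (\<integral>v. w v \<partial>S2) + (t * a + t\<^sup>2 * b)"
      unfolding a_def b_def
      by (subst Bochner_Integration.integral_add Bochner_Integration.integral_mult_right_zero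
          | (auto intro!: continuous_intros; fail))+
    finally show ?thesis by simp
  qed
  hence "a = 0" using first_order_condition[of "1 / C" a b] C by simp
  thus ?thesis by (simp add: a_def w_def y_def)
qed

definition partition_fn :: "real^3^3 \<Rightarrow> real" where
  "partition_fn B = (\<integral>v. exp (B \<bullet> tsq v) \<partial>S2)"

definition gibbs :: "real^3^3 \<Rightarrow> real^3 \<Rightarrow> real" where
  "gibbs B v = exp (B \<bullet> tsq v) / partition_fn B"

text \<open>The tensor of the Gibbs density with multiplier \<open>B\<close>, which satisfies the moment constraint in the
  definition of the potential.\<close>

definition gibbs_moment :: "real^3^3 \<Rightarrow> real^3^3" where
  "gibbs_moment B = (\<integral>v. gibbs B v *\<^sub>R (tsq v - (1/3) *\<^sub>R mat 1) \<partial>S2)"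

lemma partition_fn_pos: "partition_fn B > 0"
proof -
  have c: "continuous_on (sphere 0 1) (\<lambda>v. exp (B \<bullet> tsq v))" by (intro continuous_intros)
  have "partition_fn B \<ge> 0"
    unfolding partition_fn_def by (intro Bochner_Integration.integral_nonneg) auto
  moreover have "partition_fn B \<noteq> 0"
    using integral_S2_eq_0_imp[OF c, of "axis 1 1"] by (auto simp: partition_fn_def)
  ultimately show ?thesis by simp
qed

lemma gibbs_pos: "gibbs B v > 0"
  by (simp add: gibbs_def partition_fn_pos)

lemma continuous_on_gibbs [continuous_intros]:
  "continuous_on S f \<Longrightarrow> continuous_on S (\<lambda>x. gibbs B (f x))"
  unfolding gibbs_def using partition_fn_pos[of B] by (intro continuous_intros) auto

lemma integral_gibbs: "(\<integral>v. gibbs B v \<partial>S2) = 1"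
  using partition_fn_pos[of B] unfolding gibbs_def
  by (simp flip: partition_fn_def)

lemma integral_in_Qsp:
  assumes "integrable M g" "AE x in M. g x \<in> Qsp"
  shows "(\<integral>x. g x \<partial>M) \<in> Qsp"
proof -
  define L where "L M = (trace M, transpose M - M)" for M :: "real^3^3"
  have "linear L"
    by (rule linearI) (auto simp: L_def trace_def transpose_def vec_eq_iff sum.distrib
        sum_distrib_left algebra_simps)
  hence bl: "bounded_linear L" by (simp add: linear_conv_bounded_linear)
  have "(\<integral>x. L (g x) \<partial>M) = L (\<integral>x. g x \<partial>M)"
    by (rule integral_bounded_linear[OF bl assms(1)])
  moreover have "(\<integral>x. L (g x) \<partial>M) = 0"
    using assms(2) by (intro integral_eq_zero_AE) (auto elim!: eventually_mono simp: L_def Qsp_def zero_prod_def)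
  ultimately show ?thesis by (simp add: L_def Qsp_def zero_prod_def)
qed

lemma integral_S2_Qsp:
  assumes "continuous_on (sphere 0 1) g" "\<And>v. norm v = 1 \<Longrightarrow> g v \<in> Qsp"
  shows "(\<integral>v. g v \<partial>S2) \<in> Qsp"
  using assms by (intro integral_in_Qsp continuous_integrable_S2 AE_I2) (auto simp: space_S2)

lemma gibbs_moment_Qsp: "gibbs_moment B \<in> Qsp"
  unfolding gibbs_moment_def
  by (intro integral_S2_Qsp continuous_intros subspace_scale[OF subspace_Qsp] tsq_Qsp)

lemma inner_gibbs_moment:
  "H \<bullet> gibbs_moment B = (\<integral>v. gibbs B v * (H \<bullet> (tsq v - (1/3) *\<^sub>R mat 1)) \<partial>S2)"
  unfolding gibbs_moment_def
  by (subst integral_inner_right[symmetric]) (auto intro!: continuous_intros)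

lemma inner_deviator: "H \<in> Qsp \<Longrightarrow> H \<bullet> (tsq v - (1/3) *\<^sub>R mat 1) = H \<bullet> tsq v"
  by (simp add: inner_diff_right Qsp_inner_mat_1)

lemma integral_gibbs_centered:
  assumes "H \<in> Qsp"
  shows "(\<integral>v. gibbs B v * (H \<bullet> (tsq v - gibbs_moment B)) \<partial>S2) = 0"
proof -
  have "(\<integral>v. gibbs B v * (H \<bullet> (tsq v - gibbs_moment B)) \<partial>S2)
     = (\<integral>v. gibbs B v * (H \<bullet> tsq v) - gibbs B v * (H \<bullet> gibbs_moment B) \<partial>S2)"
    by (simp add: inner_diff_right right_diff_distrib)
  also have "\<dots> = (\<integral>v. gibbs B v * (H \<bullet> tsq v) \<partial>S2) - (\<integral>v. gibbs B v * (H \<bullet> gibbs_moment B) \<partial>S2)"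
    by (intro Bochner_Integration.integral_diff) (auto intro!: continuous_intros)
  also have "\<dots> = 0"
    using inner_gibbs_moment[of H B] assms by (simp add: inner_deviator integral_gibbs)
  finally show ?thesis .
qed

text \<open>The criticality condition, divided by the partition function, says that the Gibbs density of the
  minimiser has the moment \<open>Q\<close>.\<close>

lemma gibbs_moment_surj:
  assumes Q: "Q \<in> Qphy"
  obtains B where "B \<in> Qsp" "gibbs_moment B = Q"
proof -
  obtain B where B: "B \<in> Qsp"
    "\<And>B'. B' \<in> Qsp \<Longrightarrow> (\<integral>v. exp (B \<bullet> (tsq v - Q)) \<partial>S2) \<le> (\<integral>v. exp (B' \<bullet> (tsq v - Q)) \<partial>S2)"
    using exponential_moment_minimiser[OF Q] by metis
  have QQ: "Q \<in> Qsp" using Q by (simp add: Qphy_iff)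
  have "H \<bullet> (gibbs_moment B - Q) = 0" if H: "H \<in> Qsp" for H
  proof -
    define c where "c = partition_fn B * exp (- (B \<bullet> Q))"
    have c: "c \<noteq> 0" using partition_fn_pos[of B] by (simp add: c_def)
    have "exp (B \<bullet> (tsq v - Q)) = c * gibbs B v" for v
      using partition_fn_pos[of B]
      by (simp add: c_def gibbs_def inner_diff_right exp_diff exp_minus field_simps)
    hence "c * (\<integral>v. gibbs B v * (H \<bullet> (tsq v - Q)) \<partial>S2) = 0"
      using exponential_moment_critical[OF B(2) B(1) H]
      by (simp add: mult.assoc)
    hence "0 = (\<integral>v. gibbs B v * (H \<bullet> (tsq v - Q)) \<partial>S2)"
      using c by simp
    also have "\<dots> = (\<integral>v. gibbs B v * (H \<bullet> tsq v) - gibbs B v * (H \<bullet> Q) \<partial>S2)"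
      by (simp add: inner_diff_right right_diff_distrib)
    also have "\<dots> = (\<integral>v. gibbs B v * (H \<bullet> tsq v) \<partial>S2) - (\<integral>v. gibbs B v * (H \<bullet> Q) \<partial>S2)"
      by (intro Bochner_Integration.integral_diff) (auto intro!: continuous_intros)
    also have "\<dots> = H \<bullet> (gibbs_moment B - Q)"
      using inner_gibbs_moment[of H B] H
      by (simp add: inner_deviator integral_gibbs inner_diff_right[of H "gibbs_moment B"])
    finally show ?thesis by simp
  qed
  from this[of "gibbs_moment B - Q"] have "gibbs_moment B = Q"
    using gibbs_moment_Qsp QQ subspace_diff[OF subspace_Qsp] by simp
  thus ?thesis using that B(1) by blast
qed

section \<open>The gradient of the singular potential\<close>

lemma ereal_integral_eq_integral:
  assumes "integrable M g"
  shows "ereal_integral M (\<lambda>x. ereal (g x)) = ereal (\<integral>x. g x \<partial>M)"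
proof -
  have fin: "enn2ereal x = ereal (enn2real x)" if "x \<noteq> \<infinity>" for x
    using that by (cases x) (auto simp: enn2ereal_ennreal)
  have "enn2ereal (\<integral>\<^sup>+ x. ennreal (g x) \<partial>M) = ereal (enn2real (\<integral>\<^sup>+ x. ennreal (g x) \<partial>M))"
    "enn2ereal (\<integral>\<^sup>+ x. ennreal (- g x) \<partial>M) = ereal (enn2real (\<integral>\<^sup>+ x. ennreal (- g x) \<partial>M))"
    using real_integrable_def[of M g] assms by (auto intro!: fin)
  thus ?thesis
    using assms by (simp add: ereal_integral_def e2ennreal_ereal real_lebesgue_integral_def)
qed

text \<open>The integrand \<open>\<rho> ln \<rho>\<close> is bounded below, so that its integral exists in the extended sense.\<close>

lemma entropy_cases:
  assumes \<rho>: "\<rho> \<in> borel_measurable S2" "\<And>v. norm v = 1 \<Longrightarrow> 0 \<le> \<rho> v"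
  shows "integrable S2 (\<lambda>v. \<rho> v * ln (\<rho> v)) \<or> entropy \<rho> = \<infinity>"
proof -
  define g where "g v = \<rho> v * ln (\<rho> v)" for v
  have g: "g \<in> borel_measurable S2" using \<rho>(1) by (simp add: g_def[abs_def])
  have low: "- g v \<le> 1" if "norm v = 1" for v
  proof (cases "\<rho> v = 0")
    case False
    hence p: "\<rho> v > 0" using \<rho>(2)[OF that] by simp
    have "ln (1 / \<rho> v) \<le> 1 / \<rho> v - 1" using p by (intro ln_le_minus_one) simp
    hence "- g v \<le> \<rho> v * (1 / \<rho> v - 1)"
      using p mult_left_mono[of "- ln (\<rho> v)" "1 / \<rho> v - 1" "\<rho> v"] by (simp add: g_def ln_div)
    also have "\<dots> \<le> 1" using p by (simp add: algebra_simps)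
    finally show ?thesis .
  qed (simp add: g_def)
  have "(\<integral>\<^sup>+ v. ennreal (- g v) \<partial>S2) \<le> (\<integral>\<^sup>+ v. ennreal 1 \<partial>S2)"
    using low by (intro nn_integral_mono ennreal_leI) (auto simp: space_S2)
  also have "\<dots> < \<infinity>" using finite_measure.emeasure_finite[OF finite_measure_S2, of "space S2"]
    by (metis ennreal_1 infinity_ennreal_def mult_1 nn_integral_const top.not_eq_extremum)
  finally have neg: "(\<integral>\<^sup>+ v. ennreal (- g v) \<partial>S2) < \<infinity>" .
  show ?thesis
  proof (cases "(\<integral>\<^sup>+ v. ennreal (g v) \<partial>S2) < \<infinity>")
    case True
    thus ?thesis using neg g by (simp add: real_integrable_def g_def[symmetric] less_top)
  next
    case False
    hence "(\<integral>\<^sup>+ v. ennreal (g v) \<partial>S2) = \<infinity>"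
      by (metis infinity_ennreal_def top.not_eq_extremum)
    moreover have "enn2ereal (\<integral>\<^sup>+ v. ennreal (- g v) \<partial>S2) \<noteq> \<infinity>"
      using neg by (simp add: enn2ereal_eq_top_iff less_top)
    ultimately show ?thesis
      by (simp add: entropy_def ereal_integral_def g_def e2ennreal_ereal)
  qed
qed

lemma integrable_scaleR_continuous:
  fixes \<rho> :: "real^3 \<Rightarrow> real" and h :: "real^3 \<Rightarrow> 'b::euclidean_space"
  assumes "integrable S2 \<rho>" "continuous_on (sphere 0 1) h"
  shows "integrable S2 (\<lambda>v. \<rho> v *\<^sub>R h v)"
proof -
  have "bounded (h ` sphere 0 1)"
    by (intro compact_imp_bounded compact_continuous_image assms compact_sphere)
  then obtain C where C: "\<And>x. norm x = 1 \<Longrightarrow> norm (h x) \<le> C"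
    unfolding bounded_iff by (metis imageI mem_sphere_0)
  show ?thesis
  proof (rule Bochner_Integration.integrable_bound)
    show "integrable S2 (\<lambda>v. C * \<bar>\<rho> v\<bar>)" using assms by auto
    show "(\<lambda>v. \<rho> v *\<^sub>R h v) \<in> borel_measurable S2"
      by (rule borel_measurable_scaleR[OF borel_measurable_integrable[OF assms(1)]
            continuous_borel_measurable_S2[OF assms(2)]])
    show "AE v in S2. norm (\<rho> v *\<^sub>R h v) \<le> norm (C * \<bar>\<rho> v\<bar>)"
    proof (rule AE_I2)
      fix v assume "v \<in> space S2"
      hence "norm (h v) \<le> C" using C by (simp add: space_S2)
      hence "norm (h v) \<le> \<bar>C\<bar>" by simp
      thus "norm (\<rho> v *\<^sub>R h v) \<le> norm (C * \<bar>\<rho> v\<bar>)"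
        by (simp add: abs_mult mult.commute[of "\<bar>C\<bar>"] mult_left_mono)
    qed
  qed
qed

text \<open>Gibbs' inequality, by integration of \<open>x ln x - x ln y \<ge> x - y\<close> with \<open>y\<close> the Gibbs density.\<close>

lemma entropy_ge:
  assumes \<rho>: "\<rho> \<in> admissible P" and B: "B \<in> Qsp"
  shows "ereal (B \<bullet> P - ln (partition_fn B)) \<le> entropy \<rho>"
proof -
  have r: "\<rho> \<in> borel_measurable S2" "\<And>v. norm v = 1 \<Longrightarrow> 0 \<le> \<rho> v" "integrable S2 \<rho>"
    "(\<integral>v. \<rho> v \<partial>S2) = 1" "(\<integral>v. \<rho> v *\<^sub>R (tsq v - (1/3) *\<^sub>R mat 1) \<partial>S2) = P"
    using \<rho> by (auto simp: admissible_def tsq_def)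
  show ?thesis
  proof (cases "entropy \<rho> = \<infinity>")
    case False
    hence int: "integrable S2 (\<lambda>v. \<rho> v * ln (\<rho> v))" using entropy_cases[OF r(1,2)] by blast
    have intv: "integrable S2 (\<lambda>v. \<rho> v *\<^sub>R (tsq v - (1/3) *\<^sub>R mat 1))"
      using r(3) by (intro integrable_scaleR_continuous continuous_intros)
    have intB: "integrable S2 (\<lambda>v. \<rho> v * (B \<bullet> tsq v))"
    proof -
      have "continuous_on (sphere 0 1) (\<lambda>v. B \<bullet> tsq v)" by (intro continuous_intros)
      from integrable_scaleR_continuous[OF r(3) this] show ?thesis by simp
    qed
    have BP: "(\<integral>v. \<rho> v * (B \<bullet> tsq v) \<partial>S2) = B \<bullet> P"
    proof -
      have "B \<bullet> P = (\<integral>v. B \<bullet> (\<rho> v *\<^sub>R (tsq v - (1/3) *\<^sub>R mat 1)) \<partial>S2)"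
        unfolding r(5)[symmetric] using intv by (subst integral_inner_right) auto
      thus ?thesis using B by (simp add: inner_deviator)
    qed
    have ig: "integrable S2 (gibbs B)" by (intro continuous_integrable_S2 continuous_intros)
    have i1: "integrable S2 (\<lambda>v. ln (partition_fn B) * \<rho> v)" using r(3) by auto
    note iU = Bochner_Integration.integrable_diff[OF Bochner_Integration.integrable_add[OF
          Bochner_Integration.integrable_diff[OF intB i1] r(3)] ig]
    have "(\<integral>v. \<rho> v * (B \<bullet> tsq v) - ln (partition_fn B) * \<rho> v + \<rho> v - gibbs B v \<partial>S2)
        \<le> (\<integral>v. \<rho> v * ln (\<rho> v) \<partial>S2)"
    proof (rule integral_mono)
      fix v assume "v \<in> space S2"
      hence "\<rho> v \<ge> 0" using r(2) by (simp add: space_S2)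
      have ln_g: "ln (gibbs B v) = B \<bullet> tsq v - ln (partition_fn B)"
        using partition_fn_pos[of B] by (simp add: gibbs_def ln_div)
      have "\<rho> v * ln (gibbs B v) + \<rho> v - gibbs B v \<le> \<rho> v * ln (\<rho> v)"
      proof (cases "\<rho> v = 0")
        case False
        hence p: "\<rho> v > 0" using \<open>\<rho> v \<ge> 0\<close> by simp
        have "ln (gibbs B v / \<rho> v) \<le> gibbs B v / \<rho> v - 1"
          using p gibbs_pos[of B v] by (intro ln_le_minus_one) simp
        hence "\<rho> v * (ln (gibbs B v) - ln (\<rho> v)) \<le> \<rho> v * (gibbs B v / \<rho> v - 1)"
          using p gibbs_pos[of B v] by (simp add: ln_div)
        thus ?thesis using p by (simp add: algebra_simps)
      qed (use gibbs_pos[of B v] in simp)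
      thus "\<rho> v * (B \<bullet> tsq v) - ln (partition_fn B) * \<rho> v + \<rho> v - gibbs B v \<le> \<rho> v * ln (\<rho> v)"
        by (simp add: ln_g algebra_simps)
    qed (fact iU int)+
    also have "(\<integral>v. \<rho> v * (B \<bullet> tsq v) - ln (partition_fn B) * \<rho> v + \<rho> v - gibbs B v \<partial>S2)
       = B \<bullet> P - ln (partition_fn B)"
      unfolding Bochner_Integration.integral_diff[OF Bochner_Integration.integrable_add[OF
          Bochner_Integration.integrable_diff[OF intB i1] r(3)] ig]
        Bochner_Integration.integral_add[OF Bochner_Integration.integrable_diff[OF intB i1] r(3)]
        Bochner_Integration.integral_diff[OF intB i1]
      by (simp add: BP r(4) integral_gibbs)
    finally show ?thesis
      using ereal_integral_eq_integral[OF int] by (simp add: entropy_def)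
  qed simp
qed

lemma norm_tsq_diff_le: "norm v = 1 \<Longrightarrow> norm (tsq v - Q) \<le> 1 + norm Q"
  using norm_triangle_ineq4[of "tsq v" Q] by (simp add: norm_tsq)

text \<open>The derivative of the moment when the Gibbs density is tilted by the factor
  \<open>1 + C : (n n - Q)\<close>.\<close>

definition gibbs_covariance :: "real^3^3 \<Rightarrow> real^3^3 \<Rightarrow> real^3^3" where
  "gibbs_covariance B C =
     (\<integral>v. (gibbs B v * (C \<bullet> (tsq v - gibbs_moment B))) *\<^sub>R (tsq v - (1/3) *\<^sub>R mat 1) \<partial>S2)"

lemma gibbs_covariance_Qsp: "gibbs_covariance B C \<in> Qsp"
  unfolding gibbs_covariance_def
  by (intro integral_S2_Qsp continuous_intros subspace_scale[OF subspace_Qsp] tsq_Qsp)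

lemma linear_gibbs_covariance: "linear (gibbs_covariance B)"
proof (rule linearI)
  fix C D :: "real^3^3" and c :: real
  show "gibbs_covariance B (C + D) = gibbs_covariance B C + gibbs_covariance B D"
    unfolding gibbs_covariance_def
    by (subst Bochner_Integration.integral_add[symmetric])
       (auto intro!: continuous_intros Bochner_Integration.integral_cong
         simp: inner_add_left distrib_left scaleR_add_left)
  show "gibbs_covariance B (c *\<^sub>R C) = c *\<^sub>R gibbs_covariance B C"
    unfolding gibbs_covariance_def
    by (subst Bochner_Integration.integral_scaleR_right[symmetric])
       (auto intro!: Bochner_Integration.integral_cong)
qed

lemma inner_gibbs_covariance:
  assumes "C \<in> Qsp"
  shows "C \<bullet> gibbs_covariance B C = (\<integral>v. gibbs B v * (C \<bullet> (tsq v - gibbs_moment B))\<^sup>2 \<partial>S2)"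
proof -
  define y where "y v = C \<bullet> (tsq v - gibbs_moment B)" for v
  define k where "k = C \<bullet> gibbs_moment B"
  have y: "continuous_on S y" for S unfolding y_def by (intro continuous_intros)
  have "C \<bullet> gibbs_covariance B C = (\<integral>v. C \<bullet> ((gibbs B v * y v) *\<^sub>R (tsq v - (1/3) *\<^sub>R mat 1)) \<partial>S2)"
    unfolding gibbs_covariance_def y_def
    by (subst integral_inner_right[symmetric]) (auto intro!: continuous_intros)
  also have "\<dots> = (\<integral>v. gibbs B v * (y v)\<^sup>2 + k * (gibbs B v * y v) \<partial>S2)"
    by (intro Bochner_Integration.integral_cong refl)
       (simp add: Qsp_inner_mat_1[OF assms] y_def k_def inner_diff_right power2_eq_square algebra_simps)
  also have "\<dots> = (\<integral>v. gibbs B v * (y v)\<^sup>2 \<partial>S2) + k * (\<integral>v. gibbs B v * y v \<partial>S2)"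
    by (subst Bochner_Integration.integral_add) (auto intro!: continuous_intros y)
  finally show ?thesis
    using integral_gibbs_centered[OF assms, of B] by (simp add: y_def)
qed

text \<open>The covariance form of \<open>C\<close> is the variance of \<open>C : n n\<close>. If it vanishes then the quadratic form of \<open>C\<close> is
  constant on the sphere, hence zero for a trace-free matrix.\<close>

lemma gibbs_covariance_inj:
  assumes C: "C \<in> Qsp" and 0: "gibbs_covariance B C = 0"
  shows "C = 0"
proof -
  define k where "k = C \<bullet> gibbs_moment B"
  have c: "continuous_on (sphere 0 1) (\<lambda>v. gibbs B v * (C \<bullet> (tsq v - gibbs_moment B))\<^sup>2)"
    by (intro continuous_intros)
  have zero: "gibbs B v * (C \<bullet> (tsq v - gibbs_moment B))\<^sup>2 = 0" if "norm v = 1" for v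
    using inner_gibbs_covariance[OF C, of B] 0 that gibbs_pos[of B]
    by (intro integral_S2_eq_0_imp[OF c]) (auto simp: less_imp_le)
  hence eq: "v \<bullet> (C *v v) = k" if "norm v = 1" for v
    using zero[OF that] gibbs_pos[of B v] by (simp add: inner_diff_right k_def flip: inner_tsq)
  \<comment> \<open>The constant \<open>k\<close> vanishes because its triple is the trace; polarisation then gives \<open>C = 0\<close>.\<close>
  have form: "v \<bullet> (C *v v) = k * (norm v)\<^sup>2" for v
  proof (cases "v = 0")
    case False
    thus ?thesis using eq[of "v /\<^sub>R norm v"]
      by (simp add: matrix_vector_mult_scaleR power2_eq_square field_simps)
  qed simp
  have "3 * k = 0"
    using trace_frame[of "\<lambda>x. x" C] eq C
    by (simp add: Qsp_def sum_3)
  hence "v \<bullet> (C *v v) = 0" for v using form by simp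
  hence "(x + y) \<bullet> (C *v (x + y)) = 0" "x \<bullet> (C *v x) = 0" "y \<bullet> (C *v y) = 0" for x y by auto
  hence "x \<bullet> (C *v y) + y \<bullet> (C *v x) = 0" for x y
    by (simp add: matrix_vector_right_distrib inner_add_left inner_add_right)
  moreover have "x \<bullet> (C *v y) = y \<bullet> (C *v x)" for x y
    using Qsp_symmetric[OF C, of x y] by (simp add: inner_commute)
  ultimately have "x \<bullet> (C *v y) = 0" for x y by (metis mult_2 mult_eq_0_iff zero_neq_numeral)
  hence "C *v y = 0" for y using inner_eq_zero_iff by blast
  thus "C = 0" by (metis matrix_eq matrix_vector_mult_0)
qed

lemma gibbs_covariance_inverse:
  obtains k where "k > 0"
    "\<And>D. D \<in> Qsp \<Longrightarrow> \<exists>C\<in>Qsp. gibbs_covariance B C = D \<and> k * norm C \<le> norm D"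
proof -
  let ?L = "gibbs_covariance B"
  have "inj_on ?L (span Qsp)"
    unfolding span_eq_iff[THEN iffD2, OF subspace_Qsp]
    using linear_injective_on_subspace_0[OF linear_gibbs_covariance subspace_Qsp] gibbs_covariance_inj
    by blast
  hence "dim (?L ` Qsp) = dim Qsp"
    by (intro dim_image_eq[OF linear_gibbs_covariance])
  hence surj: "?L ` Qsp = Qsp"
    using linear_subspace_image[OF linear_gibbs_covariance subspace_Qsp]
    by (intro subspace_dim_equal subspace_Qsp) (auto simp: gibbs_covariance_Qsp)
  obtain k where "k > 0" "\<And>C. C \<in> Qsp \<Longrightarrow> k * norm C \<le> norm (?L C)"
    using injective_imp_isometric[OF closed_Qsp subspace_Qsp, of ?L] gibbs_covariance_inj
      linear_gibbs_covariance by (auto simp: linear_conv_bounded_linear)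
  thus ?thesis using that surj by (metis imageE)
qed

text \<open>Tilting moves the moment by the covariance. With \<open>ln (1 + y) \<le> y\<close> the entropy changes to first
  order by the inner product with \<open>B\<close>, up to the mean of \<open>y\<^sup>2\<close>.\<close>

lemma tilted_gibbs:
  assumes B: "B \<in> Qsp" and C: "C \<in> Qsp" and small: "norm C * (1 + norm (gibbs_moment B)) \<le> 1"
  defines "P \<equiv> gibbs_moment B + gibbs_covariance B C"
  obtains \<rho> where "\<rho> \<in> admissible P"
    "entropy \<rho> \<le> ereal (B \<bullet> P - ln (partition_fn B) + (norm C * (1 + norm (gibbs_moment B)))\<^sup>2)"
proof -
  define y where "y v = C \<bullet> (tsq v - gibbs_moment B)" for v
  \<comment> \<open>The smallness assumption says \<open>|y| \<le> 1\<close> on the sphere, which keeps \<open>\<rho>\<close> nonnegative.\<close>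
  define \<rho> where "\<rho> v = gibbs B v * (1 + y v)" for v
  define m where "m = norm C * (1 + norm (gibbs_moment B))"
  have ycont [continuous_intros]: "continuous_on S y" for S unfolding y_def by (intro continuous_intros)
  have rcont [continuous_intros]: "continuous_on S \<rho>" for S unfolding \<rho>_def by (intro continuous_intros)
  have y: "\<bar>y v\<bar> \<le> m" if "norm v = 1" for v
    unfolding y_def m_def using norm_tsq_diff_le[OF that]
    by (intro order_trans[OF Cauchy_Schwarz_ineq2] mult_left_mono) auto
  have r0: "0 \<le> \<rho> v" if "norm v = 1" for v
    using y[OF that] small gibbs_pos[of B v] unfolding \<rho>_def m_def[symmetric]
    by (intro mult_nonneg_nonneg) auto
  have even: "\<rho> (- v) = \<rho> v" for v
    by (simp add: \<rho>_def y_def gibbs_def tsq_def)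
  have gy0: "(\<integral>v. gibbs B v * y v \<partial>S2) = 0"
    unfolding y_def by (rule integral_gibbs_centered[OF C])
  have mass: "(\<integral>v. \<rho> v \<partial>S2) = 1"
    unfolding \<rho>_def distrib_left
    by (subst Bochner_Integration.integral_add)
       (auto intro!: continuous_intros simp: gy0 integral_gibbs)
  have moment: "(\<integral>v. \<rho> v *\<^sub>R (tsq v - (1/3) *\<^sub>R mat 1) \<partial>S2) = P"
    unfolding \<rho>_def distrib_left scaleR_add_left P_def gibbs_moment_def[of B] gibbs_covariance_def
    by (subst Bochner_Integration.integral_add)
       (auto intro!: continuous_intros simp: y_def gibbs_moment_def)
  have adm: "\<rho> \<in> admissible P"
    unfolding admissible_def
    using r0 even mass moment
    by (auto intro!: continuous_intros continuous_borel_measurable_S2 simp: tsq_def)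
  have clog: "continuous_on (sphere 0 1) (\<lambda>v. \<rho> v * ln (\<rho> v))" if "m < 1"
  proof -
    have "\<rho> v \<noteq> 0" if "norm v = 1" for v
      using y[OF that] \<open>m < 1\<close> gibbs_pos[of B v] by (auto simp: \<rho>_def)
    thus ?thesis by (intro continuous_intros) auto
  qed
  have BP: "(\<integral>v. \<rho> v * (B \<bullet> tsq v) \<partial>S2) = B \<bullet> P"
  proof -
    have "B \<bullet> P = (\<integral>v. B \<bullet> (\<rho> v *\<^sub>R (tsq v - (1/3) *\<^sub>R mat 1)) \<partial>S2)"
      unfolding moment[symmetric]
      by (subst integral_inner_right) (auto intro!: continuous_intros)
    thus ?thesis using B by (simp add: inner_deviator)
  qed
  define U where "U v = \<rho> v * (B \<bullet> tsq v) - ln (partition_fn B) * \<rho> v + (gibbs B v * y v + m\<^sup>2 * gibbs B v)" for v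
  have Ucont: "continuous_on S U" for S unfolding U_def by (intro continuous_intros)
  have le: "\<rho> v * ln (\<rho> v) \<le> U v" if v: "norm v = 1" for v
  proof -
    have g: "gibbs B v > 0" by (rule gibbs_pos)
    have "\<rho> v * ln (\<rho> v) \<le> \<rho> v * (ln (gibbs B v) + y v)"
    proof (cases "\<rho> v = 0")
      case False
      hence "1 + y v > 0" using r0[OF v] g by (auto simp: \<rho>_def zero_le_mult_iff)
      hence "ln (\<rho> v) = ln (gibbs B v) + ln (1 + y v)" "ln (1 + y v) \<le> y v"
        using g ln_add_one_self_le_self2 by (auto simp: \<rho>_def ln_mult ln_le_minus_one order_trans[OF ln_le_minus_one])
      thus ?thesis using r0[OF v] by (intro mult_left_mono) auto
    qed simp
    also have "\<dots> = \<rho> v * (B \<bullet> tsq v) - ln (partition_fn B) * \<rho> v + (gibbs B v * y v + (y v)\<^sup>2 * gibbs B v)"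
      using partition_fn_pos[of B]
      by (simp add: gibbs_def ln_div \<rho>_def field_simps power2_eq_square)
    also have "\<dots> \<le> U v"
      using y[OF v] g abs_le_square_iff[of "y v" m] by (auto simp: U_def)
    finally show ?thesis .
  qed
  have "entropy \<rho> \<le> ereal (\<integral>v. U v \<partial>S2)"
  proof -
    have mr: "\<rho> \<in> borel_measurable S2" by (intro continuous_borel_measurable_S2 continuous_intros)
    have bdd: "bounded ((\<lambda>v. U v) ` sphere 0 1)"
      by (intro compact_imp_bounded compact_continuous_image compact_sphere Ucont)
    have "integrable S2 (\<lambda>v. \<rho> v * ln (\<rho> v))"
    proof -
      obtain K where K: "\<And>v. norm v = 1 \<Longrightarrow> norm (U v) \<le> K" using bdd unfolding bounded_iff by (metis imageI mem_sphere_0)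
      have "norm (\<rho> v * ln (\<rho> v)) \<le> K + 1" if v: "norm v = 1" for v
      proof -
        have "- (\<rho> v * ln (\<rho> v)) \<le> 1"
        proof (cases "\<rho> v = 0")
          case False
          hence p: "\<rho> v > 0" using r0[OF v] by simp
          have "ln (1 / \<rho> v) \<le> 1 / \<rho> v - 1" using p by (intro ln_le_minus_one) simp
          hence "\<rho> v * (- ln (\<rho> v)) \<le> \<rho> v * (1 / \<rho> v - 1)"
            using p by (intro mult_left_mono) (auto simp: ln_div)
          also have "\<dots> \<le> 1" using p by (simp add: algebra_simps)
          finally show ?thesis by simp
        qed simp
        thus ?thesis using le[OF v] K[OF v] by (auto simp: abs_le_iff)
      qed
      thus ?thesis
        using mr by (intro finite_measure.integrable_const_bound[OF finite_measure_S2, where B="K+1"] AE_I2)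
          (auto simp: space_S2)
    qed
    thus ?thesis
      unfolding entropy_def
      by (subst ereal_integral_eq_integral)
         (auto intro!: integral_mono continuous_integrable_S2 Ucont le simp: space_S2)
  qed
  also have "(\<integral>v. U v \<partial>S2) = B \<bullet> P - ln (partition_fn B) + m\<^sup>2"
  proof -
    have i: "integrable S2 (\<lambda>v. \<rho> v * (B \<bullet> tsq v))" "integrable S2 (\<lambda>v. ln (partition_fn B) * \<rho> v)"
      "integrable S2 (\<lambda>v. gibbs B v * y v)" "integrable S2 (\<lambda>v. m\<^sup>2 * gibbs B v)"
      by (intro continuous_integrable_S2 continuous_intros)+
    show ?thesis
      unfolding U_def using i
      by (simp add: Bochner_Integration.integral_add Bochner_Integration.integral_diff BP mass gy0 integral_gibbs)
  qed
  finally show ?thesis using that adm by (simp add: m_def)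
qed

lemma Qphy_open_in_Qsp:
  assumes Q: "Q \<in> Qphy"
  obtains \<epsilon> where "\<epsilon> > 0" "\<And>P. P \<in> Qsp \<Longrightarrow> norm (P - Q) < \<epsilon> \<Longrightarrow> P \<in> Qphy"
proof -
  obtain l where l: "l \<in> eigenvalues Q" "\<And>e. norm e = 1 \<Longrightarrow> l \<le> e \<bullet> (Q *v e)"
    using quadratic_form_min_eigenvalue Q by (auto simp: Qphy_def)
  have "- 1/3 < l" using l Q by (auto simp: Qphy_def)
  show ?thesis
  proof (rule that[of "l + 1/3"])
    fix P assume P: "P \<in> Qsp" "norm (P - Q) < l + 1/3"
    have "- 1/3 < e \<bullet> (P *v e)" if e: "norm e = 1" for e
    proof -
      have "\<bar>e \<bullet> ((P - Q) *v e)\<bar> \<le> norm (P - Q)"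
        using quadratic_form_le[of e "P - Q"] e by simp
      moreover have "e \<bullet> ((P - Q) *v e) = e \<bullet> (P *v e) - e \<bullet> (Q *v e)"
        by (simp add: matrix_vector_mult_diff_rdistrib inner_diff_right)
      ultimately show ?thesis using P(2) l(2)[OF e] by linarith
    qed
    thus "P \<in> Qphy" using P(1) by (simp add: Qphy_iff)
  qed (use \<open>- 1/3 < l\<close> in simp)
qed

text \<open>Near \<open>gibbs_moment B\<close> the potential lies between an affine function with gradient \<open>B\<close> (Gibbs'
  inequality) and the same function plus a quadratic error (tilted Gibbs densities, whose tilt is
  obtained from the inverse of the covariance).\<close>

lemma singular_potential_has_derivative:
  assumes B: "B \<in> Qsp" and Q: "gibbs_moment B \<in> Qphy"
  shows "((\<lambda>P. real_of_ereal (singular_potential P)) has_derivative (\<lambda>H. B \<bullet> H))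
           (at (gibbs_moment B) within Qsp)"
proof -
  define Q where "Q = gibbs_moment B"
  obtain k where k: "k > 0"
    "\<And>D. D \<in> Qsp \<Longrightarrow> \<exists>C\<in>Qsp. gibbs_covariance B C = D \<and> k * norm C \<le> norm D"
    using gibbs_covariance_inverse[of B] by blast
  obtain \<epsilon> where \<epsilon>: "\<epsilon> > 0" "\<And>P. P \<in> Qsp \<Longrightarrow> norm (P - Q) < \<epsilon> \<Longrightarrow> P \<in> Qphy"
    using Qphy_open_in_Qsp[OF Q] by (auto simp: Q_def)
  \<comment> \<open>The tilt that reaches \<open>P\<close> is pointwise bounded by \<open>c\<close> times the distance of \<open>P\<close> from \<open>Q\<close>.\<close>
  define c where "c = (1 + norm Q) / k"
  have c: "c > 0" using k by (auto simp: c_def intro!: divide_pos_pos add_pos_nonneg)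
  define f where "f P = real_of_ereal (singular_potential P)" for P
  have bounds: "B \<bullet> P - ln (partition_fn B) \<le> f P \<and>
      f P \<le> B \<bullet> P - ln (partition_fn B) + (c * norm (P - Q))\<^sup>2"
    if P: "P \<in> Qsp" "norm (P - Q) < \<epsilon>" "c * norm (P - Q) \<le> 1" for P
  proof -
    have "P - Q \<in> Qsp" using P(1) gibbs_moment_Qsp subspace_diff[OF subspace_Qsp] by (simp add: Q_def)
    then obtain C where C: "C \<in> Qsp" "gibbs_covariance B C = P - Q" "k * norm C \<le> norm (P - Q)"
      using k(2) by blast
    have nC: "norm C * (1 + norm Q) \<le> c * norm (P - Q)"
    proof -
      have "norm C \<le> norm (P - Q) / k" using C(3) k(1) by (simp add: field_simps)
      hence "norm C * (1 + norm Q) \<le> norm (P - Q) / k * (1 + norm Q)" by (intro mult_right_mono) auto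
      thus ?thesis by (simp add: c_def mult_ac)
    qed
    obtain \<rho> where \<rho>: "\<rho> \<in> admissible P"
      "entropy \<rho> \<le> ereal (B \<bullet> P - ln (partition_fn B) + (norm C * (1 + norm Q))\<^sup>2)"
      using tilted_gibbs[OF B C(1)] nC P(3) C(2) by (auto simp: Q_def)
    have "singular_potential P = (INF \<rho>\<in>admissible P. entropy \<rho>)"
      using \<epsilon>(2)[OF P(1,2)] by (simp add: singular_potential_def)
    hence "ereal (B \<bullet> P - ln (partition_fn B)) \<le> singular_potential P"
      "singular_potential P \<le> ereal (B \<bullet> P - ln (partition_fn B) + (norm C * (1 + norm Q))\<^sup>2)"
      using entropy_ge[OF _ B] \<rho> by (auto intro!: INF_greatest intro: INF_lower2)
    moreover have "(norm C * (1 + norm Q))\<^sup>2 \<le> (c * norm (P - Q))\<^sup>2"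
      using nC by (intro power_mono) (auto intro!: mult_nonneg_nonneg)
    ultimately show ?thesis
      by (cases "singular_potential P") (auto simp: f_def)
  qed
  have QQ: "Q \<in> Qsp" using Q by (simp add: Q_def Qphy_iff)
  have fQ: "f Q = B \<bullet> Q - ln (partition_fn B)" using bounds[OF QQ] \<epsilon> by auto
  have "(f has_derivative (\<lambda>H. B \<bullet> H)) (at Q within Qsp)"
    unfolding has_derivative_within_alt
  proof (intro conjI allI impI)
    show "bounded_linear (\<lambda>H. B \<bullet> H)" by (rule bounded_linear_inner_right)
    fix e :: real assume e: "e > 0"
    define d where "d = min \<epsilon> (min (1 / c) (e / c\<^sup>2))"
    have "d > 0" using \<epsilon>(1) c e by (simp add: d_def)
    moreover have "norm (f P - f Q - B \<bullet> (P - Q)) \<le> e * norm (P - Q)"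
      if P: "P \<in> Qsp" "norm (P - Q) < d" for P
    proof -
      have "c * norm (P - Q) \<le> 1" "c\<^sup>2 * norm (P - Q) \<le> e"
        using P(2) c by (auto simp: d_def field_simps)
      hence "c\<^sup>2 * norm (P - Q) * norm (P - Q) \<le> e * norm (P - Q)"
        and b: "B \<bullet> P - ln (partition_fn B) \<le> f P \<and> f P \<le> B \<bullet> P - ln (partition_fn B) + (c * norm (P - Q))\<^sup>2"
        using P bounds[OF P(1)] by (auto simp: d_def intro!: mult_right_mono)
      thus ?thesis
        by (auto simp: fQ inner_diff_right abs_le_iff power_mult_distrib power2_eq_square mult_ac)
    qed
    ultimately show "\<exists>d>0. \<forall>y\<in>Qsp. norm (y - Q) < d \<longrightarrow> norm (f y - f Q - B \<bullet> (y - Q)) \<le> e * norm (y - Q)"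
      by blast
  qed
  thus ?thesis by (simp add: f_def[abs_def] Q_def)
qed

lemma gradient_within_Qsp_unique:
  assumes "(f has_derivative (\<lambda>H. G \<bullet> H)) (at Q within Qsp)"
    "(f has_derivative (\<lambda>H. G' \<bullet> H)) (at Q within Qsp)"
    and "G \<in> Qsp" "G' \<in> Qsp" "Q \<in> Qsp"
  shows "G = (G' :: real^3^3)"
proof -
  define H where "H = G - G'"
  have H: "H \<in> Qsp" using assms subspace_diff[OF subspace_Qsp] by (simp add: H_def)
  have line: "((\<lambda>t. f (Q + t *\<^sub>R H)) has_derivative (\<lambda>t. A \<bullet> (t *\<^sub>R H))) (at 0)"
    if A: "(f has_derivative (\<lambda>H. A \<bullet> H)) (at Q within Qsp)" for A
  proof -
    have g: "((\<lambda>t. Q + t *\<^sub>R H) has_derivative (\<lambda>t. t *\<^sub>R H)) (at 0)"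
      by (auto intro!: derivative_eq_intros)
    have "range (\<lambda>t. Q + t *\<^sub>R H) \<subseteq> Qsp"
      using H assms(5) subspace_Qsp by (auto intro!: subspace_add subspace_scale)
    hence "(f has_derivative (\<lambda>H. A \<bullet> H)) (at (Q + 0 *\<^sub>R H) within range (\<lambda>t. Q + t *\<^sub>R H))"
      using A has_derivative_subset by force
    from diff_chain_within[OF g this] show ?thesis by (simp add: comp_def)
  qed
  have "(\<lambda>t. G \<bullet> (t *\<^sub>R H)) = (\<lambda>t. G' \<bullet> (t *\<^sub>R H))"
    using has_derivative_unique[OF line[OF assms(1)] line[OF assms(2)]] .
  from fun_cong[OF this, of 1] have "H \<bullet> H = 0" by (simp add: H_def inner_diff_left)
  thus ?thesis by (simp add: H_def)
qed

lemma DQf_gibbs_moment: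
  assumes "B \<in> Qsp" "gibbs_moment B \<in> Qphy"
  shows "DQf (gibbs_moment B) = B"
  unfolding DQf_def
  using assms singular_potential_has_derivative gradient_within_Qsp_unique gibbs_moment_Qsp
  by (intro the_equality) blast+

section \<open>Blow-up of the gradient at the boundary\<close>

text \<open>The rotation with sine \<open>s\<close> in the plane of the first and the \<open>k\<close>-th vector of the frame \<open>T\<close>, written as
  a perturbation of the identity.\<close>

definition plane_rotation :: "(real^3 \<Rightarrow> real^3) \<Rightarrow> real \<Rightarrow> 3 \<Rightarrow> real^3 \<Rightarrow> real^3" where
  "plane_rotation T s k v =
     v + ((sqrt (1 - s\<^sup>2) - 1) * (v \<bullet> T (axis 1 1)) - s * (v \<bullet> T (axis k 1))) *\<^sub>R T (axis 1 1)
       + ((sqrt (1 - s\<^sup>2) - 1) * (v \<bullet> T (axis k 1)) + s * (v \<bullet> T (axis 1 1))) *\<^sub>R T (axis k 1)"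

lemma frame_inner:
  assumes "orthogonal_transformation (T :: real^3 \<Rightarrow> real^3)"
  shows "T (axis i 1) \<bullet> T (axis j 1) = (if i = j then 1 else 0)"
  using assms by (simp add: orthogonal_transformation_def inner_axis_axis)

context
  fixes T :: "real^3 \<Rightarrow> real^3" and s :: real and k :: 3
  assumes T: "orthogonal_transformation T" and s: "s\<^sup>2 \<le> 1" and k: "k \<noteq> 1"
begin

lemma orthogonal_plane_rotation: "orthogonal_transformation (plane_rotation T s k)"
  unfolding orthogonal_transformation
proof (intro conjI allI)
  show "linear (plane_rotation T s k)"
    by (rule linearI) (simp_all add: plane_rotation_def inner_add_left algebra_simps)
  fix v
  define a b c where "a = v \<bullet> T (axis 1 1)" and "b = v \<bullet> T (axis k 1)" and "c = sqrt (1 - s\<^sup>2)"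
  define x y where "x = (c - 1) * a - s * b" and "y = (c - 1) * b + s * a"
  have c: "c\<^sup>2 = 1 - s\<^sup>2" using s by (simp add: c_def)
  have "plane_rotation T s k v \<bullet> plane_rotation T s k v = v \<bullet> v + 2 * x * a + 2 * y * b + x\<^sup>2 + y\<^sup>2"
    using k unfolding plane_rotation_def a_def[symmetric] b_def[symmetric] c_def[symmetric]
      x_def[symmetric] y_def[symmetric]
    by (simp add: inner_add_left inner_add_right frame_inner[OF T] power2_eq_square
        inner_commute[of "T _" v] algebra_simps flip: a_def b_def)
  also have "\<dots> = v \<bullet> v + (c\<^sup>2 + s\<^sup>2 - 1) * (a\<^sup>2 + b\<^sup>2)"
    by (simp add: x_def y_def power2_eq_square algebra_simps)
  also have "\<dots> = v \<bullet> v" by (simp add: c)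
  finally show "norm (plane_rotation T s k v) = norm v" by (simp add: norm_eq_sqrt_inner)
qed

lemma plane_rotation_inner:
  "plane_rotation T s k v \<bullet> T (axis 1 1)
     = sqrt (1 - s\<^sup>2) * (v \<bullet> T (axis 1 1)) - s * (v \<bullet> T (axis k 1))"
  using k by (simp add: plane_rotation_def inner_add_left frame_inner[OF T] algebra_simps)

end

text \<open>The two rotations move a point in opposite directions, so that on average the quadratic form
  changes only by terms of order \<open>s\<^sup>2 |B|\<close>. The arithmetic-geometric mean inequality turns this into a
  bound for the exponentials.\<close>

lemma exp_quadratic_form_rotations:
  assumes T: "orthogonal_transformation T" and k: "k \<noteq> 1" and s: "s\<^sup>2 \<le> 1" "s\<^sup>2 * norm B \<le> 1"
    and B: "B \<in> Qsp" and v: "norm v = 1"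
  shows "2 * exp (- 4) * exp (B \<bullet> tsq v)
     \<le> exp (B \<bullet> tsq (plane_rotation T s k v)) + exp (B \<bullet> tsq (plane_rotation T (- s) k v))"
proof -
  define a b c where "a = v \<bullet> T (axis 1 1)" and "b = v \<bullet> T (axis k 1)" and "c = sqrt (1 - s\<^sup>2)"
  define p where "p = a *\<^sub>R T (axis 1 1) + b *\<^sub>R T (axis k 1)"
  define j where "j = a *\<^sub>R T (axis k 1) - b *\<^sub>R T (axis 1 1)"
  define w where "w = v + (c - 1) *\<^sub>R p"
  note fi = frame_inner[OF T]
  have rot: "plane_rotation T s k v = w + s *\<^sub>R j" "plane_rotation T (- s) k v = w - s *\<^sub>R j"
    by (simp_all add: plane_rotation_def w_def p_def j_def algebra_simps flip: a_def b_def c_def)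
  have vp: "v \<bullet> p = a\<^sup>2 + b\<^sup>2" by (simp add: p_def inner_add_right a_def b_def power2_eq_square)
  have pp: "p \<bullet> p = a\<^sup>2 + b\<^sup>2"
    using k by (simp add: p_def inner_add_left inner_add_right fi power2_eq_square)
  have jj: "j \<bullet> j = a\<^sup>2 + b\<^sup>2"
    using k by (simp add: j_def inner_diff_left inner_diff_right fi power2_eq_square)
  have "(norm p)\<^sup>2 \<le> norm p"
    using norm_cauchy_schwarz[of v p] vp pp v by (simp add: power2_norm_eq_inner)
  hence np: "norm p \<le> 1" by (cases "p = 0") (auto simp: power2_eq_square)
  have nj: "norm j \<le> 1" using np pp jj by (simp add: norm_eq_sqrt_inner)
  have c: "0 \<le> c" "c \<le> 1" "1 - c \<le> s\<^sup>2"
  proof -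
    show "0 \<le> c" "c \<le> 1" using s by (auto simp: c_def real_le_lsqrt)
    hence "c\<^sup>2 \<le> c" by (simp add: power2_eq_square mult_left_le)
    moreover have "c\<^sup>2 = 1 - s\<^sup>2" using s by (simp add: c_def)
    ultimately show "1 - c \<le> s\<^sup>2" by simp
  qed
  define q where "q x = B \<bullet> tsq x" for x
  have sym: "x \<bullet> (B *v y) = y \<bullet> (B *v x)" for x y
    using Qsp_symmetric[OF B, of x y] by (simp add: inner_commute)
  have avg: "q (w + s *\<^sub>R j) + q (w - s *\<^sub>R j) = 2 * q w + 2 * s\<^sup>2 * q j"
    by (simp add: q_def inner_tsq matrix_vector_right_distrib matrix_vector_mult_diff_distrib
        matrix_vector_mult_scaleR inner_simps power2_eq_square algebra_simps)
  have "\<bar>q w - q v\<bar> \<le> 3 * (norm B * s\<^sup>2)"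
  proof -
    have "q w - q v = (w - v) \<bullet> (B *v (w + v))"
      using sym[of w v] by (simp add: q_def inner_tsq matrix_vector_right_distrib inner_simps algebra_simps)
    also have "\<dots> = (c - 1) * (p \<bullet> (B *v (w + v)))" by (simp add: w_def)
    finally have "\<bar>q w - q v\<bar> = (1 - c) * \<bar>p \<bullet> (B *v (w + v))\<bar>" using c by (simp add: abs_mult)
    also have "p \<bullet> (B *v (w + v)) = 2 * (p \<bullet> (B *v v)) + (c - 1) * (p \<bullet> (B *v p))"
    proof -
      have "w + v = 2 *\<^sub>R v + (c - 1) *\<^sub>R p" by (simp add: w_def scaleR_2)
      thus ?thesis by (simp add: matrix_vector_right_distrib matrix_vector_mult_scaleR inner_add_right)
    qed
    also have "(1 - c) * \<bar>2 * (p \<bullet> (B *v v)) + (c - 1) * (p \<bullet> (B *v p))\<bar> \<le> s\<^sup>2 * (3 * norm B)"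
    proof (rule mult_mono)
      have quad: "\<bar>x \<bullet> (B *v x)\<bar> \<le> norm B * (norm x)\<^sup>2" for x by (rule quadratic_form_le)
      have "4 * (p \<bullet> (B *v v)) = (p + v) \<bullet> (B *v (p + v)) - (p - v) \<bullet> (B *v (p - v))"
        using sym[of p v] by (simp add: matrix_vector_right_distrib matrix_vector_mult_diff_distrib
            inner_simps algebra_simps)
      also have "\<bar>\<dots>\<bar> \<le> norm B * ((norm (p + v))\<^sup>2 + (norm (p - v))\<^sup>2)"
        using quad[of "p + v"] quad[of "p - v"] by (simp add: distrib_left)
      also have "(norm (p + v))\<^sup>2 + (norm (p - v))\<^sup>2 = 2 * (norm p)\<^sup>2 + 2 * (norm v)\<^sup>2"
        by (simp add: power2_norm_eq_inner inner_simps inner_commute)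
      also have "norm B * \<dots> \<le> norm B * 4"
        using np v by (intro mult_left_mono) (auto simp: power_le_one)
      finally have 1: "\<bar>2 * (p \<bullet> (B *v v))\<bar> \<le> 2 * norm B" by simp
      have "\<bar>(c - 1) * (p \<bullet> (B *v p))\<bar> \<le> 1 * (norm B * 1)"
        unfolding abs_mult using c np
        by (intro mult_mono order_trans[OF quad] mult_left_mono) (auto simp: power_le_one)
      with 1 show "\<bar>2 * (p \<bullet> (B *v v)) + (c - 1) * (p \<bullet> (B *v p))\<bar> \<le> 3 * norm B" by simp
    qed (use c in auto)
    finally show ?thesis by (simp add: mult_ac)
  qed
  moreover have "\<bar>q j\<bar> \<le> norm B"
    using quadratic_form_le[of j B] nj mult_left_mono[of "(norm j)\<^sup>2" 1 "norm B"]
    by (simp add: q_def inner_tsq power_le_one)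
  hence "s\<^sup>2 * \<bar>q j\<bar> \<le> s\<^sup>2 * norm B" by (intro mult_left_mono) auto
  ultimately have "q v - 4 \<le> (q (w + s *\<^sub>R j) + q (w - s *\<^sub>R j)) / 2"
    using avg s(2) abs_ge_minus_self[of "s\<^sup>2 * q j"] by (simp add: abs_mult mult.commute[of "norm B"])
  hence "2 * exp (- 4) * exp (q v) \<le> 2 * exp ((q (w + s *\<^sub>R j) + q (w - s *\<^sub>R j)) / 2)"
    by (simp flip: exp_add)
  also have "\<dots> \<le> exp (q (w + s *\<^sub>R j)) + exp (q (w - s *\<^sub>R j))"
  proof -
    define A D where "A = exp (q (w + s *\<^sub>R j) / 2)" and "D = exp (q (w - s *\<^sub>R j) / 2)"
    have "0 \<le> (A - D)\<^sup>2" by simp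
    hence "2 * (A * D) \<le> A * A + D * D" by (simp add: power2_eq_square algebra_simps)
    thus ?thesis by (simp add: A_def D_def add_divide_distrib flip: exp_add)
  qed
  finally show ?thesis by (simp add: rot q_def)
qed

text \<open>Where \<open>n\<close> is close to the plane orthogonal to the first frame vector, both rotations push it away
  from that plane by about \<open>s\<close> times its \<open>k\<close>-th coordinate, and by the previous lemma the density at one
  of the two images is comparable to the one at \<open>n\<close>.\<close>

lemma gibbs_second_moment_transfer:
  fixes T :: "real^3 \<Rightarrow> real^3"
  assumes T: "orthogonal_transformation T" and k: "k \<noteq> 1" and s: "0 < s" "s\<^sup>2 \<le> 1" "s\<^sup>2 * norm B \<le> 1"
    and B: "B \<in> Qsp"
  shows "s\<^sup>2 * (\<integral>v. (v \<bullet> T (axis k 1))\<^sup>2 * gibbs B v \<partial>S2)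
     \<le> (4 + 4 * exp 4) * (\<integral>v. (v \<bullet> T (axis 1 1))\<^sup>2 * gibbs B v \<partial>S2)"
proof -
  define a b where "a v = v \<bullet> T (axis 1 1)" and "b v = v \<bullet> T (axis k 1)" for v
  define R where "R = plane_rotation T s k"
  define R' where "R' = plane_rotation T (- s) k"
  define F where "F v = (a v)\<^sup>2 * gibbs B v" for v
  have s': "(- s)\<^sup>2 \<le> 1" using s by simp
  have oR: "orthogonal_transformation R" and oR': "orthogonal_transformation R'"
    unfolding R_def R'_def using orthogonal_plane_rotation[OF T _ k] s(2) s' by blast+
  have contF: "continuous_on S F" for S unfolding F_def a_def by (intro continuous_intros)
  have contR: "continuous_on S R" "continuous_on S R'" for S
    using oR oR' by (auto intro!: linear_continuous_on simp: orthogonal_transformation_def linear_linear)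
  have contFR: "continuous_on S (\<lambda>v. F (R v))" "continuous_on S (\<lambda>v. F (R' v))" for S
    by (rule continuous_on_compose2[OF contF[of UNIV]]; simp add: contR)+
  have contb: "continuous_on S (\<lambda>v. s\<^sup>2 * ((b v)\<^sup>2 * gibbs B v))" for S
    unfolding b_def by (intro continuous_intros)
  have pt: "s\<^sup>2 * ((b v)\<^sup>2 * gibbs B v) \<le> 4 * F v + 2 * exp 4 * (F (R v) + F (R' v))"
    if v: "norm v = 1" for v
  \<comment> \<open>If \<open>|a|\<close> is not already of the size \<open>s |b|\<close>, then it is at both rotated points.\<close>
  proof (cases "s * \<bar>b v\<bar> \<le> 2 * \<bar>a v\<bar>")
    case True
    hence "(s * \<bar>b v\<bar>)\<^sup>2 \<le> (2 * \<bar>a v\<bar>)\<^sup>2" using s by (intro power_mono) auto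
    hence "s\<^sup>2 * (b v)\<^sup>2 * gibbs B v \<le> 4 * (a v)\<^sup>2 * gibbs B v"
      using gibbs_pos[of B v] by (intro mult_right_mono) (auto simp: power_mult_distrib)
    moreover have "0 \<le> F (R v)" "0 \<le> F (R' v)" using gibbs_pos by (auto simp: F_def less_imp_le)
    ultimately show ?thesis by (simp add: F_def mult.assoc add_increasing2)
  next
    case False
    define c where "c = sqrt (1 - s\<^sup>2)"
    have c: "0 \<le> c" "c \<le> 1" using s by (auto simp: c_def real_le_lsqrt)
    have aR: "a (R v) = c * a v - s * b v" "a (R' v) = c * a v + s * b v"
      using plane_rotation_inner[OF T s(2) k, of v] plane_rotation_inner[OF T s' k, of v]
      by (simp_all add: a_def b_def c_def R_def R'_def)
    have ca: "\<bar>c * a v\<bar> \<le> \<bar>a v\<bar>" using c by (simp add: abs_mult mult_left_le_one_le)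
    have sb: "\<bar>s * b v\<bar> = s * \<bar>b v\<bar>" using s by (simp add: abs_mult)
    have "s * \<bar>b v\<bar> \<le> 2 * \<bar>a (R v)\<bar>" "s * \<bar>b v\<bar> \<le> 2 * \<bar>a (R' v)\<bar>"
    proof -
      have "\<bar>y\<bar> \<le> \<bar>x - y\<bar> + \<bar>x\<bar>" "\<bar>y\<bar> \<le> \<bar>x + y\<bar> + \<bar>x\<bar>" for x y :: real by arith+
      from this[of "s * b v" "c * a v"]
      show "s * \<bar>b v\<bar> \<le> 2 * \<bar>a (R v)\<bar>" "s * \<bar>b v\<bar> \<le> 2 * \<bar>a (R' v)\<bar>"
        using ca False unfolding aR sb not_le by auto
    qed
    moreover have "s\<^sup>2 * (b v)\<^sup>2 \<le> 4 * z\<^sup>2" if "s * \<bar>b v\<bar> \<le> 2 * \<bar>z\<bar>" for z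
    proof -
      have "(s * \<bar>b v\<bar>)\<^sup>2 \<le> (2 * \<bar>z\<bar>)\<^sup>2" by (rule power_mono[OF that]) (use s in simp)
      thus ?thesis by (simp add: power_mult_distrib)
    qed
    ultimately have sq: "s\<^sup>2 * (b v)\<^sup>2 \<le> 4 * (a (R v))\<^sup>2" "s\<^sup>2 * (b v)\<^sup>2 \<le> 4 * (a (R' v))\<^sup>2"
      by blast+
    \<comment> \<open>The density at \<open>v\<close> is dominated by the densities at the two rotated points.\<close>
    have "2 * exp (- 4) * gibbs B v \<le> gibbs B (R v) + gibbs B (R' v)"
      using exp_quadratic_form_rotations[OF T k s(2,3) B v] partition_fn_pos[of B]
      unfolding R_def R'_def gibbs_def by (simp add: field_simps)
    hence "gibbs B v \<le> exp 4 / 2 * (gibbs B (R v) + gibbs B (R' v))"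
      by (simp add: exp_minus field_simps)
    hence "s\<^sup>2 * (b v)\<^sup>2 * gibbs B v \<le> s\<^sup>2 * (b v)\<^sup>2 * (exp 4 / 2 * (gibbs B (R v) + gibbs B (R' v)))"
      by (intro mult_left_mono) auto
    also have "\<dots> = exp 4 / 2 * (s\<^sup>2 * (b v)\<^sup>2 * gibbs B (R v) + s\<^sup>2 * (b v)\<^sup>2 * gibbs B (R' v))"
      by (simp add: algebra_simps)
    also have "\<dots> \<le> exp 4 / 2 * (4 * (a (R v))\<^sup>2 * gibbs B (R v) + 4 * (a (R' v))\<^sup>2 * gibbs B (R' v))"
      using sq gibbs_pos[of B] by (intro mult_left_mono add_mono mult_right_mono) (auto simp: less_imp_le)
    also have "\<dots> = 2 * exp 4 * (F (R v) + F (R' v))" by (simp add: F_def algebra_simps)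
    finally have "s\<^sup>2 * ((b v)\<^sup>2 * gibbs B v) \<le> 2 * exp 4 * (F (R v) + F (R' v))"
      by (simp only: mult.assoc)
    moreover have "0 \<le> F v" using gibbs_pos by (simp add: F_def less_imp_le)
    ultimately show ?thesis by simp
  qed
  have i: "integrable S2 (\<lambda>v. 4 * F v)" "integrable S2 (\<lambda>v. 2 * exp 4 * (F (R v) + F (R' v)))"
    "integrable S2 (\<lambda>v. F (R v))" "integrable S2 (\<lambda>v. F (R' v))"
    by (intro continuous_integrable_S2 continuous_intros contF contFR)+
  have "s\<^sup>2 * (\<integral>v. (b v)\<^sup>2 * gibbs B v \<partial>S2) = (\<integral>v. s\<^sup>2 * ((b v)\<^sup>2 * gibbs B v) \<partial>S2)" by simp
  also have "\<dots> \<le> (\<integral>v. 4 * F v + 2 * exp 4 * (F (R v) + F (R' v)) \<partial>S2)"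
    by (intro integral_mono continuous_integrable_S2[OF contb] Bochner_Integration.integrable_add[OF i(1,2)])
       (auto simp: space_S2 pt)
  also have "\<dots> = (\<integral>v. 4 * F v \<partial>S2) + (\<integral>v. 2 * exp 4 * (F (R v) + F (R' v)) \<partial>S2)"
    by (rule Bochner_Integration.integral_add[OF i(1,2)])
  also have "(\<integral>v. 2 * exp 4 * (F (R v) + F (R' v)) \<partial>S2)
      = 2 * exp 4 * ((\<integral>v. F (R v) \<partial>S2) + (\<integral>v. F (R' v) \<partial>S2))"
    by (simp add: Bochner_Integration.integral_add[OF i(3,4)])
  also have "(\<integral>v. 4 * F v \<partial>S2) = 4 * (\<integral>v. F v \<partial>S2)" by simp
  also have "(\<integral>v. F (R v) \<partial>S2) = (\<integral>v. F v \<partial>S2)"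
    by (rule integral_S2_orthogonal[OF oR continuous_borel_measurable_S2[OF contF]])
  also have "(\<integral>v. F (R' v) \<partial>S2) = (\<integral>v. F v \<partial>S2)"
    by (rule integral_S2_orthogonal[OF oR' continuous_borel_measurable_S2[OF contF]])
  finally have "s\<^sup>2 * (\<integral>v. (b v)\<^sup>2 * gibbs B v \<partial>S2) \<le> (4 + 4 * exp 4) * (\<integral>v. F v \<partial>S2)"
    by (simp add: distrib_right)
  thus ?thesis by (simp only: F_def a_def b_def)
qed

text \<open>The three second moments along a frame add up to \<open>1\<close>, and the transfer lemma with
  \<open>s\<^sup>2 = 1 / (1 + |B|)\<close> bounds each of them by a multiple of \<open>1 + |B|\<close> times the first one.\<close>

lemma gibbs_moment_eigenvalue_bound:
  assumes B: "B \<in> Qsp" and e: "norm e = 1"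
  shows "1 \<le> (9 + 8 * exp 4) * (1 + norm B) * (e \<bullet> (gibbs_moment B *v e) + 1/3)"
proof -
  obtain T :: "real^3 \<Rightarrow> real^3" where T: "orthogonal_transformation T" "T (axis 1 1) = e"
    by (rule frame_through[OF e])
  define s where "s = 1 / sqrt (1 + norm B)"
  have pB: "1 + norm B > 0" by (simp add: add_pos_nonneg)
  have s2: "s\<^sup>2 = 1 / (1 + norm B)" using pB by (simp add: s_def power_divide)
  have s: "0 < s" "s\<^sup>2 \<le> 1" "s\<^sup>2 * norm B \<le> 1"
    unfolding s2 using pB by (auto simp: s_def divide_le_eq)
  define I where "I k = (\<integral>v. (v \<bullet> T (axis k 1))\<^sup>2 * gibbs B v \<partial>S2)" for k
  have int: "integrable S2 (\<lambda>v. (v \<bullet> T (axis k 1))\<^sup>2 * gibbs B v)" for k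
    by (intro continuous_integrable_S2 continuous_intros)
  have sum: "I 1 + I 2 + I 3 = 1"
  proof -
    have "(v \<bullet> T (axis 1 1))\<^sup>2 + (v \<bullet> T (axis 2 1))\<^sup>2 + (v \<bullet> T (axis 3 1))\<^sup>2 = 1" if "norm v = 1" for v
    proof -
      have "tsq v \<bullet> tsq x = (v \<bullet> x)\<^sup>2" for x
        by (simp add: inner_tsq tsq_mult_vec inner_commute power2_eq_square)
      thus ?thesis using arg_cong[OF sum_tsq_frame[OF T(1)], of "\<lambda>X. tsq v \<bullet> X"] that
        by (simp add: sum_3 inner_add_right inner_mat_1 trace_tsq)
    qed
    hence "(\<integral>v. (v \<bullet> T (axis 1 1))\<^sup>2 * gibbs B v + (v \<bullet> T (axis 2 1))\<^sup>2 * gibbs B v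
        + (v \<bullet> T (axis 3 1))\<^sup>2 * gibbs B v \<partial>S2) = (\<integral>v. gibbs B v \<partial>S2)"
      by (intro Bochner_Integration.integral_cong refl) (simp add: space_S2 flip: distrib_right)
    thus ?thesis
      unfolding I_def integral_gibbs
        Bochner_Integration.integral_add[OF Bochner_Integration.integrable_add[OF int int] int]
        Bochner_Integration.integral_add[OF int int] .
  qed
  have I1: "I 1 = e \<bullet> (gibbs_moment B *v e) + 1/3"
  proof -
    have c: "continuous_on (sphere 0 1) (\<lambda>v. gibbs B v * (tsq e \<bullet> (tsq v - (1/3) *\<^sub>R mat 1)))"
      by (intro continuous_intros)
    have ig: "integrable S2 (\<lambda>v. (1/3) * gibbs B v)"
      by (intro continuous_integrable_S2 continuous_intros)
    have dev: "tsq e \<bullet> (tsq v - (1/3) *\<^sub>R mat 1) = (v \<bullet> e)\<^sup>2 - 1/3" for v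
      using e by (simp add: inner_diff_right inner_mat_1 trace_tsq)
        (simp add: inner_tsq tsq_mult_vec inner_commute power2_eq_square)
    have "tsq e \<bullet> gibbs_moment B = (\<integral>v. (v \<bullet> e)\<^sup>2 * gibbs B v - (1/3) * gibbs B v \<partial>S2)"
      unfolding inner_gibbs_moment dev
      by (intro Bochner_Integration.integral_cong refl) (simp add: algebra_simps)
    also have "\<dots> = I 1 - (\<integral>v. (1/3) * gibbs B v \<partial>S2)"
      unfolding I_def T(2) using int[of 1] unfolding T(2) by (rule Bochner_Integration.integral_diff[OF _ ig])
    finally show ?thesis by (simp add: integral_gibbs inner_commute[of "tsq e"] inner_tsq)
  qed
  have "s\<^sup>2 * I 2 \<le> (4 + 4 * exp 4) * I 1" "s\<^sup>2 * I 3 \<le> (4 + 4 * exp 4) * I 1"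
    unfolding I_def by (rule gibbs_second_moment_transfer[OF T(1) _ s B]; simp)+
  moreover have "s\<^sup>2 * I 1 \<le> 1 * I 1"
    using s(2) gibbs_pos[of B]
    by (intro mult_right_mono) (auto simp: I_def less_imp_le intro!: Bochner_Integration.integral_nonneg)
  ultimately have "s\<^sup>2 * (I 1 + I 2 + I 3) \<le> (9 + 8 * exp 4) * I 1"
    by (simp add: algebra_simps)
  hence "1 \<le> (9 + 8 * exp 4) * I 1 * (1 + norm B)"
    using pB by (simp add: sum s2 divide_le_eq)
  thus ?thesis by (simp add: I1 mult_ac)
qed

text \<open>Along an eigenvector the last factor is the distance of an eigenvalue from \<open>- 1/3\<close>. The power one
  of \<open>norm (DQf Q)\<close> is essential for the dimension bound.\<close>

lemma DQf_blowup:
  assumes "Q \<in> Qphy" "norm e = 1"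
  shows "1 \<le> (9 + 8 * exp 4) * (1 + norm (DQf Q)) * (e \<bullet> (Q *v e) + 1/3)"
proof -
  obtain B where "B \<in> Qsp" "gibbs_moment B = Q" using gibbs_moment_surj[OF assms(1)] .
  thus ?thesis using DQf_gibbs_moment gibbs_moment_eigenvalue_bound[OF _ assms(2)] assms(1) by metis
qed

lemma singular_potential_infinite_iff:
  "singular_potential Q = \<infinity> \<longleftrightarrow> Q \<notin> Qphy"
proof
  assume inf: "singular_potential Q = \<infinity>"
  show "Q \<notin> Qphy"
  proof
    assume Q: "Q \<in> Qphy"
    obtain B where B: "B \<in> Qsp" "gibbs_moment B = Q" using gibbs_moment_surj[OF Q] .
    have "gibbs_covariance B 0 = 0" using linear_0[OF linear_gibbs_covariance] .
    then obtain \<rho> where "\<rho> \<in> admissible Q" "entropy \<rho> \<le> ereal (B \<bullet> Q - ln (partition_fn B))"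
      using tilted_gibbs[OF B(1) Qsp_0] B(2) by auto
    hence "singular_potential Q \<le> ereal (B \<bullet> Q - ln (partition_fn B))"
      using Q by (auto simp: singular_potential_def intro: INF_lower2)
    thus False using inf by simp
  qed
qed (simp add: singular_potential_def)

section \<open>Contact points\<close>

lemma matrix_sum_axes: "(M :: real^3^3) = (\<Sum>i\<in>UNIV. \<Sum>j\<in>UNIV. (M $ i $ j) *\<^sub>R axis i (axis j 1))"
  by (simp add: vec_eq_iff axis_def sum_3 forall_3)

text \<open>The equation is solved for \<open>DQf\<close>.\<close>

lemma DQf_L2_class:
  fixes u :: "real^'n::finite \<Rightarrow> real^3^3"
  assumes u: "in_H2 u" and lab: "inj lab" and p: "L2_class p"
    and eq: "AE x in torus_measure. p x = - variation lab L1 L2 L3 \<alpha> u x"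
  obtains D where "L2_class D" "AE x in torus_measure. DQf (u x) = D x"
proof -
  define E where "E i j x = L1 * (\<Sum>k\<in>UNIV. d2 lab u k k i j x) +
     (L2 + L3) / 2 * (\<Sum>k\<in>UNIV. d2 lab u j k i k x + d2 lab u i k j k x) -
     ((L2 + L3) / 3 * (if i = j then 1 else 0)) * (\<Sum>k\<in>UNIV. \<Sum>l\<in>UNIV. d2 lab u k l l k x)" for i j x
  define F where "F i j x = E i j x + 2 * \<alpha> * u x $ i $ j - p x $ i $ j" for i j x
  define D where "D x = (\<Sum>i\<in>UNIV. \<Sum>j\<in>UNIV. F i j x *\<^sub>R (axis i (axis j 1) :: real^3^3))" for x
  have L2u: "L2_class u" using u by (simp add: in_H2_def in_H1_def in_L2_iff_L2_class)
  have "L2_class (E i j)" for i j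
    unfolding E_def by (intro L2_class_diff L2_class_add L2_class_cmult L2_class_sum d2_L2_class[OF u lab] finite)
  moreover have "L2_class (\<lambda>x. u x $ i $ j)" "L2_class (\<lambda>x. p x $ i $ j)" for i j
    unfolding component_eq_inner by (intro L2_class_component L2u p)+
  ultimately have "L2_class (F i j)" for i j
    unfolding F_def mult.assoc by (intro L2_class_diff L2_class_add L2_class_cmult)
  hence "L2_class D"
    unfolding D_def by (intro L2_class_sum L2_class_scaleR_const finite)
  moreover have "AE x in torus_measure. DQf (u x) = D x"
    using eq
  proof eventually_elim
    case (elim x)
    have "F i j x = DQf (u x) $ i $ j" for i j
      using arg_cong[OF elim, of "\<lambda>M. M $ i $ j"] by (simp add: F_def E_def variation_def)
    thus ?case using matrix_sum_axes[of "DQf (u x)"] by (simp add: D_def)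
  qed
  ultimately show ?thesis by (rule that)
qed

text \<open>The continuous representative is a limit of averages of tensors in \<open>Qphy\<close>, whose closure is convex.\<close>

lemma mollify_limit_Qphy_closure:
  fixes v :: "real^'n::finite \<Rightarrow> real^3^3" and u :: "real^3^3"
  assumes v: "integrable torus_measure v" and phy: "AE x in torus_measure. v x \<in> Qphy"
    and lim: "(\<lambda>m. mollify (mesh m) v x) \<longlonglongrightarrow> profile_mass TYPE('n) *\<^sub>R u"
  shows "u \<in> Qsp" "norm e = 1 \<Longrightarrow> - 1/3 \<le> e \<bullet> (u *v e)"
proof -
  let ?c = "profile_mass TYPE('n)"
  have c: "?c > 0" by (rule profile_mass_pos)
  have mem: "mollify (mesh m) v x \<in> Qsp" for m
    unfolding mollify_def
  proof (rule integral_in_Qsp[OF integrable_mollify[OF v mesh(1)]])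
    show "AE y in torus_measure. profile (mesh m) (wrap (y - x)) *\<^sub>R v y \<in> Qsp"
      using phy by eventually_elim (simp add: Qphy_iff subspace_scale[OF subspace_Qsp])
  qed
  have "?c *\<^sub>R u \<in> Qsp" by (rule closed_sequentially[OF closed_Qsp mem lim])
  from subspace_scale[OF subspace_Qsp this, of "1 / ?c"] show "u \<in> Qsp" using c by simp
  assume e: "norm e = 1"
  have low: "- 1/3 * ?c \<le> tsq e \<bullet> mollify (mesh m) v x" for m
  proof -
    let ?p = "\<lambda>y. profile (mesh m) (wrap (y - x))"
    have one: "integrable torus_measure (\<lambda>x::real^'n. 1::real)" by simp
    have ip: "integrable torus_measure ?p" using integrable_mollify[OF one mesh(1)] by simp
    have "- 1/3 * ?c = (\<integral>y. - 1/3 * ?p y \<partial>torus_measure)"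
      using integral_profile[OF mesh(1)[of m] mesh(2)[of m], of x] by simp
    also have "\<dots> \<le> (\<integral>y. tsq e \<bullet> (?p y *\<^sub>R v y) \<partial>torus_measure)"
    proof (rule integral_mono_AE)
      show "integrable torus_measure (\<lambda>y. - 1/3 * ?p y)" using ip by simp
      show "integrable torus_measure (\<lambda>y. tsq e \<bullet> (?p y *\<^sub>R v y))"
        using integrable_mollify[OF v mesh(1)[of m], of x] by (rule integrable_inner_right)
      show "AE y in torus_measure. - 1/3 * ?p y \<le> tsq e \<bullet> (?p y *\<^sub>R v y)"
        using phy
      proof eventually_elim
        case (elim y)
        have "- 1/3 < tsq e \<bullet> v y"
          using elim e inner_tsq[of "v y" e] by (simp add: Qphy_iff inner_commute)
        hence "?p y * (- 1/3) \<le> ?p y * (tsq e \<bullet> v y)"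
          by (intro mult_left_mono profile_nonneg mesh) simp
        thus ?case by simp
      qed
    qed
    also have "\<dots> = tsq e \<bullet> mollify (mesh m) v x"
      unfolding mollify_def by (rule integral_inner_right) (rule integrable_mollify[OF v mesh(1)])
    finally show ?thesis .
  qed
  have "- 1/3 * ?c \<le> tsq e \<bullet> (?c *\<^sub>R u)"
    by (rule LIMSEQ_le_const[OF tendsto_inner[OF tendsto_const lim]]) (use low in blast)
  hence "?c * (- 1/3) \<le> ?c * (tsq e \<bullet> u)" by simp
  hence "- 1/3 \<le> tsq e \<bullet> u" using c by (metis mult_le_cancel_left_pos)
  thus "- 1/3 \<le> e \<bullet> (u *v e)" by (simp add: inner_tsq inner_commute[of "tsq e"])
qed

text \<open>At a contact point the quadratic form of \<open>u x\<close> takes the value \<open>- 1/3\<close> at some unit vector \<open>e\<close>;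
  \<open>zero_costs_energy\<close> is applied to \<open>g = e \<bullet> v e + 1/3\<close>.\<close>

lemma contact_points_carry_energy:
  fixes v D :: "real^'n::finite \<Rightarrow> real^3^3"
  assumes v: "in_H2 v" and phy: "AE x in torus_measure. v x \<in> Qphy"
    and D: "L2_class D" "AE x in torus_measure. DQf (v x) = D x" and n3: "CARD('n) \<le> 3"
  obtains u \<omega> \<kappa> where "continuous_rep v u" "integrable torus_measure \<omega>" "\<And>y. (0::real) \<le> \<omega> y" "\<kappa> > 0"
    "\<And>x r. x \<in> contact_set u \<Longrightarrow> 0 < r \<Longrightarrow> r < 1/2 \<Longrightarrow>
       \<kappa> * r powr (real CARD('n) - 2) \<le> (\<integral>y. indicator (torus_ball x r) y * \<omega> y \<partial>torus_measure)"
proof -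
  let ?c0 = "profile_mass TYPE('n)"
  obtain h where h: "in_L2 h" "weak_laplacian v h" by (rule H2_weak_laplacian[OF v])
  have L2v: "in_L2 v" using v by (simp add: in_H2_def in_H1_def)
  note vi = in_L2_integrable(1)[OF L2v] and hi = in_L2_integrable(1)[OF h(1)] and h2 = in_L2_integrable(2)[OF h(1)]
  show ?thesis
  proof (rule continuous_representative[OF h(2) vi hi h2 n3], goal_cases)
    case (1 u)
    note u = 1
  define K where "K = 9 + 8 * exp (4::real)"
  define F where "F y = K * (1 + norm (D y))" for y
  define H where "H y = (norm (h y))\<^sup>2" for y
  define \<omega> where "\<omega> y = H y + (F y)\<^sup>2" for y
  have iF: "integrable torus_measure (\<lambda>y. (F y)\<^sup>2)"
  proof -
    have "D \<in> borel_measurable torus_measure" using D(1) by (simp add: L2_class_def)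
    from measurable_compose[OF this borel_measurable_norm]
    have "L2_class (\<lambda>y. norm (D y))" using D(1) by (simp add: L2_class_def)
    moreover have "L2_class (\<lambda>y :: real^'n. 1 :: real)" by (simp add: L2_class_def)
    ultimately have "L2_class F" unfolding F_def by (intro L2_class_cmult L2_class_add)
    thus ?thesis by (simp add: L2_class_def)
  qed
  have iH: "integrable torus_measure H" unfolding H_def by (rule h2)
  show ?thesis
  proof (rule zero_costs_energy[where 'n='n], goal_cases)
    case (1 \<kappa>)
    note \<kappa> = 1
  show ?thesis
  proof (rule that[of u \<omega> \<kappa>])
    show "continuous_rep v u" using u by (simp add: continuous_rep_def)
    show "integrable torus_measure \<omega>" unfolding \<omega>_def using iH iF by simp
    show "0 \<le> \<omega> y" for y by (simp add: \<omega>_def H_def)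
    show "\<kappa> > 0" by (rule \<kappa>(1))
    fix x :: "real^'n" and r :: real
    assume x: "x \<in> contact_set u" and r: "0 < r" "r < 1/2"
    have "u x \<notin> Qphy" using x by (simp add: contact_set_def singular_potential_infinite_iff)
    from not_Qphy_direction[OF mollify_limit_Qphy_closure(1)[OF vi phy u(4)] mollify_limit_Qphy_closure(2)[OF vi phy u(4)] this]
    obtain e where e: "norm e = 1" "e \<bullet> (u x *v e) = - 1/3" .
    define g where "g y = tsq e \<bullet> v y + 1/3" for y
    have gi: "integrable torus_measure g" unfolding g_def using vi by simp
    have gF: "AE y in torus_measure. 0 \<le> g y \<and> 1 \<le> F y * g y"
      using phy D(2)
    proof eventually_elim
      case (elim y)
      have gy: "g y = e \<bullet> (v y *v e) + 1/3" by (simp add: g_def inner_tsq inner_commute[of "tsq e"])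
      have "1 \<le> K * (1 + norm (DQf (v y))) * g y"
        using DQf_blowup[OF elim(1) e(1)] by (simp add: gy K_def)
      moreover have "0 \<le> g y" using elim(1) e(1) by (auto simp: gy Qphy_iff dest: spec[of _ e])
      ultimately show ?case by (simp add: F_def elim(2))
    qed
    have avg: "mollify r g x \<le> r powr (2 - CARD('n) / 2) *
         (c * (\<integral>y. indicator (torus_ball x r) y * H y \<partial>torus_measure) + unit_ball_vol CARD('n) / c)" if c: "c > 0" for c
    proof -
      let ?p = "\<lambda>y. profile r (wrap (y - x))"
      have one: "integrable torus_measure (\<lambda>x::real^'n. 1::real)" by simp
      have ip: "integrable torus_measure (\<lambda>y. 1/3 * ?p y)" using integrable_mollify[OF one r(1)] by simp
      have ipv: "integrable torus_measure (\<lambda>y. tsq e \<bullet> (?p y *\<^sub>R v y))"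
        using integrable_mollify[OF vi r(1), of x] by (rule integrable_inner_right)
      have "mollify r g x = (\<integral>y. tsq e \<bullet> (?p y *\<^sub>R v y) + 1/3 * ?p y \<partial>torus_measure)"
        unfolding mollify_def g_def by (intro Bochner_Integration.integral_cong) (auto simp: algebra_simps)
      also have "\<dots> = (\<integral>y. tsq e \<bullet> (?p y *\<^sub>R v y) \<partial>torus_measure) + (\<integral>y. 1/3 * ?p y \<partial>torus_measure)"
        by (rule Bochner_Integration.integral_add[OF ipv ip])
      also have "(\<integral>y. 1/3 * ?p y \<partial>torus_measure) = ?c0 / 3"
        using integral_profile[OF r, of x] by simp
      also have "(\<integral>y. tsq e \<bullet> (?p y *\<^sub>R v y) \<partial>torus_measure) = tsq e \<bullet> mollify r v x"
        unfolding mollify_def by (rule integral_inner_right) (rule integrable_mollify[OF vi r(1)])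
      also have "tsq e \<bullet> mollify r v x + ?c0 / 3 = tsq e \<bullet> (mollify r v x - ?c0 *\<^sub>R u x)"
        using e(2) by (simp add: inner_diff_right inner_commute[of "tsq e" "u x"] inner_tsq)
      also have "\<dots> \<le> norm (tsq e) * norm (mollify r v x - ?c0 *\<^sub>R u x)" by (rule norm_cauchy_schwarz)
      also have "\<dots> = norm (mollify r v x - ?c0 *\<^sub>R u x)" using e(1) by (simp add: norm_tsq)
      also note u(5)[OF r c]
      finally show ?thesis by (simp add: H_def)
    qed
    show "\<kappa> * r powr (real CARD('n) - 2) \<le> (\<integral>y. indicator (torus_ball x r) y * \<omega> y \<partial>torus_measure)"
      unfolding \<omega>_def by (rule \<kappa>(2)[OF gi iF iH _ gF r avg]) (auto simp: H_def)
  qed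
  qed
  qed
qed

lemma integral_torus_ball_tendsto_0:
  fixes \<omega> :: "real^'n::finite \<Rightarrow> real"
  assumes w: "integrable torus_measure \<omega>" and x: "x \<in> unit_cell"
  shows "(\<lambda>m. \<integral>y. indicator (torus_ball x (mesh m)) y * \<omega> y \<partial>torus_measure) \<longlonglongrightarrow> 0"
proof -
  have "(\<lambda>m. \<integral>y. indicator (torus_ball x (mesh m)) y * \<omega> y \<partial>torus_measure) \<longlonglongrightarrow> (\<integral>y. 0 \<partial>(torus_measure :: (real^'n) measure))"
  proof (rule integral_dominated_convergence[where w="\<lambda>y. \<bar>\<omega> y\<bar>"])
    have "AE y in lebesgue. y \<noteq> x" by (intro AE_completion AE_lborel_singleton)
    hence "AE y in torus_measure. y \<noteq> x" by (subst AE_restrict_space_iff) (auto elim: eventually_mono)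
    moreover have "AE y in torus_measure. y \<in> (unit_cell :: (real^'n) set)" by (rule AE_I2) simp
    ultimately show "AE y in torus_measure. (\<lambda>m. indicator (torus_ball x (mesh m)) y * \<omega> y) \<longlonglongrightarrow> 0"
    proof eventually_elim
      case (elim y)
      have "wrap (y - x) \<noteq> 0"
      proof
        assume "wrap (y - x) = 0"
        hence "\<And>i. (y - x) $ i \<in> \<int>" using wrap_diff_integer[of "y - x"] by simp
        then obtain k where k: "y - x = lattice_vec k" by (rule lattice_vec_cases)
        hence "x + lattice_vec k \<in> unit_cell" using elim by (simp flip: k)
        from unit_cell_lattice_unique[OF x this] have "y - x = 0" by (simp add: k)
        thus False using elim by simp
      qed
      hence "norm (wrap (y - x)) > 0" by simp
      hence "\<forall>\<^sub>F m in sequentially. mesh m < norm (wrap (y - x))" using mesh(3) order_tendstoD(2) by blast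
      hence "\<forall>\<^sub>F m in sequentially. indicator (torus_ball x (mesh m)) y * \<omega> y = 0"
        by eventually_elim (simp add: torus_ball_def)
      thus ?case by (rule tendsto_eventually)
    qed
    show "(\<lambda>y. indicator (torus_ball x (mesh m)) y * \<omega> y) \<in> borel_measurable torus_measure" for m
      using w by (intro borel_measurable_times borel_measurable_indicator torus_ball_sets) auto
    show "AE y in torus_measure. norm (indicator (torus_ball x (mesh m)) y * \<omega> y) \<le> \<bar>\<omega> y\<bar>" for m
      by (intro AE_I2) (auto simp: indicator_def)
  qed (use w in auto)
  thus ?thesis by simp
qed

text \<open>In dimension two the lower bound for the energy in small balls does not decay, although points have
  measure zero. In dimension three it decays like the radius, which limits packings.\<close>

lemma contact_set_small:
  fixes v D :: "real^'n::finite \<Rightarrow> real^3^3"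
  assumes v: "in_H2 v" and phy: "AE x in torus_measure. v x \<in> Qphy"
    and D: "L2_class D" "AE x in torus_measure. DQf (v x) = D x" and n: "CARD('n) \<in> {2, 3}"
  shows "\<exists>u. continuous_rep v u \<and> (CARD('n) = 2 \<longrightarrow> contact_set u = {}) \<and>
     (CARD('n) = 3 \<longrightarrow> hausdorff_dim torus_dist (contact_set u) \<le> 1)"
proof -
  have n3: "CARD('n) \<le> 3" using n by auto
  show ?thesis
  proof (rule contact_points_carry_energy[OF v phy D n3], goal_cases)
    case (1 u \<omega> \<kappa>)
    note u = 1(1) and \<omega> = 1(2,3) and \<kappa> = 1(4) and low = 1(5)
  have "contact_set u = {}" if n2: "CARD('n) = 2"
  proof (rule ccontr)
    assume "contact_set u \<noteq> {}"
    then obtain x where x: "x \<in> contact_set u" by blast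
    have "\<kappa> \<le> (\<integral>y. indicator (torus_ball x (mesh m)) y * \<omega> y \<partial>torus_measure)" for m
      using low[OF x mesh(1,2), of m] mesh(1)[of m] n2 by simp
    moreover have "(\<lambda>m. \<integral>y. indicator (torus_ball x (mesh m)) y * \<omega> y \<partial>torus_measure) \<longlonglongrightarrow> 0"
      using x by (intro integral_torus_ball_tendsto_0 \<omega>) (simp add: contact_set_def)
    ultimately have "\<kappa> \<le> 0" by (intro LIMSEQ_le_const) auto
    thus False using \<kappa> by simp
  qed
  moreover have "hausdorff_dim torus_dist (contact_set u) \<le> 1" if n3: "CARD('n) = 3"
  proof (rule hausdorff_dim_le_1)
    let ?W = "\<integral>y. \<omega> y \<partial>torus_measure"
    show "0 \<le> ?W / \<kappa>" using \<kappa> \<omega> by (intro divide_nonneg_pos Bochner_Integration.integral_nonneg)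
    fix r :: real assume r: "0 < r" "r < 1/2"
    have "\<kappa> * r \<le> (\<integral>y. indicator (torus_ball x r) y * \<omega> y \<partial>torus_measure)" if "x \<in> contact_set u" for x
      using low[OF that r] n3 r by simp
    then obtain B where B: "finite B" "real (card B) * (\<kappa> * r) \<le> ?W" "\<forall>y\<in>contact_set u. \<exists>x\<in>B. torus_dist y x < 2 * r"
      using packing_cover[OF \<omega> r(1) mult_pos_pos[OF \<kappa> r(1)]] by blast
    have "real (card B) * r \<le> ?W / \<kappa>" using B(2) \<kappa> by (simp add: field_simps)
    thus "\<exists>B. finite B \<and> real (card B) * r \<le> ?W / \<kappa> \<and> (\<forall>y\<in>contact_set u. \<exists>x\<in>B. torus_dist y x < 2 * r)"
      using B by blast
  qed
  ultimately show ?thesis using u by blast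
  qed
qed

theorem corollary1p1:
  fixes lab :: "'n::finite \<Rightarrow> 3"
    and L1 L2 L3 \<alpha> T :: real
    and Q0 :: "real^'n \<Rightarrow> real^3^3"
    and Q :: "real \<Rightarrow> real^'n \<Rightarrow> real^3^3"
  assumes n: "CARD('n) \<in> {2, 3}"
    and lab: "bij_betw lab UNIV (of_nat ` {1..CARD('n)})"
    and alpha: "\<alpha> > 0"
    and L: "L1 > 0" "L1 > \<bar>L2 + L3\<bar>"
    and Q0: "in_H1 Q0" "AE x in lebesgue_on unit_cell. Q0 x \<in> Qphy"
    and finite_energy: "energy lab L1 L2 L3 \<alpha> Q0 < \<infinity>"
    and finite_variation: "\<exists>G. in_L2 G \<and> distr_variation lab L1 L2 L3 \<alpha> Q0 G"
    and solution: "global_strong_solution lab L1 L2 L3 \<alpha> Q0 Q"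
    and T: "T > 0"
  shows "AE t in lebesgue_on {0<..<T}. \<exists>u. continuous_rep (Q t) u \<and>
           (CARD('n) = 2 \<longrightarrow> contact_set u = {}) \<and>
           (CARD('n) = 3 \<longrightarrow> hausdorff_dim torus_dist (contact_set u) \<le> 1)"
proof -
  have "inj lab" using lab by (simp add: bij_betw_def)
  have "strong_solution_on lab L1 L2 L3 \<alpha> T Q" using solution T by (simp add: global_strong_solution_def)
  then obtain P where phy: "AE (t, x) in space_time T. Q t x \<in> Qphy"
    and H2: "AE t in lebesgue_on {0<..<T}. in_H2 (Q t)"
    and P: "(\<lambda>(t, x). P t x) \<in> borel_measurable (space_time T)"
      "integrable (space_time T) (\<lambda>(t, x). (norm (P t x))\<^sup>2)"
    and eq: "AE t in lebesgue_on {0<..<T}. AE x in torus_measure. P t x = - variation lab L1 L2 L3 \<alpha> (Q t) x"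
    unfolding strong_solution_on_def by blast
  have "AE t in lebesgue_on {0<..<T}. AE x in torus_measure. Q t x \<in> Qphy"
    using AE_lebesgue_on_slices[OF phy[unfolded space_time_def]] by simp
  with H2 eq AE_slice_L2_class[OF P] show ?thesis
  proof eventually_elim
    case (elim t)
    obtain p where p: "L2_class p" "AE x in torus_measure. P t x = p x" using elim(3) by blast
    have "AE x in torus_measure. p x = - variation lab L1 L2 L3 \<alpha> (Q t) x"
      using p(2) elim(2) by eventually_elim simp
    then obtain D where "L2_class D" "AE x in torus_measure. DQf (Q t x) = D x"
      using DQf_L2_class[OF elim(1) \<open>inj lab\<close> p(1)] by blast
    thus ?case using contact_set_small[OF elim(1) elim(4)] n by blast
  qed
qed

end
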